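(* There is an absolute constant $C>0$ such that for every $0<\varepsilon<1$ there is a randomized $(1-\varepsilon)$-approximation algorithm for the maximum matching problem on bipartite graphs whose sensitivity on every bipartite graph of maximum degree $\Delta$ is at most $\Delta^{C/\varepsilon}$, and whose running time is $\tilde O(\varepsilon^{-3} n^{16} m^3\log^3\Delta)$.
   Context: Graphs are finite, simple and undirected; for an input graph $G=(V,E)$, $n=|V|$, $m=|E|$, $\Delta$ is the maximum degree of $G$, and $\nu(G)$ is the maximum size of a matching in $G$. A randomized algorithm $A$ outputs, on input $G$, a random matching $A(G)\subseteq E$; it is a $(1-\varepsilon)$-approximation algorithm (on a graph class) if $\mathbb{E}[|A(G)|]\ge(1-\varepsilon)\nu(G)$ for every graph $G$ in the class. For distributions $\mu,\mu'$ on subsets of a finite set $E$, $W(\mu,\mu')=\inf_{\pi}\mathbb{E}_{(X,Y)\sim\pi}|X\triangle Y|$ over all couplings $\pi$ of $\mu,\mu'$. The sensitivity of $A$ on $G$ is $\max_{e\in E}W(A(G),A(G-e))$, where $G-e$ is $G$ with the edge $e$ deleted. $\tilde O(\cdot)$ hides polylogarithmic factors in $n$.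
   Formalization: In the running-time bound, n, m, log Δ and log n are replaced by their maxima with 1, since for Δ ≤ 1 the literal bound is 0 and no algorithm meets it; for Δ ≥ 2 nothing changes. *)

theory Defs
  imports "HOL-Probability.Probability" "HOL-Library.Log_Nat"
begin

section \<open>Graphs and matchings\<close>

definition simple_graph :: "'v set \<Rightarrow> 'v set set \<Rightarrow> bool" where
  "simple_graph V E \<longleftrightarrow> finite V \<and> (\<forall>e\<in>E. e \<subseteq> V \<and> card e = 2)"

definition bipartite_graph :: "'v set \<Rightarrow> 'v set set \<Rightarrow> bool" where
  "bipartite_graph V E \<longleftrightarrow> simple_graph V E \<and>
     (\<exists>L R. L \<union> R = V \<and> L \<inter> R = {} \<and> (\<forall>e\<in>E. \<exists>u\<in>L. \<exists>v\<in>R. e = {u, v}))"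

definition deg :: "'v set set \<Rightarrow> 'v \<Rightarrow> nat" where
  "deg E v = card {e \<in> E. v \<in> e}"

definition max_degree :: "'v set \<Rightarrow> 'v set set \<Rightarrow> nat" where
  "max_degree V E = Max (insert 0 (deg E ` V))"

definition matching :: "'v set set \<Rightarrow> 'v set set \<Rightarrow> bool" where
  "matching E M \<longleftrightarrow> M \<subseteq> E \<and> (\<forall>e\<in>M. \<forall>f\<in>M. e \<noteq> f \<longrightarrow> e \<inter> f = {})"

definition matching_number :: "'v set set \<Rightarrow> nat" where
  "matching_number E = Max (card ` {M. matching E M})"

section \<open>Sensitivity\<close>

definition couplings :: "'a pmf \<Rightarrow> 'a pmf \<Rightarrow> ('a \<times> 'a) pmf set" where
  "couplings \<mu> \<mu>' = {\<pi>. map_pmf fst \<pi> = \<mu> \<and> map_pmf snd \<pi> = \<mu>'}"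

definition wasserstein :: "'e set pmf \<Rightarrow> 'e set pmf \<Rightarrow> real" where
  "wasserstein \<mu> \<mu>' =
     (INF \<pi>\<in>couplings \<mu> \<mu>'. measure_pmf.expectation \<pi> (\<lambda>(X, Y). real (card (sym_diff X Y))))"

text \<open>The vertex set is left unchanged when an edge is deleted. The inserted \<open>0\<close> only matters for
  edgeless graphs, since \<^const>\<open>wasserstein\<close> is nonnegative.\<close>

definition sensitivity :: "('e set \<Rightarrow> 'e set pmf) \<Rightarrow> 'e set \<Rightarrow> real" where
  "sensitivity A E = Max (insert 0 ((\<lambda>e. wasserstein (A E) (A (E - {e}))) ` E))"

section \<open>A randomized random-access machine with logarithmic cost\<close>

text \<open>The memory consists of integer arrays \<open>s a\<close>, unbounded in both directions; a program can
  refer to only finitely many of them, while the index into an array is computed. Arithmetic and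
  memory accesses are charged the bit lengths of the numbers and indices involved.\<close>

type_synonym memory = "nat \<Rightarrow> int \<Rightarrow> int"

datatype expr =
    Lit int
  | Read nat expr
  | Plus expr expr
  | Minus expr expr
  | Times expr expr
  | Div expr expr

datatype com =
    Skip
  | Write nat expr expr
  | Draw nat expr expr
  | Seq com com
  | IfPos expr com com
  | WhilePos expr com

definition bits :: "int \<Rightarrow> nat" where
  "bits k = 1 + floorlog 2 (nat \<bar>k\<bar>)"

fun val :: "expr \<Rightarrow> memory \<Rightarrow> int" where
  "val (Lit k) s = k"
| "val (Read a e) s = s a (val e s)"
| "val (Plus e f) s = val e s + val f s"
| "val (Minus e f) s = val e s - val f s"
| "val (Times e f) s = val e s * val f s"
| "val (Div e f) s = val e s div val f s"

fun exp_cost :: "expr \<Rightarrow> memory \<Rightarrow> nat" where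
  "exp_cost (Lit k) s = bits k"
| "exp_cost (Read a e) s = exp_cost e s + bits (val e s) + bits (s a (val e s))"
| "exp_cost (Plus e f) s = exp_cost e s + exp_cost f s + bits (val e s) + bits (val f s)"
| "exp_cost (Minus e f) s = exp_cost e s + exp_cost f s + bits (val e s) + bits (val f s)"
| "exp_cost (Times e f) s = exp_cost e s + exp_cost f s + bits (val e s) + bits (val f s)"
| "exp_cost (Div e f) s = exp_cost e s + exp_cost f s + bits (val e s) + bits (val f s)"

definition set_cell :: "nat \<Rightarrow> int \<Rightarrow> int \<Rightarrow> memory \<Rightarrow> memory" where
  "set_cell a i x s = s(a := (s a)(i := x))"

text \<open>\<open>exec c s\<close> is the joint subdistribution of the running time and the final memory; the missing
  mass is the probability of divergence. \<open>Draw a i e\<close> stores a uniformly random element of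
  \<open>{0..<e}\<close> in \<open>a[i]\<close>, and aborts (which also counts as missing mass) if that range is empty.\<close>

partial_function (spmf) loop ::
    "expr \<Rightarrow> (memory \<Rightarrow> (nat \<times> memory) spmf) \<Rightarrow> memory \<Rightarrow> (nat \<times> memory) spmf" where
  "loop b body s =
     (if 0 < val b s then
        bind_spmf (body s) (\<lambda>(t1, s1).
        bind_spmf (loop b body s1) (\<lambda>(t2, s2).
        return_spmf (exp_cost b s + t1 + t2, s2)))
      else return_spmf (exp_cost b s, s))"

primrec exec :: "com \<Rightarrow> memory \<Rightarrow> (nat \<times> memory) spmf" where
  "exec Skip = (\<lambda>s. return_spmf (1, s))"
| "exec (Write a i e) = (\<lambda>s.
     return_spmf (exp_cost i s + exp_cost e s + bits (val i s) + bits (val e s),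
                  set_cell a (val i s) (val e s) s))"
| "exec (Draw a i e) = (\<lambda>s.
     bind_spmf (spmf_of_set {0..<val e s}) (\<lambda>x.
     return_spmf (exp_cost i s + exp_cost e s + bits (val i s) + bits (val e s),
                  set_cell a (val i s) x s)))"
| "exec (Seq c1 c2) = (\<lambda>s.
     bind_spmf (exec c1 s) (\<lambda>(t1, s1).
     bind_spmf (exec c2 s1) (\<lambda>(t2, s2).
     return_spmf (t1 + t2, s2))))"
| "exec (IfPos b c1 c2) = (\<lambda>s.
     bind_spmf (if 0 < val b s then exec c1 s else exec c2 s) (\<lambda>(t, s').
     return_spmf (exp_cost b s + t, s')))"
| "exec (WhilePos b c) = loop b (exec c)"

section \<open>Randomized matching algorithms\<close>

text \<open>An input graph has vertex set \<open>{..<n}\<close>. Cell \<open>0\<close> of array \<open>0\<close> holds \<open>n\<close>, array \<open>1\<close> holds the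
  adjacency matrix row by row, and all other cells are \<open>0\<close>. The resulting edge set is read off the
  strict upper triangle of a matrix stored in the same way in array \<open>2\<close>.\<close>

definition input_memory :: "nat \<Rightarrow> nat set set \<Rightarrow> memory" where
  "input_memory n E a i =
     (if a = 0 \<and> i = 0 then int n
      else if a = 1 \<and> (\<exists>u<n. \<exists>v<n. i = int (u * n + v) \<and> {u, v} \<in> E) then 1
      else 0)"

definition output_edges :: "nat \<Rightarrow> memory \<Rightarrow> nat set set" where
  "output_edges n s = {{u, v} | u v. u < v \<and> v < n \<and> s 2 (int (u * n + v)) \<noteq> 0}"

definition run :: "com \<Rightarrow> nat \<Rightarrow> nat set set \<Rightarrow> (nat \<times> memory) spmf" where
  "run P n E = exec P (input_memory n E)"

text \<open>The output distribution; only meaningful if \<open>run P n E\<close> is lossless.\<close>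

definition alg_output :: "com \<Rightarrow> nat \<Rightarrow> nat set set \<Rightarrow> nat set set pmf" where
  "alg_output P n E = map_pmf (\<lambda>r. output_edges n (snd (the r))) (run P n E)"

definition matching_algorithm_on :: "(nat \<Rightarrow> nat set set \<Rightarrow> bool) \<Rightarrow> com \<Rightarrow> bool" where
  "matching_algorithm_on \<G> P \<longleftrightarrow>
     (\<forall>n E. \<G> n E \<longrightarrow> lossless_spmf (run P n E) \<and> (\<forall>M\<in>set_pmf (alg_output P n E). matching E M))"

definition approximation_algorithm_on ::
    "(nat \<Rightarrow> nat set set \<Rightarrow> bool) \<Rightarrow> real \<Rightarrow> com \<Rightarrow> bool" where
  "approximation_algorithm_on \<G> \<alpha> P \<longleftrightarrow> matching_algorithm_on \<G> P \<and>
     (\<forall>n E. \<G> n E \<longrightarrow>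
        \<alpha> * real (matching_number E)
          \<le> measure_pmf.expectation (alg_output P n E) (\<lambda>M. real (card M)))"

text \<open>Worst case over all random choices.\<close>

definition runs_within :: "com \<Rightarrow> nat \<Rightarrow> nat set set \<Rightarrow> real \<Rightarrow> bool" where
  "runs_within P n E T \<longleftrightarrow> (\<forall>(t, s)\<in>set_spmf (run P n E). real t \<le> T)"

text \<open>The maxima with \<open>1\<close> have no effect on graphs of maximum degree at least \<open>2\<close>; without them the
  bound would be \<open>0\<close> on edgeless graphs and on graphs of maximum degree \<open>1\<close>.\<close>

definition time_bound :: "real \<Rightarrow> nat \<Rightarrow> nat set set \<Rightarrow> real" where
  "time_bound \<epsilon> n E =
     (1 / \<epsilon>) ^ 3 * real (max 1 n) ^ 16 * real (max 1 (card E)) ^ 3 *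
     (max 1 (log 2 (real (max_degree {..<n} E)))) ^ 3"

definition polylog :: "nat \<Rightarrow> nat \<Rightarrow> real" where
  "polylog k n = (max 1 (log 2 (real n))) ^ k"

end

theory Submission
  imports Defs
begin

text \<open>
  In the bipartite double cover, where every vertex acts both as a proposer and as a receiver, run
  deferred acceptance: a proposer goes through its neighbours \<open>k\<close> times, at level \<open>1, \<dots>, k\<close>, and a
  receiver keeps the proposal of highest level. Whenever a proposal to \<open>w\<close> is rejected, its proposer
  quits for good with probability about \<open>1 / (k\<^sup>2 deg w)\<close>. The outcome is a least fixed point, hence
  monotone in the set of proposers. The levels are an almost feasible dual solution, so only a
  fraction \<open>O(1/k)\<close> of the optimum is lost; and since one additional proposer creates at most one
  additional quitter while every rejection yields a quitter with probability at least
  \<open>1 / (2 k\<^sup>2 \<Delta>)\<close>, it changes only \<open>O(k\<^sup>2 \<Delta>)\<close> matched pairs in expectation.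

  In \<open>G\<close> the result is a union of directed paths and even cycles. Every vertex guesses its side of
  the bipartition from the parity of its distance to the vertex of least random label among its
  \<open>O(k)\<close> nearest predecessors, and one keeps the arcs that lead from one fixed side to the other.
  The sensitivity is polynomial in \<open>k\<close> and \<open>\<Delta>\<close>, which is below \<open>\<Delta> powr O(1/\<epsilon>)\<close> for \<open>\<Delta> \<ge> 2\<close>.
\<close>

section \<open>Deferred acceptance with quitting proposers\<close>

text \<open>In plain deferred acceptance one extra proposer can start a chain of displacements that
  runs through the whole graph. Quitting cuts it off, and its rate is forced from both sides: a
  receiver \<open>w\<close> that holds a proposal has seen at most \<open>k * deg w\<close> of them,
  so a rate of about 1/(k^2 deg w) costs only a 1/k fraction of the held proposals, while it stays
  of order at least 1/(k^2 \<Delta>). The rate uses the local quantity \<open>deg w\<close>, and the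
  range of the coins depends on \<open>n\<close> and \<open>k\<close> alone. Deleting an edge
  therefore disturbs only the neighbours of its ends, and the two runs can be coupled by sharing all
  random numbers. The double cover appears because no bipartition is supplied, and one computed from
  the graph could flip on a whole component when an edge disappears; hence the sides are guessed
  locally. At \<Delta> = 1 the required bound is exactly 1, which the general polynomial estimate
  exceeds; there the algorithm returns the whole edge set.\<close>

text \<open>Position \<open>p\<close> of a proposer's list stands for the receiver \<open>p mod n\<close> at level \<open>p div n\<close>;
  receivers that are not adjacent are skipped. For proposals \<open>(u, p)\<close> to the same receiver, the key
  \<open>p * n + u\<close> orders by level first and then by proposer.\<close>

locale deferred_acceptance =
  fixes n k :: nat and adj :: "nat \<Rightarrow> nat \<Rightarrow> bool"
begin

text \<open>Positions already passed are kept together with the current one. They never win again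
  (\<open>stage_passed\<close>), but keeping them makes the set monotone in \<open>pos\<close>, on
  which all comparisons below rest.\<close>

definition proposals :: "nat set \<Rightarrow> (nat \<Rightarrow> nat) \<Rightarrow> (nat \<times> nat) set" where
  "proposals S pos = {(u, p). u \<in> S \<and> p \<le> pos u \<and> p < k * n \<and> adj u (p mod n)}"

definition outbid :: "nat set \<Rightarrow> (nat \<Rightarrow> nat) \<Rightarrow> nat \<Rightarrow> nat \<Rightarrow> bool" where
  "outbid S pos u p \<longleftrightarrow>
     (\<exists>u' p'. (u', p') \<in> proposals S pos \<and> p' mod n = p mod n \<and> p * n + u < p' * n + u')"

text \<open>All proposers move simultaneously and by at most one position. A rejected proposer whose
  coin \<open>q\<close> says quit stays at the rejected position for ever, so quitters need no
  separate state.\<close>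

definition advance ::
    "nat set \<Rightarrow> (nat \<Rightarrow> nat \<Rightarrow> bool) \<Rightarrow> (nat \<Rightarrow> nat) \<Rightarrow> nat \<Rightarrow> nat" where
  "advance S q pos u =
     (if u \<in> S \<and> pos u < k * n \<and>
         (adj u (pos u mod n) \<longrightarrow> outbid S pos u (pos u) \<and> \<not> q u (pos u))
      then Suc (pos u) else pos u)"

definition stage :: "nat set \<Rightarrow> (nat \<Rightarrow> nat \<Rightarrow> bool) \<Rightarrow> nat \<Rightarrow> nat \<Rightarrow> nat" where
  "stage S q t = (advance S q ^^ t) (\<lambda>_. 0)"

definition final :: "nat set \<Rightarrow> (nat \<Rightarrow> nat \<Rightarrow> bool) \<Rightarrow> nat \<Rightarrow> nat" where
  "final S q = stage S q (n * (k * n))"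

section \<open>Monotonicity and the least fixed point\<close>

lemma stage_0 [simp]: "stage S q 0 u = 0"
  by (simp add: stage_def)

lemma stage_Suc: "stage S q (Suc t) = advance S q (stage S q t)"
  by (simp add: stage_def)

lemma proposals_mono: "S \<subseteq> S' \<Longrightarrow> pos \<le> pos' \<Longrightarrow> proposals S pos \<subseteq> proposals S' pos'"
  by (auto simp: proposals_def le_fun_def intro: order_trans)

lemma outbid_mono: "outbid S pos u p \<Longrightarrow> S \<subseteq> S' \<Longrightarrow> pos \<le> pos' \<Longrightarrow> outbid S' pos' u p"
  unfolding outbid_def using proposals_mono[of S S' pos pos'] by blast

lemma le_advance: "pos \<le> advance S q pos"
  by (auto simp: le_fun_def advance_def)

text \<open>More competitors and fewer quits can only push positions forward. Where the two
  positions of \<open>u\<close> already differ, the smaller one cannot overtake, since a step moves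
  by at most one.\<close>

lemma advance_mono:
  assumes "S \<subseteq> S'" "pos \<le> pos'" "\<And>u p. q' u p \<Longrightarrow> q u p"
  shows "advance S q pos \<le> advance S' q' pos'"
proof (rule le_funI)
  fix u
  have le: "pos u \<le> pos' u" using assms(2) by (simp add: le_fun_def)
  show "advance S q pos u \<le> advance S' q' pos' u"
  proof (cases "pos u = pos' u")
    case True
    then show ?thesis
      using assms(1,3) outbid_mono[OF _ assms(1,2), of u "pos u"] by (auto simp: advance_def)
  next
    case False
    then show ?thesis using le by (auto simp: advance_def)
  qed
qed

lemma stage_mono_param:
  assumes "S \<subseteq> S'" "\<And>u p. q' u p \<Longrightarrow> q u p"
  shows "stage S q t \<le> stage S' q' t"
proof (induction t)
  case (Suc t)
  then show ?case unfolding stage_Suc by (intro advance_mono assms)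
qed (simp add: le_fun_def)

lemmas final_mono = stage_mono_param[where t = "n * (k * n)", folded final_def]

lemma stage_mono: "s \<le> t \<Longrightarrow> stage S q s \<le> stage S q t"
  by (rule lift_Suc_mono_le[of "stage S q"]) (auto simp: stage_Suc le_advance)

lemma stage_le: "stage S q t u \<le> k * n"
  by (induction t) (auto simp: stage_Suc advance_def)

lemma stage_outside: "u \<notin> S \<Longrightarrow> stage S q t u = 0"
  by (induction t) (auto simp: stage_Suc advance_def)

lemma stage_passed:
  assumes "p < stage S q t u" "adj u (p mod n)"
  shows "outbid S (stage S q t) u p \<and> \<not> q u p"
  using assms(1)
proof (induction t)
  case (Suc t)
  have le: "stage S q t \<le> stage S q (Suc t)" by (simp add: stage_mono)
  have "outbid S (stage S q t) u p \<and> \<not> q u p"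
  proof (cases "p < stage S q t u")
    case False
    with Suc.prems have "p = stage S q t u" "stage S q (Suc t) u = Suc (stage S q t u)"
      by (auto simp: stage_Suc advance_def split: if_splits)
    then show ?thesis using assms(2) by (auto simp: stage_Suc advance_def split: if_splits)
  qed (use Suc.IH in auto)
  then show ?case using outbid_mono[OF _ order_refl le] by blast
qed simp

text \<open>The iteration starts at the zero function, below every fixed point. Leastness is what
  later allows the outcomes for two coin assignments to be compared.\<close>

lemma stage_least:
  assumes "advance S q pos = pos"
  shows "stage S q t \<le> pos"
proof (induction t)
  case (Suc t)
  then have "advance S q (stage S q t) \<le> advance S q pos" by (intro advance_mono) auto
  then show ?case by (simp add: assms stage_Suc)
qed (simp add: le_fun_def)

text \<open>The sum of the positions is at most \<open>n * (k * n)\<close> and grows in every round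
  that changes anything, so the process is stationary by the time the rounds run out.\<close>

lemma advance_final:
  assumes S: "S \<subseteq> {..<n}"
  shows "advance S q (final S q) = final S q"
proof -
  let ?N = "n * (k * n)"
  have step: "stage S q s = stage S q t" if "stage S q (Suc s) = stage S q s" "s \<le> t" for s t
    using that(2) that(1) by (induction rule: dec_induct) (auto simp: stage_Suc)
  have "\<exists>s\<le>?N. stage S q (Suc s) = stage S q s"
  proof (rule ccontr)
    assume *: "\<not> ?thesis"
    have sum_lt: "(\<Sum>u<n. stage S q s u) < (\<Sum>u<n. stage S q (Suc s) u)" if "s \<le> ?N" for s
    proof (rule sum_strict_mono_ex1)
      have le: "stage S q s u \<le> stage S q (Suc s) u" for u
        using stage_mono[of s "Suc s" S q] by (simp add: le_fun_def)
      then show "\<forall>u\<in>{..<n}. stage S q s u \<le> stage S q (Suc s) u" by blast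
      obtain u where u: "stage S q (Suc s) u \<noteq> stage S q s u" using * \<open>s \<le> ?N\<close> by blast
      then have "u \<in> S" using stage_outside[of u S q] by metis
      then show "\<exists>u\<in>{..<n}. stage S q s u < stage S q (Suc s) u"
        using u le[of u] S by (intro bexI[of _ u]) auto
    qed simp
    have "s \<le> (\<Sum>u<n. stage S q s u)" if "s \<le> Suc ?N" for s
      using that by (induction s) (use sum_lt in force)+
    from this[of "Suc ?N"] have "Suc ?N \<le> (\<Sum>u<n. stage S q (Suc ?N) u)" by simp
    also have "\<dots> \<le> (\<Sum>u<n. k * n)" by (intro sum_mono stage_le)
    finally show False by simp
  qed
  then obtain s where "s \<le> ?N" "stage S q (Suc s) = stage S q s" by blast
  from step[OF this(2,1)] step[OF this(2), of "Suc ?N"] this(1)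
  have "stage S q (Suc ?N) = stage S q ?N" by simp
  then show ?thesis by (simp add: final_def stage_Suc)
qed

lemma final_least: "advance S q pos = pos \<Longrightarrow> final S q \<le> pos"
  unfolding final_def by (rule stage_least)

lemma final_le: "final S q u \<le> k * n"
  unfolding final_def by (rule stage_le)

lemma final_passed:
  "p < final S q u \<Longrightarrow> adj u (p mod n) \<Longrightarrow> outbid S (final S q) u p"
  "p < final S q u \<Longrightarrow> adj u (p mod n) \<Longrightarrow> \<not> q u p"
  unfolding final_def using stage_passed by blast+

section \<open>The outcome of the process and its conservation law\<close>

definition rejections :: "nat set \<Rightarrow> (nat \<Rightarrow> nat \<Rightarrow> bool) \<Rightarrow> (nat \<times> nat) set" where
  "rejections S q = {(u, p) \<in> proposals S (final S q). outbid S (final S q) u p}"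

definition quitters :: "nat set \<Rightarrow> (nat \<Rightarrow> nat \<Rightarrow> bool) \<Rightarrow> (nat \<times> nat) set" where
  "quitters S q = {(u, p) \<in> rejections S q. q u p}"

definition held :: "nat set \<Rightarrow> (nat \<Rightarrow> nat \<Rightarrow> bool) \<Rightarrow> (nat \<times> nat) set" where
  "held S q = {(u, p) \<in> proposals S (final S q). \<not> outbid S (final S q) u p}"

definition exhausted :: "nat set \<Rightarrow> (nat \<Rightarrow> nat \<Rightarrow> bool) \<Rightarrow> nat set" where
  "exhausted S q = {u \<in> S. final S q u = k * n}"

definition arcs :: "nat set \<Rightarrow> (nat \<Rightarrow> nat \<Rightarrow> bool) \<Rightarrow> (nat \<times> nat) set" where
  "arcs S q = (\<lambda>(u, p). (u, p mod n)) ` held S q"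

lemma finite_proposals: "finite S \<Longrightarrow> finite (proposals S pos)"
  by (rule finite_subset[of _ "S \<times> {..<k * n}"]) (auto simp: proposals_def)

lemma finite_sets:
  assumes "finite S"
  shows "finite (rejections S q)" "finite (quitters S q)" "finite (held S q)"
    "finite (exhausted S q)" "finite (arcs S q)"
proof -
  note fin = finite_subset[OF _ finite_proposals[OF assms, of "final S q"]]
  show "finite (rejections S q)" by (rule fin) (auto simp: rejections_def)
  show "finite (quitters S q)" by (rule fin) (auto simp: quitters_def rejections_def)
  show *: "finite (held S q)" by (rule fin) (auto simp: held_def)
  show "finite (exhausted S q)" using assms by (simp add: exhausted_def)
  show "finite (arcs S q)" using * by (simp add: arcs_def)
qed

lemma held_pos: "(u, p) \<in> held S q \<Longrightarrow> p = final S q u"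
  using final_passed(1)[of p S q u] by (auto simp: held_def proposals_def le_less)

lemma quitters_pos: "(u, p) \<in> quitters S q \<Longrightarrow> p = final S q u"
  using final_passed(2)[of p S q u]
  by (auto simp: quitters_def rejections_def proposals_def le_less)

text \<open>At a fixed point of \<open>advance\<close> a proposer has only three reasons to stop:
  the end of its list, an accepted proposal, or a rejection whose coin says quit.\<close>

lemma final_cases:
  assumes "S \<subseteq> {..<n}" "u \<in> S"
  shows "u \<in> exhausted S q \<or> (u, final S q u) \<in> held S q \<or> (u, final S q u) \<in> quitters S q"
proof -
  have "advance S q (final S q) u = final S q u" by (simp add: advance_final assms(1))
  then show ?thesis using assms(2) final_le[of S q u]
    by (auto simp: advance_def exhausted_def held_def quitters_def rejections_def proposals_def
        split: if_splits)
qed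

text \<open>The conservation law that drives the sensitivity bound: each of the three summands turns
  out to be monotone in \<open>S\<close>, so one extra proposer can raise them by only one in
  total.\<close>

lemma card_partition:
  assumes S: "S \<subseteq> {..<n}"
  shows "card S = card (held S q) + card (quitters S q) + card (exhausted S q)"
proof -
  have fin: "finite S" using S finite_subset by blast
  let ?H = "fst ` held S q" and ?Q = "fst ` quitters S q" and ?X = "exhausted S q"
  have inj: "inj_on fst (held S q)" "inj_on fst (quitters S q)"
    by (rule inj_onI, metis held_pos quitters_pos prod.collapse)+
  have "S = ?H \<union> ?Q \<union> ?X"
  proof (intro equalityI subsetI)
    fix u assume "u \<in> S"
    from final_cases[OF S this, of q] show "u \<in> ?H \<union> ?Q \<union> ?X"
      by (metis UnCI fst_conv image_eqI)
  qed (auto simp: held_def quitters_def rejections_def exhausted_def proposals_def)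
  moreover have disj: "?H \<inter> ?Q = {}" "(?H \<union> ?Q) \<inter> ?X = {}"
  proof -
    have "u \<notin> ?X \<and> outbid S (final S q) u (final S q u)" if "u \<in> ?Q" for u
    proof -
      from that obtain p where p: "(u, p) \<in> quitters S q" by auto
      then show ?thesis using quitters_pos[OF p]
        by (auto simp: quitters_def rejections_def proposals_def exhausted_def)
    qed
    moreover have "u \<notin> ?X \<and> \<not> outbid S (final S q) u (final S q u)" if "u \<in> ?H" for u
    proof -
      from that obtain p where p: "(u, p) \<in> held S q" by auto
      then show ?thesis using held_pos[OF p]
        by (auto simp: held_def proposals_def exhausted_def)
    qed
    ultimately show "?H \<inter> ?Q = {}" "(?H \<union> ?Q) \<inter> ?X = {}" by blast+
  qed
  ultimately have "card S = card ?H + card ?Q + card ?X"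
    using finite_sets[OF fin] by (metis card_Un_disjoint finite_UnI finite_imageI)
  then show ?thesis using inj by (simp add: card_image)
qed

text \<open>Two held proposals at one receiver do not outbid each other, so their keys coincide; as
  proposers are below \<open>n\<close>, the key can be decoded.\<close>

lemma held_woman_unique:
  assumes "(u, p) \<in> held S q" "(u', p') \<in> held S q" "p mod n = p' mod n" "S \<subseteq> {..<n}"
  shows "(u, p) = (u', p')"
proof -
  have "p * n + u = p' * n + u'"
    using assms by (force simp: held_def outbid_def not_less dest: antisym)
  moreover have "u < n" "u' < n" using assms by (auto simp: held_def proposals_def)
  ultimately have "(p * n + u) div n = (p' * n + u') div n" "u < n" "u' < n" by simp_all
  then have "p = p'" by simp
  then show ?thesis using \<open>p * n + u = p' * n + u'\<close> by simp
qed

lemma ex_held: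
  assumes "(u, p) \<in> proposals S (final S q)" "S \<subseteq> {..<n}"
  obtains u' p' where "(u', p') \<in> held S q" "p' mod n = p mod n" "p \<le> p'"
proof -
  let ?A = "{x \<in> proposals S (final S q). snd x mod n = p mod n}"
  let ?f = "\<lambda>x. snd x * n + fst x"
  have "finite S" using assms(2) finite_subset by blast
  then have fin: "finite ?A" using finite_proposals by simp
  have ne: "?A \<noteq> {}" using assms(1) by auto
  have "Max (?f ` ?A) \<in> ?f ` ?A" using fin ne by (intro Max_in) auto
  then obtain x where x: "x \<in> ?A" "?f x = Max (?f ` ?A)" by (metis (no_types, lifting) imageE)
  have x2: "?f y \<le> ?f x" if "y \<in> ?A" for y
    unfolding x(2) using fin that by (intro Max_ge) auto
  obtain u' p' where [simp]: "x = (u', p')" by (cases x)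
  have "(u', p') \<in> held S q"
    using x(1) x2 by (fastforce simp: held_def outbid_def not_less)
  moreover have "p \<le> p'"
  proof -
    have "p * n + u \<le> p' * n + u'" using x2[of "(u, p)"] assms(1) by simp
    moreover have "u' < n" using x(1) assms(2) by (auto simp: proposals_def)
    ultimately have "p * n < Suc p' * n" by simp
    then show ?thesis by (metis less_Suc_eq_le mult_less_cancel2)
  qed
  ultimately show ?thesis using that x(1) by simp
qed

definition proposed_to :: "nat set \<Rightarrow> (nat \<Rightarrow> nat \<Rightarrow> bool) \<Rightarrow> nat set" where
  "proposed_to S q = (\<lambda>(u, p). p mod n) ` proposals S (final S q)"

text \<open>A receiver that ever got a proposal holds one at the end. Counting receivers instead of
  proposals makes the number of held proposals visibly monotone in the proposer set.\<close>

lemma card_held: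
  assumes "S \<subseteq> {..<n}"
  shows "card (held S q) = card (proposed_to S q)"
proof -
  have "(\<lambda>(u, p). p mod n) ` held S q = proposed_to S q"
    unfolding proposed_to_def
  proof (intro equalityI subsetI)
    fix w assume "w \<in> (\<lambda>(u, p). p mod n) ` proposals S (final S q)"
    then obtain u p where "(u, p) \<in> proposals S (final S q)" "w = p mod n" by auto
    then show "w \<in> (\<lambda>(u, p). p mod n) ` held S q"
      using ex_held[OF _ assms] by (metis (mono_tags, lifting) case_prod_conv image_eqI)
  qed (auto simp: held_def)
  moreover have "inj_on (\<lambda>(u, p). p mod n) (held S q)"
    by (auto simp: inj_on_def dest: held_woman_unique[OF _ _ _ assms])
  ultimately show ?thesis by (metis card_image)
qed

lemma card_arcs: "card (arcs S q) = card (held S q)"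
proof -
  have "inj_on (\<lambda>(u, p). (u, p mod n)) (held S q)"
  proof (rule inj_onI, clarsimp)
    fix u p p' assume "(u, p) \<in> held S q" "(u, p') \<in> held S q"
    then show "p = p'" using held_pos by metis
  qed
  then show ?thesis unfolding arcs_def by (rule card_image)
qed

section \<open>Effect of additional proposers\<close>

context
  fixes S S' :: "nat set" and q :: "nat \<Rightarrow> nat \<Rightarrow> bool"
  assumes sub: "S \<subseteq> S'" and S': "S' \<subseteq> {..<n}"
begin

lemma fin_sub: "finite S" "finite S'"
  using finite_subset[OF S'] finite_subset[OF sub] by auto

lemma final_mono': "final S q \<le> final S' q"
  by (rule final_mono[OF sub])

lemma rejections_mono: "rejections S q \<subseteq> rejections S' q"
  unfolding rejections_def
  using proposals_mono[OF sub final_mono'] outbid_mono[OF _ sub final_mono'] by auto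

lemma quitters_mono: "quitters S q \<subseteq> quitters S' q"
  unfolding quitters_def using rejections_mono by auto

lemma exhausted_mono: "exhausted S q \<subseteq> exhausted S' q"
proof
  fix u assume "u \<in> exhausted S q"
  then have "u \<in> S'" "k * n \<le> final S' q u"
    using sub final_mono'[THEN le_funD, of u] by (auto simp: exhausted_def)
  then show "u \<in> exhausted S' q" using final_le[of S' q u] by (simp add: exhausted_def)
qed

lemma card_held_mono: "card (held S q) \<le> card (held S' q)"
proof -
  have "proposed_to S q \<subseteq> proposed_to S' q"
    unfolding proposed_to_def using proposals_mono[OF sub final_mono'] by blast
  then show ?thesis
    using card_mono[of "proposed_to S' q"] finite_proposals[OF fin_sub(2)] sub S'
    by (simp add: card_held proposed_to_def)
qed

text \<open>In \<open>card_partition\<close> the held and the exhausted proposers do not become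
  fewer, so every new quitter is paid for by a new proposer.\<close>

lemma card_quitters_le: "card (quitters S' q) \<le> card (quitters S q) + card (S' - S)"
proof -
  have "card S' = card S + card (S' - S)"
    using sub fin_sub by (metis card_Diff_subset card_mono le_add_diff_inverse)
  moreover have "card (exhausted S q) \<le> card (exhausted S' q)"
    using exhausted_mono finite_sets(4)[OF fin_sub(2)] card_mono by blast
  ultimately show ?thesis
    using card_partition[of S q] card_partition[OF S', of q] card_held_mono sub S' by simp
qed

lemma card_held_le: "card (held S' q) \<le> card (held S q) + card (S' - S)"
proof -
  have "card S' = card S + card (S' - S)"
    using sub fin_sub by (metis card_Diff_subset card_mono le_add_diff_inverse)
  moreover have "card (exhausted S q) \<le> card (exhausted S' q)"
    using exhausted_mono finite_sets(4)[OF fin_sub(2)] card_mono by blast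
  moreover have "card (quitters S q) \<le> card (quitters S' q)"
    using quitters_mono finite_sets(2)[OF fin_sub(2)] card_mono by blast
  ultimately show ?thesis
    using card_partition[of S q] card_partition[OF S', of q] sub S' by simp
qed

lemma held_diff: "held S q - held S' q \<subseteq> rejections S' q - rejections S q"
  using proposals_mono[OF sub final_mono'] by (auto simp: held_def rejections_def)

text \<open>A proposal that ceases to be held is a new rejection. The number of held proposals grows
  by at most \<open>card (S' - S)\<close>, so gains exceed losses by at most that amount.\<close>

lemma card_sym_diff_held:
  "card (sym_diff (held S q) (held S' q)) \<le>
     2 * card (rejections S' q - rejections S q) + card (S' - S)"
proof -
  let ?H = "held S q" and ?H' = "held S' q"
  have fin: "finite ?H" "finite ?H'" using finite_sets fin_sub by auto
  have "card (?H - ?H') \<le> card (rejections S' q - rejections S q)"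
    using held_diff finite_sets(1)[OF fin_sub(2)] card_mono by blast
  moreover have "card (?H' - ?H) + card (?H' \<inter> ?H) = card ?H'"
    using fin by (metis Int_commute card_Diff_subset_Int card_mono finite_Int inf_le2
        le_add_diff_inverse2)
  moreover have "card (?H - ?H') + card (?H' \<inter> ?H) = card ?H"
    using fin by (metis card_Diff_subset_Int card_mono finite_Int inf_le2 inf_commute
        le_add_diff_inverse2)
  moreover have "card (sym_diff ?H ?H') = card (?H - ?H') + card (?H' - ?H)"
    using fin by (intro card_Un_disjoint) auto
  ultimately show ?thesis using card_held_le by linarith
qed

lemma card_sym_diff_arcs:
  "card (sym_diff (arcs S q) (arcs S' q)) \<le>
     2 * card (rejections S' q - rejections S q) + card (S' - S)"
proof -
  have "sym_diff (arcs S q) (arcs S' q) \<subseteq>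
      (\<lambda>(u, p). (u, p mod n)) ` sym_diff (held S q) (held S' q)"
    by (auto simp: arcs_def)
  moreover have "finite (sym_diff (held S q) (held S' q))" using finite_sets fin_sub by simp
  ultimately have "card (sym_diff (arcs S q) (arcs S' q)) \<le> card (sym_diff (held S q) (held S' q))"
    by (rule surj_card_le[rotated])
  then show ?thesis using card_sym_diff_held by linarith
qed

end

text \<open>If \<open>(u, p)\<close> were not rejected under \<open>q\<close>, its coin would not be
  consulted at the fixed point, so \<open>final S q\<close> would be fixed for \<open>q'\<close> as
  well. Leastness and monotonicity in the coins then make both outcomes equal, against the rejection
  under \<open>q'\<close>.\<close>

lemma rejections_indep_aux:
  assumes S: "S \<subseteq> {..<n}"
    and eq: "\<And>u' p'. (u', p') \<noteq> (u, p) \<Longrightarrow> q u' p' = q' u' p'"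
    and q: "q u p" and rej: "(u, p) \<in> rejections S q'" 
  shows "(u, p) \<in> rejections S q"
proof (rule ccontr)
  assume not: "(u, p) \<notin> rejections S q"
  have "advance S q' (final S q) = advance S q (final S q)"
  proof
    fix x
    show "advance S q' (final S q) x = advance S q (final S q) x"
    proof (cases "(x, final S q x) = (u, p)")
      case True
      then show ?thesis using not by (auto simp: advance_def rejections_def proposals_def)
    next
      case False
      then show ?thesis using eq[of x "final S q x"] by (simp add: advance_def)
    qed
  qed
  then have "final S q' \<le> final S q" by (intro final_least) (simp add: advance_final S)
  moreover have "final S q \<le> final S q'"
  proof (rule final_mono)
    fix x y assume "q' x y"
    then show "q x y" using eq[of x y] q by (cases "(x, y) = (u, p)") auto
  qed simp
  ultimately have "final S q' = final S q" by (rule antisym)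
  then show False using rej not by (simp add: rejections_def)
qed

text \<open>Turning a coin to quit only lowers positions, which gives one implication by
  monotonicity; the other one is \<open>rejections_indep_aux\<close>.\<close>

lemma rejections_indep:
  assumes S: "S \<subseteq> {..<n}"
    and eq: "\<And>u' p'. (u', p') \<noteq> (u, p) \<Longrightarrow> q u' p' = q' u' p'"
  shows "(u, p) \<in> rejections S q \<longleftrightarrow> (u, p) \<in> rejections S q'"
proof -
  have main: "(u, p) \<in> rejections S q1 \<longleftrightarrow> (u, p) \<in> rejections S q2"
    if eq: "\<And>u' p'. (u', p') \<noteq> (u, p) \<Longrightarrow> q1 u' p' = q2 u' p'" and "q1 u p" "\<not> q2 u p" for q1 q2
  proof
    have "final S q1 \<le> final S q2"
    proof (rule final_mono)
      fix x y assume "q2 x y"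
      then show "q1 x y" using eq[of x y] that(2) by (cases "(x, y) = (u, p)") auto
    qed simp
    then show "(u, p) \<in> rejections S q1 \<Longrightarrow> (u, p) \<in> rejections S q2"
      unfolding rejections_def
      using proposals_mono[of S S] outbid_mono[of S "final S q1" u p S "final S q2"] by auto
    assume "(u, p) \<in> rejections S q2"
    then show "(u, p) \<in> rejections S q1"
      using rejections_indep_aux[where q = q1 and q' = q2, OF S _ \<open>q1 u p\<close>] eq by blast
  qed
  consider "q u p = q' u p" | "q u p" "\<not> q' u p" | "\<not> q u p" "q' u p" by blast
  then show ?thesis
  proof cases
    case 1
    have "q x y = q' x y" for x y
      using 1 eq[of x y] by (cases "(x, y) = (u, p)") auto
    then have "q = q'" by (intro ext)
    then show ?thesis by simp
  next
    case 2
    then show ?thesis using main[of q q'] eq by blast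
  next
    case 3
    then have "(u, p) \<in> rejections S q' \<longleftrightarrow> (u, p) \<in> rejections S q"
      using main[of q' q] eq by blast
    then show ?thesis ..
  qed
qed


section \<open>Lower bounds on the number of held proposals\<close>

lemma no_proposals: "n = 0 \<Longrightarrow> proposals S pos = {}"
  unfolding proposals_def by simp

lemma no_held: "n = 0 \<Longrightarrow> held S q = {}" and no_rejections: "n = 0 \<Longrightarrow> rejections S q = {}"
  unfolding held_def rejections_def using no_proposals[of S "final S q"] by blast+

lemma arc_adj: "(u, w) \<in> arcs S q \<Longrightarrow> u \<in> S \<and> adj u w \<and> (0 < n \<longrightarrow> w < n)"
  by (auto simp: arcs_def held_def proposals_def)

lemma arcs_left_unique: "(u, w) \<in> arcs S q \<Longrightarrow> (u, w') \<in> arcs S q \<Longrightarrow> w = w'"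
  unfolding arcs_def by (auto, metis held_pos)

lemma arcs_right_unique:
  "(u, w) \<in> arcs S q \<Longrightarrow> (u', w) \<in> arcs S q \<Longrightarrow> S \<subseteq> {..<n} \<Longrightarrow> u = u'"
  unfolding arcs_def by (auto dest: held_woman_unique)

text \<open>Weak linear programming duality: profits \<open>\<pi>\<close> and prices add up to at
  least \<open>k\<close> on every pair of \<open>D\<close>, whereas a held proposal contributes only
  \<open>k + 1\<close> and a quitter at most \<open>k\<close> to the dual value.\<close>

lemma card_mult_le:
  assumes D: "D \<subseteq> {(u, w). u < n \<and> w < n \<and> adj u w}"
    and inj: "inj_on fst D" "inj_on snd D"
  shows "k * card D \<le> (k + 1) * card (held {..<n} q) + k * card (quitters {..<n} q)"
proof -
  let ?S = "{..<n}"
  define H where "H = held ?S q"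
  define Q where "Q = quitters ?S q"
  let ?pos = "final ?S q"
  \<comment> \<open>Levels \<open>p div n\<close> count from 0. A held proposer keeps
    \<open>k\<close> minus its level, a quitter is compensated in full, and an exhausted proposer
    gets nothing.\<close>
  define \<pi> where "\<pi> u = (if (u, ?pos u) \<in> H then k - ?pos u div n
                        else if (u, ?pos u) \<in> Q then k else 0)" for u
  \<comment> \<open>The sum has at most one term, since a receiver holds at most one proposal; in
    this form it is 0 for a receiver without proposals and can be regrouped over
    \<open>H\<close>.\<close>
  define price where "price w = (\<Sum>(u, p)\<in>{x \<in> H. snd x mod n = w}. Suc (p div n))" for w
  have finH: "finite H" "finite Q" by (simp_all add: H_def Q_def finite_sets)
  have finD: "finite D" using D by (rule finite_subset) (auto intro: finite_subset[of _ "?S \<times> ?S"])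
  have price: "Suc (p div n) \<le> price w" if pr: "(u, p) \<in> proposals ?S ?pos" "p mod n = w" for u p w
  proof -
    obtain u' p' where *: "(u', p') \<in> H" "p' mod n = p mod n" "p \<le> p'"
      unfolding H_def by (rule ex_held[OF pr(1)]) auto
    have "Suc (p div n) \<le> Suc (p' div n)" using *(3) by (simp add: div_le_mono)
    also have "\<dots> \<le> price w"
      unfolding price_def
      using member_le_sum[of "(u', p')" "{x \<in> H. snd x mod n = w}" "\<lambda>(u, p). Suc (p div n)"]
        * pr(2) finH by simp
    finally show ?thesis .
  qed
  have key: "k \<le> \<pi> u + price w" if "(u, w) \<in> D" for u w
  proof -
    have uw: "u < n" "w < n" "adj u w" using that D by auto
    \<comment> \<open>All positions below \<open>?pos u\<close> have been proposed, and the price of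
      a receiver exceeds the level of every proposal it has seen.\<close>
    have passed: "Suc l \<le> price w" if "l * n + w < ?pos u" for l
    proof -
      have "(u, l * n + w) \<in> proposals ?S ?pos"
        using that uw final_le[of ?S q u] by (simp add: proposals_def)
      from price[OF this] show ?thesis using uw by simp
    qed
    consider "u \<in> exhausted ?S q" | "(u, ?pos u) \<in> H" | "(u, ?pos u) \<in> Q" "(u, ?pos u) \<notin> H"
      using final_cases[of ?S u q] uw unfolding H_def Q_def by blast
    then show ?thesis
    proof cases
      case 1
      then have pos: "?pos u = k * n" by (simp add: exhausted_def)
      show ?thesis
      proof (cases k)
        case (Suc l)
        have "l * n + w < ?pos u" using uw pos Suc by simp
        from passed[OF this] show ?thesis using Suc by simp
      qed simp
    next
      case 2
      show ?thesis
      proof (cases "?pos u div n")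
        case 0
        then show ?thesis using 2 by (simp add: \<pi>_def)
      next
        case (Suc l)
        \<comment> \<open>A proposer held at level \<open>Suc l\<close> has gone past
          \<open>w\<close> at level \<open>l\<close>, wherever \<open>w\<close> stands in the
          list.\<close>
        have "l * n + w < Suc l * n" using uw by simp
        also have "\<dots> \<le> ?pos u" using div_times_less_eq_dividend[of "?pos u" n] Suc by simp
        finally have "Suc l \<le> price w" by (rule passed)
        then show ?thesis using 2 Suc by (simp add: \<pi>_def)
      qed
    next
      case 3
      then show ?thesis by (simp add: \<pi>_def)
    qed
  qed
  have "k * card D = (\<Sum>x\<in>D. k)" by simp
  also have "\<dots> \<le> (\<Sum>x\<in>D. \<pi> (fst x) + price (snd x))"
    using key by (intro sum_mono) auto
  also have "\<dots> = sum \<pi> (fst ` D) + sum price (snd ` D)"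
    using inj by (simp add: sum.distrib sum.reindex)
  also have "\<dots> \<le> sum \<pi> ?S + sum price ?S"
    using D by (intro add_mono sum_mono2) auto
  also have "sum price ?S = (\<Sum>(u, p)\<in>H. Suc (p div n))"
  proof (cases "n = 0")
    case True
    then have "H = {}" unfolding H_def by (rule no_held)
    then show ?thesis using True by simp
  next
    case False
    then show ?thesis unfolding price_def
      by (intro sum.group[where g = "\<lambda>x. snd x mod n"] finH) auto
  qed
  also have "sum \<pi> ?S \<le> (\<Sum>(u, p)\<in>H. k - p div n) + k * card Q"
  proof -
    let ?H = "fst ` H" and ?Q = "fst ` Q"
    have pos: "p = ?pos u" if "(u, p) \<in> H \<or> (u, p) \<in> Q" for u p
      using that held_pos quitters_pos unfolding H_def Q_def by blast
    have "\<pi> u \<le> (if u \<in> ?H then k - ?pos u div n else 0) + (if u \<in> ?Q then k else 0)" for u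
      unfolding \<pi>_def by force
    then have "sum \<pi> ?S \<le> (\<Sum>u\<in>?S. (if u \<in> ?H then k - ?pos u div n else 0) + (if u \<in> ?Q then k else 0))"
      by (intro sum_mono)
    also have "\<dots> = (\<Sum>u\<in>?S \<inter> ?H. k - ?pos u div n) + (\<Sum>u\<in>?S \<inter> ?Q. k)"
      by (simp only: sum.distrib sum.inter_restrict[symmetric] finite_lessThan)
    also have "\<dots> \<le> (\<Sum>u\<in>?H. k - ?pos u div n) + (\<Sum>u\<in>?Q. k)"
      using finH by (intro add_mono sum_mono2) auto
    also have "(\<Sum>u\<in>?H. k - ?pos u div n) = (\<Sum>x\<in>H. k - ?pos (fst x) div n)"
    proof (subst sum.reindex)
      show "inj_on fst H" by (rule inj_onI) (metis pos prod.collapse)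
    qed simp
    also have "\<dots> = (\<Sum>(u, p)\<in>H. k - p div n)"
      by (intro sum.cong refl) (auto simp: case_prod_unfold dest!: pos[OF disjI1])
    also have "(\<Sum>u\<in>?Q. k) \<le> k * card Q" using card_image_le[OF finH(2), of fst] by simp
    finally show ?thesis by simp
  qed
  also have "(\<Sum>(u, p)\<in>H. k - p div n) + k * card Q + (\<Sum>(u, p)\<in>H. Suc (p div n))
      = (\<Sum>(u, p)\<in>H. (k - p div n) + Suc (p div n)) + k * card Q"
    by (simp add: case_prod_unfold flip: sum.distrib)
  also have "(\<Sum>(u, p)\<in>H. (k - p div n) + Suc (p div n)) = (\<Sum>x\<in>H. k + 1)"
  proof (rule sum.cong)
    fix x assume "x \<in> H"
    then have "snd x < k * n" by (auto simp: H_def held_def proposals_def)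
    then have "snd x div n < k" by (simp add: less_mult_imp_div_less)
    then show "(case x of (u, p) \<Rightarrow> (k - p div n) + Suc (p div n)) = k + 1"
      by (simp add: case_prod_unfold)
  qed simp
  finally show ?thesis by (simp add: H_def Q_def mult.commute)
qed

text \<open>With \<open>c w\<close> as quitting probability at \<open>w\<close>, the expectation of
  the left-hand side is the expected number of quitters. A receiver gets at most one proposal per
  neighbour and level, and the receivers that get any are counted by the held proposals.\<close>

lemma rejections_level_bound:
  fixes c :: "nat \<Rightarrow> real"
  assumes S: "S \<subseteq> {..<n}" and c: "\<And>w. 0 \<le> c w"
    and c_le: "\<And>w. w < n \<Longrightarrow> real (card {u. u < n \<and> adj u w}) * c w \<le> \<gamma>"
  shows "(\<Sum>(u, p)\<in>rejections S q. c (p mod n)) \<le> real k * \<gamma> * real (card (held S q))"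
proof (cases "n = 0")
  case True
  then have "rejections S q = {}" "held S q = {}" by (rule no_rejections, rule no_held)
  then show ?thesis by simp
next
  case False
  have fin: "finite S" using finite_subset[OF S] by simp
  let ?R = "rejections S q" and ?W = "proposed_to S q"
  have W: "?W \<subseteq> {..<n}" using False by (auto simp: proposed_to_def)
  have finW: "finite ?W" using finite_subset[OF W] by simp
  have "(\<Sum>(u, p)\<in>?R. c (p mod n)) = (\<Sum>w\<in>?W. \<Sum>(u, p)\<in>{x \<in> ?R. snd x mod n = w}. c (p mod n))"
  proof (rule sum.group[symmetric])
    show "(\<lambda>x. snd x mod n) ` ?R \<subseteq> ?W"
      by (auto simp: proposed_to_def rejections_def)
  qed (fact finite_sets[OF fin] finW)+
  also have "\<dots> = (\<Sum>w\<in>?W. real (card {x \<in> ?R. snd x mod n = w}) * c w)"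
    by (intro sum.cong refl) (auto simp: case_prod_unfold)
  also have "\<dots> \<le> (\<Sum>w\<in>?W. real k * \<gamma>)"
  proof (rule sum_mono)
    fix w assume w: "w \<in> ?W"
    let ?N = "{u. u < n \<and> adj u w}"
    have "{x \<in> ?R. snd x mod n = w} \<subseteq> (\<lambda>(u, l). (u, l * n + w)) ` (?N \<times> {..<k})"
    proof
      fix x assume x: "x \<in> {x \<in> ?R. snd x mod n = w}"
      then have "x = (\<lambda>(u, l). (u, l * n + w)) (fst x, snd x div n)"
        by (auto simp: case_prod_unfold prod_eq_iff)
      moreover have "(fst x, snd x div n) \<in> ?N \<times> {..<k}"
        using x S by (auto simp: rejections_def proposals_def less_mult_imp_div_less)
      ultimately show "x \<in> (\<lambda>(u, l). (u, l * n + w)) ` (?N \<times> {..<k})" by (rule image_eqI)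
    qed
    then have "card {x \<in> ?R. snd x mod n = w} \<le> card (?N \<times> {..<k})"
      by (intro surj_card_le) auto
    then have "real (card {x \<in> ?R. snd x mod n = w}) \<le> real k * real (card ?N)"
      by (simp add: card_cartesian_product mult.commute flip: of_nat_mult)
    then have "real (card {x \<in> ?R. snd x mod n = w}) * c w \<le> real k * real (card ?N) * c w"
      using c by (intro mult_right_mono)
    also have "\<dots> \<le> real k * \<gamma>" using c_le[of w] w W by (simp add: mult.assoc mult_left_mono subset_eq)
    finally show "real (card {x \<in> ?R. snd x mod n = w}) * c w \<le> real k * \<gamma>" .
  qed
  also have "\<dots> = real k * \<gamma> * real (card (held S q))" by (simp add: card_held[OF S])
  finally show ?thesis .
qed

text \<open>Serves maximum degree 1. The only possible rival of \<open>u\<close> is \<open>u\<close>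
  itself, and its own proposals so far have no larger key, so it is never rejected.\<close>

lemma arcs_if_no_competition:
  assumes uniq: "\<And>u u' w. u < n \<Longrightarrow> u' < n \<Longrightarrow> adj u w \<Longrightarrow> adj u' w \<Longrightarrow> u = u'"
    and uw: "u < n" "w < n" "adj u w" "0 < k" and uniq': "\<And>w'. w' < n \<Longrightarrow> adj u w' \<Longrightarrow> w' = w"
  shows "(u, w) \<in> arcs {..<n} q"
proof -
  let ?S = "{..<n}"
  have passed: "\<not> adj u (p mod n)" if "p < stage ?S q t u" "u < n" for p t u
    using that
  proof (induction t arbitrary: u p)
    case (Suc t)
    show ?case
    proof (cases "p < stage ?S q t u")
      case False
      with Suc.prems have p: "p = stage ?S q t u" "stage ?S q (Suc t) u = Suc (stage ?S q t u)"
        by (auto simp: stage_Suc advance_def split: if_splits)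
      show ?thesis
      proof
        assume adj: "adj u (p mod n)"
        then have "outbid ?S (stage ?S q t) u p"
          using p by (auto simp: stage_Suc advance_def split: if_splits)
        then obtain u' p' where *: "u' < n" "p' \<le> stage ?S q t u'" "adj u' (p' mod n)"
          "p' mod n = p mod n" "p * n + u < p' * n + u'"
          by (auto simp: outbid_def proposals_def)
        with uniq[of u u' "p mod n"] adj \<open>u < n\<close> have "u' = u" by simp
        with * p(1) show False by simp
      qed
    qed (use Suc in blast)
  qed simp
  have nout: "\<not> outbid ?S (final ?S q) u (final ?S q u)" if "adj u (final ?S q u mod n)"
  proof
    assume "outbid ?S (final ?S q) u (final ?S q u)"
    then obtain u' p' where *: "u' < n" "p' \<le> final ?S q u'" "adj u' (p' mod n)"
          "p' mod n = final ?S q u mod n" "final ?S q u * n + u < p' * n + u'"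
      by (auto simp: outbid_def proposals_def)
    with uniq[of u u' "final ?S q u mod n"] that uw have "u' = u" by simp
    with * show False by simp
  qed
  have "w < k * n" using uw by (metis less_le_trans mult_le_mono1 mult_1 Suc_leI One_nat_def)
  moreover have "\<not> w < final ?S q u" using passed[of w _ u] uw unfolding final_def by auto
  ultimately have "u \<notin> exhausted ?S q" by (simp add: exhausted_def)
  moreover have "(u, final ?S q u) \<notin> quitters ?S q"
    using nout by (auto simp: quitters_def rejections_def proposals_def)
  ultimately have held: "(u, final ?S q u) \<in> held ?S q"
    using final_cases[of ?S u q] uw by blast
  then have "adj u (final ?S q u mod n)" by (simp add: held_def proposals_def)
  moreover have "final ?S q u mod n < n" using uw by simp
  ultimately have "final ?S q u mod n = w" by (intro uniq')
  then show ?thesis using held unfolding arcs_def by (metis (no_types, lifting) case_prod_conv image_eqI)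
qed

end

text \<open>The process consults \<open>adj\<close> and \<open>q\<close> only for proposers in
  \<open>S\<close>. This identifies the instances of \<open>E\<close> and \<open>E - {e}\<close>
  once the neighbours of both ends are barred from proposing.\<close>

lemma arcs_cong:
  fixes adj adj' :: "nat \<Rightarrow> nat \<Rightarrow> bool"
  assumes S: "S \<subseteq> {..<n}"
    and adj: "\<And>u w. u \<in> S \<Longrightarrow> adj u w = adj' u w"
    and q: "\<And>u p. u \<in> S \<Longrightarrow> adj u (p mod n) \<Longrightarrow> q u p = q' u p"
  shows "deferred_acceptance.arcs n k adj S q = deferred_acceptance.arcs n k adj' S q'"
proof -
  interpret A: deferred_acceptance n k adj .
  interpret B: deferred_acceptance n k adj' .
  have props: "A.proposals S pos = B.proposals S pos" for pos
    using adj by (auto simp: A.proposals_def B.proposals_def)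
  have out: "A.outbid S pos u p = B.outbid S pos u p" for pos u p
    by (simp add: A.outbid_def B.outbid_def props)
  have adv: "A.advance S q = B.advance S q'"
    by (intro ext) (use adj q in \<open>auto simp: A.advance_def B.advance_def out\<close>)
  have "A.final S q = B.final S q'"
    by (simp add: A.final_def B.final_def A.stage_def B.stage_def adv)
  then show ?thesis
    by (simp add: A.arcs_def B.arcs_def A.held_def B.held_def props out)
qed

section \<open>Splitting paths and even cycles into matchings\<close>

text \<open>A vertex \<open>x\<close> is the node \<open>(x, 0)\<close>. Beyond a vertex without predecessor, the walk continues
  through the virtual nodes \<open>(x, 1), (x, 2), \<dots>\<close>, so that it never ends.\<close>

fun step_back :: "(nat \<Rightarrow> nat option) \<Rightarrow> nat \<times> nat \<Rightarrow> nat \<times> nat" where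
  "step_back par (x, i) =
     (if i = 0 then case par x of Some u \<Rightarrow> (u, 0) | None \<Rightarrow> (x, 1) else (x, Suc i))"

text \<open>Lexicographic order by rank, with the number of the node as tie-breaker;
  \<open>fst z * Suc h + snd z\<close> numbers the nodes whose virtual part is at most
  \<open>h\<close>.\<close>

definition label :: "nat \<Rightarrow> nat \<Rightarrow> (nat \<Rightarrow> nat) \<Rightarrow> nat \<times> nat \<Rightarrow> nat" where
  "label n h r z = (let j = fst z * Suc h + snd z in r j * (n * Suc h) + j)"

text \<open>The strict comparison selects the nearest occurrence of the minimum, which matters on
  short cycles, where the walk meets a node repeatedly.\<close>

fun lead :: "nat \<Rightarrow> nat \<Rightarrow> (nat \<Rightarrow> nat) \<Rightarrow> (nat \<Rightarrow> nat option) \<Rightarrow> nat \<Rightarrow> nat \<Rightarrow> nat" where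
  "lead n h r par v 0 = 0"
| "lead n h r par v (Suc j) =
     (if label n h r ((step_back par ^^ Suc j) (v, 0))
           < label n h r ((step_back par ^^ lead n h r par v j) (v, 0))
      then Suc j else lead n h r par v j)"

definition side :: "nat \<Rightarrow> nat \<Rightarrow> (nat \<Rightarrow> nat) \<Rightarrow> (nat \<Rightarrow> nat option) \<Rightarrow> nat \<Rightarrow> bool" where
  "side n h r par v = odd (lead n h r par v h)"

definition parent :: "(nat \<times> nat) set \<Rightarrow> nat \<Rightarrow> nat option" where
  "parent A w = (if \<exists>u. (u, w) \<in> A then Some (THE u. (u, w) \<in> A) else None)"

definition selected ::
    "nat \<Rightarrow> nat \<Rightarrow> (nat \<Rightarrow> nat) \<Rightarrow> bool \<Rightarrow> (nat \<times> nat) set \<Rightarrow> (nat \<times> nat) set" where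
  "selected n h r b A = {(u, w) \<in> A. side n h r (parent A) u = b \<and> side n h r (parent A) w \<noteq> b}"

section \<open>Leaders, labels and the walk along predecessors\<close>

lemma lead_le: "lead n h r par v j \<le> j"
  by (induction j) auto

lemma lead_min:
  "i \<le> j \<Longrightarrow> label n h r ((step_back par ^^ lead n h r par v j) (v, 0)) \<le> label n h r ((step_back par ^^ i) (v, 0))"
  by (induction j) (auto simp: le_Suc_eq)

lemma lead_first:
  "i < lead n h r par v j \<Longrightarrow>
   label n h r ((step_back par ^^ lead n h r par v j) (v, 0)) < label n h r ((step_back par ^^ i) (v, 0))"
proof (induction j)
  case (Suc j)
  let ?f = "\<lambda>i. label n h r ((step_back par ^^ i) (v, 0))"
  show ?case
  proof (cases "?f (Suc j) < ?f (lead n h r par v j)")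
    case True
    then have l: "lead n h r par v (Suc j) = Suc j" by simp
    with Suc.prems have "i \<le> j" by simp
    from lead_min[OF this, of n h r par v] True show ?thesis unfolding l by linarith
  next
    case False
    then have l: "lead n h r par v (Suc j) = lead n h r par v j" by simp
    show ?thesis using Suc unfolding l by blast
  qed
qed simp

lemma lead_eqI:
  assumes "m \<le> j"
    and "\<And>i. i < m \<Longrightarrow> label n h r ((step_back par ^^ m) (v, 0)) < label n h r ((step_back par ^^ i) (v, 0))"
    and "\<And>i. i \<le> j \<Longrightarrow> label n h r ((step_back par ^^ m) (v, 0)) \<le> label n h r ((step_back par ^^ i) (v, 0))"
  shows "lead n h r par v j = m"
proof (rule ccontr)
  let ?l = "lead n h r par v j"
  assume "?l \<noteq> m"
  then consider "?l < m" | "m < ?l" by linarith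
  then show False
  proof cases
    case 1
    from assms(2)[OF this] lead_min[OF assms(1), of n h r par v] show False by linarith
  next
    case 2
    from lead_first[OF 2] assms(3)[OF lead_le, of n h r par v] show False by linarith
  qed
qed

lemma label_inj:
  assumes "label n h r z = label n h r z'" "fst z < n" "snd z \<le> h" "fst z' < n" "snd z' \<le> h"
  shows "z = z'"
proof -
  define j where "j = fst z * Suc h + snd z"
  define j' where "j' = fst z' * Suc h + snd z'"
  have lt: "fst x * Suc h + snd x < n * Suc h" if "fst x < n" "snd x \<le> h" for x :: "nat \<times> nat"
  proof -
    have "fst x * Suc h + snd x < Suc (fst x) * Suc h" using that by simp
    also have "\<dots> \<le> n * Suc h" using that by (intro mult_le_mono1) simp
    finally show ?thesis .
  qed
  have "(r j * (n * Suc h) + j) mod (n * Suc h) = (r j' * (n * Suc h) + j') mod (n * Suc h)"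
    using assms(1) by (simp add: label_def Let_def j_def j'_def)
  then have "j = j'" using lt[of z] lt[of z'] assms by (simp add: j_def j'_def)
  then have "j div Suc h = j' div Suc h" "j mod Suc h = j' mod Suc h" by simp_all
  then show ?thesis using assms unfolding j_def j'_def
    by (simp add: prod_eq_iff del: mult_Suc_right)
qed

text \<open>Only a weak comparison of ranks survives the tie-breaking; this is why the probability
  estimate below concerns weak minima.\<close>

lemma label_le_imp:
  assumes "label n h r z \<le> label n h r z'" "fst z' < n" "snd z' \<le> h"
  shows "r (fst z * Suc h + snd z) \<le> r (fst z' * Suc h + snd z')"
proof -
  define N where "N = n * Suc h"
  define j where "j = fst z * Suc h + snd z"
  define j' where "j' = fst z' * Suc h + snd z'"
  have "j' < Suc (fst z') * Suc h" using assms by (simp add: j'_def)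
  also have "\<dots> \<le> N" unfolding N_def using assms by (intro mult_le_mono1) simp
  finally have "j' < N" .
  moreover have "r j * N + j \<le> r j' * N + j'"
    using assms(1) by (simp add: label_def Let_def j_def j'_def N_def)
  ultimately have "r j * N < Suc (r j') * N" by simp
  then have "r j \<le> r j'" by (metis less_Suc_eq_le mult_less_cancel2)
  then show ?thesis by (simp add: j_def j'_def)
qed

text \<open>Each vertex without predecessor has a virtual tail of its own, so different walks never
  merge.\<close>

lemma inj_step_back:
  assumes inj: "\<And>x y u. par x = Some u \<Longrightarrow> par y = Some u \<Longrightarrow> x = y"
  shows "inj (step_back par)"
proof (rule injI)
  fix a b :: "nat \<times> nat"
  assume "step_back par a = step_back par b"
  then show "a = b" using inj
    by (cases a; cases b) (auto split: if_splits option.splits)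
qed

lemma step_back_bounds:
  assumes "\<And>x u. x < n \<Longrightarrow> par x = Some u \<Longrightarrow> u < n" "fst z < n"
  shows "fst ((step_back par ^^ i) z) < n \<and> snd ((step_back par ^^ i) z) \<le> snd z + i"
proof (induction i)
  case (Suc i)
  obtain x j where *: "(step_back par ^^ i) z = (x, j)" by (cases "(step_back par ^^ i) z")
  with Suc have "x < n" "j \<le> snd z + i" by auto
  then show ?case using assms(1)[of x] by (auto simp: * split: option.splits)
qed (use assms in simp)

lemma step_back_virtual:
  assumes "0 < snd z"
  shows "0 < snd ((step_back par ^^ i) z)"
proof (induction i)
  case (Suc i)
  obtain x j where *: "(step_back par ^^ i) z = (x, j)" by (cases "(step_back par ^^ i) z")
  with Suc show ?case by simp
qed (use assms in simp)

text \<open>A walk never returns from virtual nodes, so a closed walk from a vertex uses real arcs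
  only, and each of them flips the colour.\<close>

lemma step_back_cycle_even:
  assumes colour: "\<And>x u. par x = Some u \<Longrightarrow> f u = (\<not> f x)"
    and cyc: "(step_back par ^^ c) (x, 0) = (x, 0)"
  shows "even c"
proof -
  have real: "snd ((step_back par ^^ i) (x, 0)) = 0" if "i \<le> c" for i
  proof (rule ccontr)
    assume "snd ((step_back par ^^ i) (x, 0)) \<noteq> 0"
    then have "0 < snd ((step_back par ^^ (c - i)) ((step_back par ^^ i) (x, 0)))"
      by (intro step_back_virtual[of "(step_back par ^^ i) (x, 0)"]) simp
    moreover have "(step_back par ^^ (c - i)) ((step_back par ^^ i) (x, 0)) = (step_back par ^^ c) (x, 0)"
      using that by (metis comp_apply funpow_add le_add_diff_inverse2)
    ultimately show False using cyc by simp
  qed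
  have "f (fst ((step_back par ^^ i) (x, 0))) = (if even i then f x else \<not> f x)" if "i \<le> c" for i
    using that
  proof (induction i)
    case (Suc i)
    obtain y where y: "(step_back par ^^ i) (x, 0) = (y, 0)"
      using real[of i] Suc.prems by (metis Suc_leD prod.collapse)
    obtain u where "par y = Some u"
      using real[of "Suc i"] Suc.prems y by (auto split: option.splits)
    then show ?case using Suc y colour by auto
  qed simp
  from this[of c] show ?thesis using cyc by (auto split: if_splits)
qed

text \<open>An orbit of an injective map has no tail leading into a cycle: any repetition forces a
  return to the starting point.\<close>

lemma funpow_orbit_cases:
  assumes "inj f"
  obtains "inj_on (\<lambda>i. (f ^^ i) x) {..m}"
  | c where "0 < c" "c \<le> m" "(f ^^ c) x = x" "inj_on (\<lambda>i. (f ^^ i) x) {..<c}"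
proof (cases "inj_on (\<lambda>i. (f ^^ i) x) {..m}")
  case False
  have inj: "inj (f ^^ i)" for i using assms by (rule inj_fn)
  have ret: "(f ^^ (j - i)) x = x" if "i < j" "(f ^^ i) x = (f ^^ j) x" for i j
  proof -
    have "(f ^^ i) ((f ^^ (j - i)) x) = (f ^^ i) x"
      using that by (metis add.commute comp_apply funpow_add le_add_diff_inverse2 less_imp_le)
    then show ?thesis using inj[of i] by (simp add: inj_eq)
  qed
  from False obtain i j where ij: "i < j" "j \<le> m" "(f ^^ i) x = (f ^^ j) x"
    unfolding inj_on_def by (metis atMost_iff linorder_neqE_nat)
  let ?P = "\<lambda>c. 0 < c \<and> (f ^^ c) x = x"
  have P: "?P (j - i)" using ret[OF ij(1,3)] ij by simp
  define c where "c = (LEAST c. ?P c)"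
  have c: "?P c" unfolding c_def by (rule LeastI[of ?P, OF P])
  have least: "c \<le> d" if "?P d" for d unfolding c_def by (rule Least_le[of ?P, OF that])
  have "c \<le> m" using least[OF P] ij by linarith
  moreover have "inj_on (\<lambda>i. (f ^^ i) x) {..<c}"
  proof (rule linorder_inj_onI)
    fix a b assume ab: "a < b" "a \<in> {..<c}" "b \<in> {..<c}"
    show "(f ^^ a) x \<noteq> (f ^^ b) x"
    proof
      assume "(f ^^ a) x = (f ^^ b) x"
      from least[of "b - a"] ret[OF ab(1) this] ab show False by simp
    qed
  qed auto
  ultimately show ?thesis using that c by blast
qed (use that in blast)

text \<open>Consecutive vertices see windows that differ in one end point each, so they agree on the
  label minimum unless it sits at an end of the union of the two windows. On a cycle shorter than
  the window both see the whole cycle, and its length is even.\<close>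

lemma conflict_imp_extreme:
  assumes par: "par w = Some u" and w: "w < n"
    and inj: "\<And>x y u. par x = Some u \<Longrightarrow> par y = Some u \<Longrightarrow> x = y"
    and bound: "\<And>x u. x < n \<Longrightarrow> par x = Some u \<Longrightarrow> u < n"
    and colour: "\<And>x u. par x = Some u \<Longrightarrow> f u = (\<not> f x)"
    and conflict: "side n h r par u = side n h r par w"
  defines "y \<equiv> \<lambda>i. (step_back par ^^ i) (w, 0)"
  shows "inj_on y {..Suc h} \<and>
    ((\<forall>i\<le>Suc h. label n h r (y 0) \<le> label n h r (y i)) \<or>
     (\<forall>i\<le>Suc h. label n h r (y (Suc h)) \<le> label n h r (y i)))"
proof -
  let ?L = "\<lambda>i. label n h r (y i)"
  have y_Suc: "y (Suc i) = (step_back par ^^ i) (u, 0)" for i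
    unfolding y_def using par by (simp add: funpow_Suc_right del: funpow.simps)
  \<comment> \<open>The first step leads to the real node \<open>u\<close>, so even node number
    \<open>Suc h\<close> of the walk has virtual part at most \<open>h\<close> and hence a label of
    its own.\<close>
  have yb: "fst (y i) < n \<and> snd (y i) \<le> h" if "i \<le> Suc h" for i
  proof (cases i)
    case 0
    then show ?thesis using w by (simp add: y_def)
  next
    case (Suc j)
    have "fst ((step_back par ^^ j) (u, 0)) < n \<and> snd ((step_back par ^^ j) (u, 0)) \<le> snd (u, 0::nat) + j"
      by (rule step_back_bounds) (use bound bound[OF w par] in auto)
    then show ?thesis using that Suc by (simp add: y_Suc)
  qed
  have L_eq: "y i = y j" if "?L i = ?L j" "i \<le> Suc h" "j \<le> Suc h" for i j
    using label_inj[OF that(1)] yb that by simp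
  have leadw: "lead n h r par w h = m" if "m \<le> h" "\<And>i. i < m \<Longrightarrow> ?L m < ?L i" "\<And>i. i \<le> h \<Longrightarrow> ?L m \<le> ?L i" for m
    using lead_eqI[of m h n h r par w] that by (simp add: y_def)
  have leadu: "lead n h r par u h = m" if "m \<le> h" "\<And>i. i < m \<Longrightarrow> ?L (Suc m) < ?L (Suc i)"
      "\<And>i. i \<le> h \<Longrightarrow> ?L (Suc m) \<le> ?L (Suc i)" for m
    using lead_eqI[of m h n h r par u] that by (simp add: y_Suc)
  have sides: "odd (lead n h r par u h) = odd (lead n h r par w h)"
    using conflict by (simp add: side_def)
  from inj_step_back[OF inj] consider "inj_on y {..Suc h}"
    | c where "0 < c" "c \<le> Suc h" "y c = y 0" "inj_on y {..<c}"
    unfolding y_def by (rule funpow_orbit_cases[where x = "(w, 0)" and m = "Suc h"]) auto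
  then show ?thesis
  proof cases
    case 1
    have "\<exists>m\<in>{..Suc h}. \<forall>i\<in>{..Suc h}. ?L m \<le> ?L i"
      using ex_is_arg_min_if_finite[of "{..Suc h}" ?L] by (auto simp: is_arg_min_linorder)
    then obtain m where m: "m \<le> Suc h" "\<And>i. i \<le> Suc h \<Longrightarrow> ?L m \<le> ?L i" by auto
    have lt: "?L m < ?L i" if "i \<le> Suc h" "i \<noteq> m" for i
    proof -
      have "?L m \<noteq> ?L i" using L_eq[of m i] m(1) that 1 by (auto dest: inj_onD)
      then show ?thesis using m(2)[OF that(1)] by simp
    qed
    \<comment> \<open>An interior minimum is the leader of both vertices, at position
      \<open>m\<close> seen from \<open>w\<close> and \<open>m - 1\<close> seen from
      \<open>u\<close>, so their parities differ.\<close>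
    have "m = 0 \<or> m = Suc h"
    proof (rule ccontr)
      assume "\<not> ?thesis"
      then obtain m' where m': "m = Suc m'" "m \<le> h" using m(1) by (cases m) auto
      have "lead n h r par w h = m" by (rule leadw) (use m' m lt in auto)
      moreover have "lead n h r par u h = m'" by (rule leadu) (use m' m lt in auto)
      ultimately show False using sides m' by simp
    qed
    then show ?thesis using m(2) 1 by auto
  next
    case 2
    have "(step_back par ^^ c) (w, 0) = (w, 0)" using 2(3) by (simp add: y_def)
    from step_back_cycle_even[OF colour this] have even: "even c" .
    have per: "y (i + c) = y i" for i
      using 2(3) unfolding y_def by (simp add: funpow_add)
    have permod: "y i = y (i mod c)" for i
    proof (induction i rule: less_induct)
      case (less i)
      show ?case
      proof (cases "i < c")
        case False
        then have "y i = y (i - c)" using per[of "i - c"] by simp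
        also have "\<dots> = y ((i - c) mod c)" using False 2(1) by (intro less) simp
        also have "(i - c) mod c = i mod c" using False by (simp add: le_mod_geq)
        finally show ?thesis .
      qed simp
    qed
    have "\<exists>m\<in>{..<c}. \<forall>i\<in>{..<c}. ?L m \<le> ?L i"
      using ex_is_arg_min_if_finite[of "{..<c}" ?L] 2(1) by (auto simp: is_arg_min_linorder)
    then obtain m where m: "m < c" "\<And>i. i < c \<Longrightarrow> ?L m \<le> ?L i" by auto
    have le: "?L m \<le> ?L i" for i using m(2)[of "i mod c"] 2(1) permod[of i] by simp
    have lt: "?L m < ?L i" if "i < c" "i \<noteq> m" for i
    proof -
      have "?L m \<noteq> ?L i" using L_eq[of m i] m(1) that 2 by (auto dest: inj_onD)
      then show ?thesis using le[of i] by simp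
    qed
    have w: "lead n h r par w h = m" by (rule leadw) (use m le lt 2 in auto)
    have "odd m \<noteq> odd (lead n h r par u h)"
    proof (cases m)
      case 0
      \<comment> \<open>The minimum is \<open>w\<close> itself, which \<open>u\<close> meets only
        after going round the cycle, at the odd distance \<open>c - 1\<close>.\<close>
      obtain c' where c': "c = Suc c'" using 2(1) by (cases c) auto
      have "?L (Suc c') = ?L 0" using 2(3) c' by simp
      then have "lead n h r par u h = c'"
        by (intro leadu) (use 0 le lt 2 c' in auto)
      then show ?thesis using 0 c' even by simp
    next
      case (Suc m')
      then have "lead n h r par u h = m'"
        by (intro leadu) (use Suc le lt 2 m in auto)
      then show ?thesis using Suc by simp
    qed
    then show ?thesis using w sides by simp
  qed
qed

text \<open>A side can change only if the walk meets a vertex with a changed parent at some position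
  \<open>i \<le> h\<close>; by injectivity that vertex and \<open>i\<close> determine the start of
  the walk.\<close>

lemma card_lead_diff:
  assumes inj: "\<And>x y u. par x = Some u \<Longrightarrow> par y = Some u \<Longrightarrow> x = y"
    and fin: "finite X" and X: "\<And>x. x \<notin> X \<Longrightarrow> par x = par' x"
  shows "finite {v. side n h r par v \<noteq> side n h r par' v} \<and>
    card {v. side n h r par v \<noteq> side n h r par' v} \<le> Suc h * card X"
proof -
  let ?D = "{v. side n h r par v \<noteq> side n h r par' v}"
  let ?g = "\<lambda>(x, i). fst (inv (step_back par ^^ i) (x, 0))"
  have injn: "inj (step_back par ^^ i)" for i
    by (intro inj_fn inj_step_back) (fact inj)
  have "?D \<subseteq> ?g ` (X \<times> {..h})"
  proof
    fix v assume v: "v \<in> ?D"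
    have "\<exists>i\<le>h. (step_back par ^^ i) (v, 0) \<in> X \<times> {0}"
    proof (rule ccontr)
      assume *: "\<not> ?thesis"
      have eq: "(step_back par' ^^ i) (v, 0) = (step_back par ^^ i) (v, 0)" if "i \<le> h" for i
        using that
      proof (induction i)
        case (Suc i)
        obtain x j where xj: "(step_back par ^^ i) (v, 0) = (x, j)" by (cases "(step_back par ^^ i) (v, 0)")
        have "i \<le> h" using Suc.prems by simp
        with * have "(step_back par ^^ i) (v, 0) \<notin> X \<times> {0}" by metis
        then have "j = 0 \<Longrightarrow> par x = par' x" using xj X by auto
        then show ?case using Suc xj by auto
      qed simp
      have "lead n h r par' v j = lead n h r par v j" if "j \<le> h" for j
        using that
      proof (induction j)
        case (Suc j)
        then show ?case
          using eq[OF Suc.prems] eq[of "lead n h r par v j"] lead_le[of n h r par v j] by simp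
      qed simp
      then show False using v by (simp add: side_def)
    qed
    then obtain i x where ix: "i \<le> h" "x \<in> X" "(step_back par ^^ i) (v, 0) = (x, 0)" by auto
    then have "inv (step_back par ^^ i) (x, 0) = (v, 0)" using injn[of i] by (metis inv_f_f)
    then have "v = ?g (x, i)" by simp
    then show "v \<in> ?g ` (X \<times> {..h})" using ix by blast
  qed
  moreover have "finite (X \<times> {..h})" using fin by simp
  ultimately have "finite ?D" "card ?D \<le> card (X \<times> {..h})"
    using finite_surj surj_card_le by blast+
  then show ?thesis by (simp add: card_cartesian_product mult.commute)
qed

section \<open>Stability of the selected arcs\<close>

definition partial_matching :: "(nat \<times> nat) set \<Rightarrow> bool" where
  "partial_matching A \<longleftrightarrow> finite A \<and> inj_on fst A \<and> inj_on snd A"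

lemma parent_eq_Some_iff:
  assumes "inj_on snd A"
  shows "parent A w = Some u \<longleftrightarrow> (u, w) \<in> A"
proof -
  have uniq: "u = u'" if "(u, w) \<in> A" "(u', w) \<in> A" for u u'
    using inj_onD[OF assms, of "(u, w)" "(u', w)"] that by simp
  show ?thesis
  proof (cases "\<exists>u. (u, w) \<in> A")
    case True
    then obtain u' where u': "(u', w) \<in> A" by blast
    then have "(THE u. (u, w) \<in> A) = u'" using uniq by (intro the_equality)
    then have "parent A w = Some u'" using True by (simp add: parent_def)
    then show ?thesis using u' uniq by (metis option.inject)
  qed (auto simp: parent_def)
qed

lemma parent_inj:
  assumes "partial_matching A" "parent A x = Some u" "parent A y = Some u"
  shows "x = y"
  using assms inj_onD[of fst A "(u, x)" "(u, y)"]
  by (auto simp: partial_matching_def parent_eq_Some_iff)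

text \<open>Parents change only at heads of changed arcs, so at most \<open>Suc h\<close> vertices
  per changed arc switch sides. Such a vertex affects at most one arc as tail and one as head, which
  gives 1 + 2 (h + 1).\<close>

lemma card_sym_diff_selected:
  assumes A: "partial_matching A" and A': "partial_matching A'"
  shows "card (sym_diff (selected n h r b A) (selected n h r b A')) \<le>
    (2 * h + 3) * card (sym_diff A A')"
proof -
  let ?D = "{v. side n h r (parent A) v \<noteq> side n h r (parent A') v}"
  let ?X = "snd ` sym_diff A A'"
  have fin: "finite (sym_diff A A')" using A A' by (auto simp: partial_matching_def)
  have "parent A x = parent A' x" if "x \<notin> ?X" for x
  proof -
    have "(u, x) \<in> A \<longleftrightarrow> (u, x) \<in> A'" for u using that by force
    then show ?thesis by (simp add: parent_def)
  qed
  with parent_inj[OF A] have "finite ?D \<and> card ?D \<le> Suc h * card ?X"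
    by (intro card_lead_diff finite_imageI fin)
  then have D: "finite ?D" "card ?D \<le> Suc h * card ?X" by auto
  have X: "card ?X \<le> card (sym_diff A A')" using fin by (rule card_image_le)
  let ?B1 = "{x \<in> A. fst x \<in> ?D}" and ?B2 = "{x \<in> A. snd x \<in> ?D}"
  have B: "card ?B1 \<le> card ?D" "card ?B2 \<le> card ?D" "finite ?B1" "finite ?B2"
  proof -
    have inj: "inj_on fst ?B1" "inj_on snd ?B2"
      using A by (auto simp: partial_matching_def intro: inj_on_subset[of _ A])
    show "card ?B1 \<le> card ?D" by (rule card_inj_on_le[OF inj(1) _ D(1)]) blast
    show "card ?B2 \<le> card ?D" by (rule card_inj_on_le[OF inj(2) _ D(1)]) blast
  qed (use A in \<open>auto simp: partial_matching_def\<close>)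
  have "sym_diff (selected n h r b A) (selected n h r b A') \<subseteq> sym_diff A A' \<union> (?B1 \<union> ?B2)"
    by (auto simp: selected_def)
  then have "card (sym_diff (selected n h r b A) (selected n h r b A')) \<le>
      card (sym_diff A A' \<union> (?B1 \<union> ?B2))"
    using fin B by (intro card_mono) auto
  also have "\<dots> \<le> card (sym_diff A A') + (card ?B1 + card ?B2)"
    by (meson add_left_mono card_Un_le order_trans)
  also have "\<dots> \<le> card (sym_diff A A') + 2 * (Suc h * card (sym_diff A A'))"
    using B(1,2) D(2) X mult_le_mono2[OF X, of "Suc h"] by linarith
  also have "\<dots> = (2 * h + 3) * card (sym_diff A A')" by (simp add: algebra_simps)
  finally show ?thesis .
qed

section \<open>Product distributions\<close>

lemma expectation_pair_pmf_finite:
  fixes f :: "'a \<times> 'b \<Rightarrow> real"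
  assumes "finite (set_pmf p)" "finite (set_pmf q)"
  shows "measure_pmf.expectation (pair_pmf p q) f =
    measure_pmf.expectation p (\<lambda>a. measure_pmf.expectation q (\<lambda>b. f (a, b)))"
proof -
  have "measure_pmf.expectation (pair_pmf p q) f
      = (\<Sum>x\<in>set_pmf p \<times> set_pmf q. pmf (pair_pmf p q) x *\<^sub>R f x)"
    using assms by (intro integral_measure_pmf) auto
  also have "\<dots> = (\<Sum>a\<in>set_pmf p. \<Sum>b\<in>set_pmf q. pmf p a * pmf q b * f (a, b))"
    by (simp add: sum.cartesian_product case_prod_unfold pmf_pair prod.collapse flip: pmf_pair)
  also have "\<dots> = (\<Sum>a\<in>set_pmf p. pmf p a *\<^sub>R (\<Sum>b\<in>set_pmf q. pmf q b *\<^sub>R f (a, b)))"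
    by (simp add: sum_distrib_left mult.assoc)
  also have "\<dots> = measure_pmf.expectation p (\<lambda>a. \<Sum>b\<in>set_pmf q. pmf q b *\<^sub>R f (a, b))"
    using assms by (intro integral_measure_pmf[symmetric]) auto
  also have "(\<lambda>a. \<Sum>b\<in>set_pmf q. pmf q b *\<^sub>R f (a, b))
      = (\<lambda>a. measure_pmf.expectation q (\<lambda>b. f (a, b)))"
    using assms by (intro ext integral_measure_pmf[symmetric]) auto
  finally show ?thesis .
qed

lemma expectation_mono_pmf:
  fixes f g :: "'a \<Rightarrow> real"
  assumes "finite (set_pmf p)" "\<And>x. x \<in> set_pmf p \<Longrightarrow> f x \<le> g x"
  shows "measure_pmf.expectation p f \<le> measure_pmf.expectation p g"
  using assms by (intro integral_mono_AE integrable_measure_pmf_finite) (auto simp: AE_measure_pmf_iff)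

lemma finite_set_Pi_pmf:
  assumes "finite I" "\<And>i. i \<in> I \<Longrightarrow> finite (set_pmf (p i))"
  shows "finite (set_pmf (Pi_pmf I d p))"
proof -
  have "set_pmf (Pi_pmf I d p) \<subseteq> PiE_dflt I d (set_pmf \<circ> p)"
    using assms by (intro set_Pi_pmf_subset')
  moreover have "finite (PiE_dflt I d (set_pmf \<circ> p))"
    using assms by (intro finite_PiE_dflt) auto
  ultimately show ?thesis by (rule finite_subset)
qed

lemma prob_Pi_pmf_coordinate_indep:
  assumes I: "finite I" "i \<in> I" and A: "\<And>f y. A (f(i := y)) = A f"
  shows "measure_pmf.prob (Pi_pmf I d p) {f. A f \<and> f i \<in> B} =
    measure_pmf.prob (Pi_pmf I d p) {f. A f} * measure_pmf.prob (p i) B"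
proof -
  let ?q = "Pi_pmf (I - {i}) d p"
  have I': "Pi_pmf I d p = map_pmf (\<lambda>(y, f). f(i := y)) (pair_pmf (p i) ?q)"
    using Pi_pmf_insert[of "I - {i}" i d p] I by (simp add: insert_absorb)
  have *: "measure_pmf.prob (Pi_pmf I d p) {f. A f \<and> f i \<in> C} =
      measure_pmf.prob (p i) C * measure_pmf.prob ?q {f. A f}" for C
  proof -
    have "measure_pmf.prob (Pi_pmf I d p) {f. A f \<and> f i \<in> C} =
        measure_pmf.prob (pair_pmf (p i) ?q) (C \<times> {f. A f})"
      unfolding I' measure_map_pmf by (rule arg_cong[where f = "measure _"]) (auto simp: A)
    also have "\<dots> = measure_pmf.prob (p i) C * measure_pmf.prob ?q {f. A f}"
    proof -
      have "measure_pmf.prob (pair_pmf (p i) ?q) (C \<times> {f. A f}) =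
          measure_pmf.prob (pair_pmf (p i) ?q) ((C \<inter> set_pmf (p i)) \<times> ({f. A f} \<inter> set_pmf ?q))"
        by (subst measure_Int_set_pmf[symmetric]) (auto intro: arg_cong[where f = "measure _"])
      also have "\<dots> = measure_pmf.prob (p i) (C \<inter> set_pmf (p i)) *
          measure_pmf.prob ?q ({f. A f} \<inter> set_pmf ?q)"
        by (intro measure_pmf_prob_product) auto
      finally show ?thesis by (simp only: measure_Int_set_pmf)
    qed
    finally show ?thesis .
  qed
  \<comment> \<open>Taking \<open>UNIV\<close> for the coordinate shows that \<open>A\<close> has
    the same probability with and without coordinate \<open>i\<close>.\<close>
  from *[of UNIV] have "measure_pmf.prob (Pi_pmf I d p) {f. A f} = measure_pmf.prob ?q {f. A f}"
    by simp
  with *[of B] show ?thesis by simp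
qed

abbreviation uniform :: "int \<Rightarrow> int pmf" where
  "uniform R \<equiv> pmf_of_set {0..<R}"

lemma set_uniform: "0 < R \<Longrightarrow> set_pmf (uniform R) = {0..<R}"
  by (simp add: set_pmf_of_set)

lemma prob_uniform_less:
  assumes "0 \<le> x" "x \<le> R" "0 < R"
  shows "measure_pmf.prob (uniform R) {..<x} = of_int x / of_int R"
proof -
  have "{0..<R} \<inter> {..<x} = {0..<x}" using assms by auto
  then show ?thesis using assms by (simp add: measure_pmf_of_set)
qed

text \<open>A discrete form of integrating x^(m-1): Bernoulli's inequality gives m x^(m-1) \<le>
  (x+1)^m - x^m, and the right-hand sides telescope.\<close>

lemma sum_power_le:
  fixes R m :: nat
  assumes "0 < m"
  shows "real m * (\<Sum>i=1..R. real i ^ (m - 1)) \<le> real (Suc R) ^ m"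
proof (induction R)
  case (Suc R)
  let ?x = "real (Suc R)"
  have "1 + real m * (1 / ?x) \<le> (1 + 1 / ?x) ^ m"
    by (rule Bernoulli_inequality) (rule order_trans[of _ 0], simp_all)
  then have "?x ^ m * (1 + real m * (1 / ?x)) \<le> ?x ^ m * (1 + 1 / ?x) ^ m"
    by (rule mult_left_mono) simp
  also have "\<dots> = (?x * (1 + 1 / ?x)) ^ m" by (simp only: power_mult_distrib)
  also have "?x * (1 + 1 / ?x) = real (Suc (Suc R))" by (simp add: field_simps)
  also have "?x ^ m * (1 + real m * (1 / ?x)) = ?x ^ m + real m * ?x ^ (m - 1)"
    using assms by (cases m) (simp_all add: field_simps)
  finally show ?case using Suc by (simp add: algebra_simps)
qed simp

text \<open>Without ties the probability would be 1/m by symmetry. Ties cost at most a factor (1 +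
  1/R)^m, which is below \<open>exp 1\<close> because the range \<open>R\<close> is at least
  \<open>m\<close>.\<close>

lemma prob_first_minimal_le:
  assumes I: "finite I" "J \<subseteq> I" "j0 \<in> J" and m: "card J = m" "int m \<le> R"
  shows "measure_pmf.prob (Pi_pmf I d (\<lambda>_. uniform R)) {f. \<forall>j\<in>J. f j0 \<le> f j} \<le> 3 / real m"
proof -
  let ?P = "Pi_pmf I d (\<lambda>_. uniform R)"
  have finJ: "finite J" using I finite_subset by blast
  have m0: "0 < m" using m(1) I finJ by (auto simp: card_gt_0_iff)
  define r where "r = nat R"
  have R: "R = int r" "0 < r" "m \<le> r" using m m0 by (auto simp: r_def)
  \<comment> \<open>A product event: coordinate \<open>j0\<close> takes the value \<open>t\<close>
    and the other coordinates in \<open>J\<close> are at least \<open>t\<close>. These events cover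
    the one in question as \<open>t\<close> varies.\<close>
  define E where "E t = Pi I (\<lambda>j. if j = j0 then {t} else if j \<in> J then {t..} else UNIV)" for t :: int
  have E: "measure_pmf.prob ?P (E (int t)) = real (r - t) ^ (m - 1) / real r ^ m" if t: "t < r" for t
  proof -
    have "{0..<R} \<inter> {int t..} = {int t..<R}" using R by auto
    then have p1: "measure_pmf.prob (uniform R) {int t..} = real (r - t) / real r"
      using t R by (simp add: measure_pmf_of_set of_nat_diff)
    have p0: "measure_pmf.prob (uniform R) {int t} = 1 / real r"
      using t R by (simp add: measure_pmf_of_set)
    have "measure_pmf.prob ?P (E (int t)) =
        (\<Prod>j\<in>I. measure_pmf.prob (uniform R) (if j = j0 then {int t} else if j \<in> J then {int t..} else UNIV))"
      unfolding E_def using I(1) by (rule measure_Pi_pmf_Pi)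
    also have "\<dots> = (\<Prod>j\<in>J. measure_pmf.prob (uniform R) (if j = j0 then {int t} else if j \<in> J then {int t..} else UNIV))"
      using I by (intro prod.mono_neutral_right) auto
    also have "\<dots> = 1 / real r * (\<Prod>j\<in>J - {j0}. real (r - t) / real r)"
      using finJ I by (subst prod.remove[of J j0]) (auto simp: p0 p1 intro!: prod.cong)
    also have "\<dots> = 1 / real r * (real (r - t) / real r) ^ (m - 1)"
      using finJ I m by (simp add: card_Diff_singleton)
    also have "\<dots> = real (r - t) ^ (m - 1) / real r ^ m"
      using m0 by (cases m) (simp_all add: power_divide)
    finally show ?thesis .
  qed
  have "measure_pmf.prob ?P {f. \<forall>j\<in>J. f j0 \<le> f j} \<le> measure_pmf.prob ?P (\<Union>t\<in>{..<r}. E (int t))"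
  proof (rule measure_pmf.finite_measure_mono_AE; (unfold AE_measure_pmf_iff)?; (intro ballI impI)?)
    fix f assume f: "f \<in> set_pmf ?P" "f \<in> {f. \<forall>j\<in>J. f j0 \<le> f j}"
    have "f \<in> PiE_dflt I d (set_pmf \<circ> (\<lambda>_. uniform R))"
      using f(1) set_Pi_pmf_subset'[OF I(1), of d "\<lambda>_. uniform R"] by blast
    then have "f j0 \<in> {0..<R}" using I R by (auto simp: PiE_dflt_def set_uniform)
    then have "f \<in> E (int (nat (f j0)))" "nat (f j0) < r" using f(2) R by (auto simp: E_def)
    then show "f \<in> (\<Union>t\<in>{..<r}. E (int t))" by blast
  qed simp
  also have "\<dots> \<le> (\<Sum>t<r. measure_pmf.prob ?P (E (int t)))"
    by (intro measure_pmf.finite_measure_subadditive_finite) auto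
  also have "\<dots> = (\<Sum>t<r. real (r - t) ^ (m - 1) / real r ^ m)" using E by simp
  also have "\<dots> = (\<Sum>i=1..r. real i ^ (m - 1)) / real r ^ m"
    unfolding sum_divide_distrib
    by (rule sum.reindex_bij_witness[of _ "\<lambda>i. r - i" "\<lambda>t. r - t"]) auto
  also have "\<dots> \<le> (real (Suc r) ^ m / real m) / real r ^ m"
    using sum_power_le[OF m0, of r] m0 by (intro divide_right_mono) (auto simp: field_simps)
  also have "\<dots> = (1 + 1 / real r) ^ m / real m"
  proof -
    have "1 + 1 / real r = real (Suc r) / real r" using R by (simp add: field_simps)
    then show ?thesis by (simp only: power_divide) simp
  qed
  also have "\<dots> \<le> 3 / real m"
  proof (rule divide_right_mono)
    have "(1 + 1 / real r) ^ m \<le> exp (1 / real r) ^ m"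
      by (intro power_mono) (auto simp: exp_ge_add_one_self)
    also have "\<dots> = exp (real m / real r)" by (simp add: exp_of_nat_mult[symmetric])
    also have "\<dots> \<le> exp 1" using R by simp
    also have "\<dots> \<le> 3" by (rule exp_le)
    finally show "(1 + 1 / real r) ^ m \<le> 3" .
  qed simp
  finally show ?thesis .
qed

section \<open>Expected number of quitters and its two consequences\<close>

context deferred_acceptance
begin

text \<open>Proposal \<open>(u, p)\<close> owns coin number \<open>u * (k * n) + p\<close>; the
  guard \<open>p < k * n\<close> keeps a position behind the end of the list from reading a coin of
  the next proposer.\<close>

definition below :: "(nat \<Rightarrow> int) \<Rightarrow> (int \<Rightarrow> int) \<Rightarrow> nat \<Rightarrow> nat \<Rightarrow> bool" where
  "below thr \<omega> u p \<longleftrightarrow> p < k * n \<and> \<omega> (int (u * (k * n) + p)) < thr (p mod n)"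

definition coins :: "int \<Rightarrow> (int \<Rightarrow> int) pmf" where
  "coins R = Pi_pmf {0..<int (n * (k * n))} 0 (\<lambda>_. uniform R)"

lemma finite_coins: "0 < R \<Longrightarrow> finite (set_pmf (coins R))"
  unfolding coins_def by (rule finite_set_Pi_pmf) (auto simp: set_uniform)

context
  fixes R :: int and thr :: "nat \<Rightarrow> int"
  assumes R: "0 < R" and thr: "\<And>w. 0 \<le> thr w" "\<And>w. thr w \<le> R"
begin

abbreviation expect :: "((int \<Rightarrow> int) \<Rightarrow> real) \<Rightarrow> real" where
  "expect \<equiv> measure_pmf.expectation (coins R)"

lemma integrable_coins [simp]: "integrable (measure_pmf (coins R)) (f :: (int \<Rightarrow> int) \<Rightarrow> real)"
  by (intro integrable_measure_pmf_finite finite_coins R)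

text \<open>Whether the proposal \<open>(u, p)\<close> is rejected does not depend on the coin attached to it, so
  every rejection makes its proposer quit with the prescribed probability.\<close>

lemma expected_quitters:
  assumes S: "S \<subseteq> {..<n}"
  shows "expect (\<lambda>\<omega>. real (card (quitters S (below thr \<omega>)))) =
    expect (\<lambda>\<omega>. \<Sum>(u, p)\<in>rejections S (below thr \<omega>). of_int (thr (p mod n)) / of_int R)"
proof -
  let ?U = "{..<n} \<times> {..<k * n}"
  define rej where "rej x = {\<omega>. x \<in> rejections S (below thr \<omega>)}" for x
  define qt where "qt x = {\<omega>. x \<in> quitters S (below thr \<omega>)}" for x
  have subU: "rejections S q \<subseteq> ?U" for q using S by (auto simp: rejections_def proposals_def)
  then have subU': "quitters S q \<subseteq> ?U" for q by (auto simp: quitters_def)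
  have prob: "measure_pmf.prob (coins R) (qt x) =
      measure_pmf.prob (coins R) (rej x) * (of_int (thr (snd x mod n)) / of_int R)"
    if x: "x \<in> ?U" for x
  proof -
    obtain u p where [simp]: "x = (u, p)" by (cases x)
    define i where "i = int (u * (k * n) + p)"
    have up: "u < n" "p < k * n" using x by auto
    have "u * (k * n) + p < Suc u * (k * n)" using up by simp
    also have "\<dots> \<le> n * (k * n)" using up by (intro mult_le_mono1) simp
    finally have i: "i \<in> {0..<int (n * (k * n))}"
      by (simp add: i_def del: of_nat_mult of_nat_add)
    have "below thr (g(i := y)) u' p' = below thr g u' p'" if "(u', p') \<noteq> (u, p)" for g y u' p'
    proof (cases "p' < k * n")
      case True
      have "u' * (k * n) + p' \<noteq> u * (k * n) + p"
      proof
        assume eq: "u' * (k * n) + p' = u * (k * n) + p"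
        then have "(u' * (k * n) + p') div (k * n) = (u * (k * n) + p) div (k * n)" by simp
        moreover have "(a * N + b) div N = a" if "b < N" for a b N :: nat using that by simp
        ultimately have "u' = u" using True up by metis
        with eq that show False by simp
      qed
      then show ?thesis by (simp add: below_def i_def del: of_nat_mult of_nat_add)
    qed (simp add: below_def)
    then have indep: "(u, p) \<in> rejections S (below thr (g(i := y))) \<longleftrightarrow> (u, p) \<in> rejections S (below thr g)" for g y
      by (intro rejections_indep[OF S])
    have "qt x = {\<omega>. (u, p) \<in> rejections S (below thr \<omega>) \<and> \<omega> i \<in> {..<thr (p mod n)}}"
      using up by (auto simp: qt_def quitters_def below_def[of _ _ u p] i_def)
    then have "measure_pmf.prob (coins R) (qt x) =
       measure_pmf.prob (coins R) {\<omega>. (u, p) \<in> rejections S (below thr \<omega>)} *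
       measure_pmf.prob (uniform R) {..<thr (p mod n)}"
      unfolding coins_def using i indep
      by (simp only: prob_Pi_pmf_coordinate_indep[where p = "\<lambda>_. uniform R"] finite_atLeastLessThan_int)
    then show ?thesis using thr R by (simp add: rej_def prob_uniform_less)
  qed
  have "expect (\<lambda>\<omega>. real (card (quitters S (below thr \<omega>)))) = expect (\<lambda>\<omega>. \<Sum>x\<in>?U. indicator (qt x) \<omega>)"
    using subU' by (intro arg_cong[where f = expect] ext)
      (simp add: qt_def indicator_def sum.If_cases Int_absorb1 Int_commute)
  also have "\<dots> = (\<Sum>x\<in>?U. measure_pmf.prob (coins R) (qt x))"
    by (subst Bochner_Integration.integral_sum) auto
  also have "\<dots> = (\<Sum>x\<in>?U. measure_pmf.prob (coins R) (rej x) * (of_int (thr (snd x mod n)) / of_int R))"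
    by (intro sum.cong prob refl)
  also have "\<dots> = expect (\<lambda>\<omega>. \<Sum>x\<in>?U. indicator (rej x) \<omega> * (of_int (thr (snd x mod n)) / of_int R))"
    by (subst Bochner_Integration.integral_sum) auto
  also have "\<dots> = expect (\<lambda>\<omega>. \<Sum>(u, p)\<in>rejections S (below thr \<omega>). of_int (thr (p mod n)) / of_int R)"
  proof (intro arg_cong[where f = expect] ext)
    fix \<omega>
    have "(\<Sum>x\<in>?U. indicator (rej x) \<omega> * (of_int (thr (snd x mod n)) / of_int R :: real)) =
        (\<Sum>x\<in>?U. if x \<in> rejections S (below thr \<omega>) then of_int (thr (snd x mod n)) / of_int R else 0)"
      by (intro sum.cong) (auto simp: rej_def)
    also have "\<dots> = (\<Sum>x\<in>?U \<inter> rejections S (below thr \<omega>). of_int (thr (snd x mod n)) / of_int R)"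
      by (simp add: sum.inter_restrict)
    also have "?U \<inter> rejections S (below thr \<omega>) = rejections S (below thr \<omega>)" using subU by blast
    finally show "(\<Sum>x\<in>?U. indicator (rej x) \<omega> * (of_int (thr (snd x mod n)) / of_int R :: real)) =
        (\<Sum>(u, p)\<in>rejections S (below thr \<omega>). of_int (thr (p mod n)) / of_int R)"
      by (simp add: case_prod_unfold)
  qed
  finally show ?thesis .
qed

text \<open>By \<open>expected_quitters\<close> and \<open>rejections_level_bound\<close>, the
  expected number of quitters is at most 1/k times that of held proposals. Their term in
  \<open>card_mult_le\<close> therefore turns the factor k + 1 into k + 2.\<close>

lemma expected_arcs_ge:
  assumes D: "D \<subseteq> {(u, w). u < n \<and> w < n \<and> adj u w}" "inj_on fst D" "inj_on snd D"
    and k: "0 < k"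
    and thr_le: "\<And>w. w < n \<Longrightarrow> real (card {u. u < n \<and> adj u w}) * (of_int (thr w) / of_int R) \<le> 1 / real k ^ 2"
  shows "real k * real (card D) \<le> (real k + 2) * expect (\<lambda>\<omega>. real (card (arcs {..<n} (below thr \<omega>))))"
proof -
  let ?q = "below thr"
  let ?H = "\<lambda>\<omega>. real (card (held {..<n} (?q \<omega>)))" and ?Q = "\<lambda>\<omega>. real (card (quitters {..<n} (?q \<omega>)))"
  have "expect ?Q = expect (\<lambda>\<omega>. \<Sum>(u, p)\<in>rejections {..<n} (?q \<omega>). of_int (thr (p mod n)) / of_int R)"
    by (rule expected_quitters) simp
  also have "\<dots> \<le> expect (\<lambda>\<omega>. real k * (1 / real k ^ 2) * ?H \<omega>)"
    using thr R by (intro integral_mono rejections_level_bound[where c = "\<lambda>w. of_int (thr w) / of_int R"] thr_le) auto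
  also have "\<dots> = expect ?H / real k" using k by (simp add: power2_eq_square)
  finally have "real k * expect ?Q \<le> expect ?H" using k by (simp add: field_simps)
  moreover have "real k * real (card D) \<le> expect (\<lambda>\<omega>. (real k + 1) * ?H \<omega> + real k * ?Q \<omega>)"
  proof -
    have "real k * real (card D) = expect (\<lambda>_. real k * real (card D))" by simp
    also have "\<dots> \<le> expect (\<lambda>\<omega>. (real k + 1) * ?H \<omega> + real k * ?Q \<omega>)"
    proof (rule integral_mono)
      fix \<omega>
      from card_mult_le[OF D, of "?q \<omega>"]
      have "real (k * card D) \<le> real ((k + 1) * card (held {..<n} (?q \<omega>)) + k * card (quitters {..<n} (?q \<omega>)))"
        by (rule of_nat_mono)
      then show "real k * real (card D) \<le> (real k + 1) * ?H \<omega> + real k * ?Q \<omega>" by (simp add: algebra_simps)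
    qed auto
    finally show ?thesis .
  qed
  moreover have "expect (\<lambda>\<omega>. (real k + 1) * ?H \<omega> + real k * ?Q \<omega>) = (real k + 1) * expect ?H + real k * expect ?Q"
    by simp
  ultimately show ?thesis by (simp add: card_arcs algebra_simps)
qed

text \<open>New rejections are converted into new quitters: each new rejection has weight at least
  \<open>c\<close>, the weighted rejections have the same expectation as the quitters, and the
  quitters grow by at most \<open>card (S' - S)\<close> for every outcome of the coins.\<close>

lemma expected_arcs_change:
  assumes S: "S \<subseteq> S'" "S' \<subseteq> {..<n}" and c: "0 < c"
    and thr_ge: "\<And>u w. u \<in> S' \<Longrightarrow> adj u w \<Longrightarrow> w < n \<Longrightarrow> c \<le> of_int (thr w) / of_int R"
  shows "expect (\<lambda>\<omega>. real (card (sym_diff (arcs S (below thr \<omega>)) (arcs S' (below thr \<omega>))))) \<le>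
    (2 / c + 1) * real (card (S' - S))"
proof -
  let ?q = "below thr"
  let ?g = "\<lambda>(u :: nat, p). of_int (thr (p mod n)) / of_int R :: real"
  have S1: "S \<subseteq> {..<n}" using S by blast
  have fin: "finite S" "finite S'" using finite_subset[OF S1] finite_subset[OF S(2)] by auto
  let ?N = "\<lambda>\<omega>. rejections S' (?q \<omega>) - rejections S (?q \<omega>)"
  have "c * expect (\<lambda>\<omega>. real (card (?N \<omega>))) = expect (\<lambda>\<omega>. c * real (card (?N \<omega>)))" by simp
  also have "\<dots> \<le> expect (\<lambda>\<omega>. sum ?g (rejections S' (?q \<omega>)) - sum ?g (rejections S (?q \<omega>)))"
  proof (rule integral_mono)
    fix \<omega>
    have "c * real (card (?N \<omega>)) = (\<Sum>x\<in>?N \<omega>. c)" by simp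
    also have "\<dots> \<le> sum ?g (?N \<omega>)"
    proof (rule sum_mono)
      fix x assume "x \<in> ?N \<omega>"
      moreover obtain u p where [simp]: "x = (u, p)" by (cases x)
      ultimately have "u \<in> S'" "adj u (p mod n)" "p < k * n"
        by (auto simp: rejections_def proposals_def)
      then show "c \<le> ?g x" using thr_ge[of u "p mod n"] by (cases "n = 0") auto
    qed
    also have "\<dots> = sum ?g (rejections S' (?q \<omega>)) - sum ?g (rejections S (?q \<omega>))"
      using rejections_mono[OF S] finite_sets(1)[OF fin(2)] by (intro sum_diff)
    finally show "c * real (card (?N \<omega>)) \<le> sum ?g (rejections S' (?q \<omega>)) - sum ?g (rejections S (?q \<omega>))" .
  qed auto
  also have "\<dots> = expect (\<lambda>\<omega>. real (card (quitters S' (?q \<omega>)))) - expect (\<lambda>\<omega>. real (card (quitters S (?q \<omega>))))"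
    by (simp add: expected_quitters[OF S(2)] expected_quitters[OF S1])
  also have "\<dots> = expect (\<lambda>\<omega>. real (card (quitters S' (?q \<omega>))) - real (card (quitters S (?q \<omega>))))" by simp
  also have "\<dots> \<le> expect (\<lambda>\<omega>. real (card (S' - S)))"
  proof (rule integral_mono)
    fix \<omega> show "real (card (quitters S' (?q \<omega>))) - real (card (quitters S (?q \<omega>))) \<le> real (card (S' - S))"
      using card_quitters_le[OF S, of "?q \<omega>"] by linarith
  qed auto
  finally have "expect (\<lambda>\<omega>. real (card (?N \<omega>))) \<le> real (card (S' - S)) / c"
    using c by (simp add: field_simps)
  moreover have "expect (\<lambda>\<omega>. real (card (sym_diff (arcs S (?q \<omega>)) (arcs S' (?q \<omega>))))) \<le>
      expect (\<lambda>\<omega>. 2 * real (card (?N \<omega>)) + real (card (S' - S)))"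
  proof (rule integral_mono)
    fix \<omega> show "real (card (sym_diff (arcs S (?q \<omega>)) (arcs S' (?q \<omega>)))) \<le> 2 * real (card (?N \<omega>)) + real (card (S' - S))"
      using card_sym_diff_arcs[OF S, of "?q \<omega>"] by linarith
  qed auto
  ultimately show ?thesis by (simp add: algebra_simps)
qed

end

end

text \<open>The range \<open>h + 2\<close> is the number of nodes in the union of the windows of two
  consecutive vertices, the least range that \<open>prob_first_minimal_le\<close> admits.\<close>

definition labels :: "nat \<Rightarrow> nat \<Rightarrow> (int \<Rightarrow> int) pmf" where
  "labels n h = Pi_pmf {0..<int (n * Suc h)} 0 (\<lambda>_. uniform (int h + 2))"

definition ranks :: "(int \<Rightarrow> int) \<Rightarrow> nat \<Rightarrow> nat" where
  "ranks \<rho> j = nat (\<rho> (int j))"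

lemma finite_labels: "finite (set_pmf (labels n h))"
  unfolding labels_def by (rule finite_set_Pi_pmf) (auto simp: set_uniform)

text \<open>By \<open>conflict_imp_extreme\<close> a conflict needs \<open>h + 2\<close> distinct
  nodes and puts a minimal rank at one of the two ends; each of these two events has probability at
  most 3/(h + 2).\<close>

lemma prob_conflict_le:
  assumes A: "partial_matching A" "A \<subseteq> {..<n} \<times> {..<n}"
    and colour: "\<And>u w. (u, w) \<in> A \<Longrightarrow> f u = (\<not> f w)" and uw: "(u, w) \<in> A"
  shows "measure_pmf.prob (labels n h)
      {\<rho>. side n h (ranks \<rho>) (parent A) u = side n h (ranks \<rho>) (parent A) w} \<le> 6 / (real h + 2)"
proof -
  let ?par = "parent A"
  have par: "?par x = Some v \<longleftrightarrow> (v, x) \<in> A" for v x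
    using A by (simp add: partial_matching_def parent_eq_Some_iff)
  define y where "y i = (step_back ?par ^^ i) (w, 0)" for i
  define idx where "idx z = int (fst z * Suc h + snd z)" for z :: "nat \<times> nat"
  define I where "I = {0..<int (n * Suc h)}"
  define first where "first i = {\<rho> :: int \<Rightarrow> int. \<forall>j\<in>idx ` y ` {..Suc h}. \<rho> (idx (y i)) \<le> \<rho> j}" for i
  have wn: "w < n" using uw A by auto
  have y_Suc: "y (Suc i) = (step_back ?par ^^ i) (u, 0)" for i
    unfolding y_def using uw par[of w u] by (simp add: funpow_Suc_right del: funpow.simps)
  have yb: "fst (y i) < n \<and> snd (y i) \<le> h" if "i \<le> Suc h" for i
  proof (cases i)
    case 0
    then show ?thesis using wn by (simp add: y_def)
  next
    case (Suc j)
    have "fst ((step_back ?par ^^ j) (u, 0)) < n \<and> snd ((step_back ?par ^^ j) (u, 0)) \<le> snd (u, 0::nat) + j"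
      by (rule step_back_bounds) (use A uw par in auto)
    then show ?thesis using that Suc by (simp add: y_Suc)
  qed
  have idx_lt: "idx (y i) \<in> I" if "i \<le> Suc h" for i
  proof -
    have "fst (y i) * Suc h + snd (y i) < Suc (fst (y i)) * Suc h" using yb[OF that] by simp
    also have "\<dots> \<le> n * Suc h" using yb[OF that] by (intro mult_le_mono1) simp
    finally show ?thesis by (simp add: idx_def I_def del: mult_Suc mult_Suc_right of_nat_mult of_nat_add)
  qed
  show ?thesis
  proof (cases "inj_on y {..Suc h}")
    case True
    have inj_idx: "inj_on idx (y ` {..Suc h})"
    proof (rule inj_onI, clarify)
      fix a b a' b' i i' assume eq: "idx (a, b) = idx (a', b')" "i \<le> Suc h" "i' \<le> Suc h"
        "(a, b) = y i" "(a', b') = y i'"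
      have "b \<le> h" "b' \<le> h" using yb[OF eq(2)] yb[OF eq(3)] eq(4,5) by (metis snd_conv)+
      moreover have "a * Suc h + b = a' * Suc h + b'" using eq(1) unfolding idx_def fst_conv snd_conv
        by (simp only: of_nat_eq_iff)
      then have "(a * Suc h + b) div Suc h = (a' * Suc h + b') div Suc h"
        "(a * Suc h + b) mod Suc h = (a' * Suc h + b') mod Suc h" by simp_all
      ultimately show "a = a' \<and> b = b'" by (simp del: mult_Suc_right)
    qed
    have card: "card (idx ` y ` {..Suc h}) = h + 2"
      using True inj_idx by (simp add: card_image)
    have first: "measure_pmf.prob (labels n h) (first i) \<le> 3 / (real h + 2)" if "i \<le> Suc h" for i
    proof -
      have "measure_pmf.prob (Pi_pmf I 0 (\<lambda>_. uniform (int h + 2)))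
          {f. \<forall>j\<in>idx ` y ` {..Suc h}. f (idx (y i)) \<le> f j} \<le> 3 / real (h + 2)"
        by (rule prob_first_minimal_le[OF _ _ _ card]) (use idx_lt that in \<open>auto simp: I_def\<close>)
      moreover have "real (h + 2) = real h + 2" by simp
      ultimately show ?thesis by (simp only: labels_def first_def I_def)
    qed
    have "{\<rho>. side n h (ranks \<rho>) ?par u = side n h (ranks \<rho>) ?par w} \<inter> set_pmf (labels n h)
        \<subseteq> first 0 \<union> first (Suc h)"
    proof
      fix \<rho> assume \<rho>: "\<rho> \<in> {\<rho>. side n h (ranks \<rho>) ?par u = side n h (ranks \<rho>) ?par w} \<inter> set_pmf (labels n h)"
      have nonneg: "0 \<le> \<rho> j" if "j \<in> I" for j
      proof -
        have "\<rho> \<in> PiE_dflt I 0 (set_pmf \<circ> (\<lambda>_. uniform (int h + 2)))"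
          using \<rho> set_Pi_pmf_subset'[of I 0 "\<lambda>_. uniform (int h + 2)"] by (auto simp: labels_def I_def)
        then show ?thesis using that by (auto simp: PiE_dflt_def set_uniform)
      qed
      have "inj_on y {..Suc h} \<and>
        ((\<forall>i\<le>Suc h. label n h (ranks \<rho>) (y 0) \<le> label n h (ranks \<rho>) (y i)) \<or>
         (\<forall>i\<le>Suc h. label n h (ranks \<rho>) (y (Suc h)) \<le> label n h (ranks \<rho>) (y i)))"
        unfolding y_def
      proof (rule conflict_imp_extreme[where f = f])
        show "?par w = Some u" using uw par by blast
        show "side n h (ranks \<rho>) ?par u = side n h (ranks \<rho>) ?par w" using \<rho> by blast
        show "\<And>x y u. ?par x = Some u \<Longrightarrow> ?par y = Some u \<Longrightarrow> x = y" using parent_inj[OF A(1)] by blast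
        show "\<And>x u. x < n \<Longrightarrow> ?par x = Some u \<Longrightarrow> u < n" using par A(2) by blast
        show "\<And>x u. ?par x = Some u \<Longrightarrow> f u = (\<not> f x)" using par colour by blast
      qed (fact wn)
      moreover have "\<rho> \<in> first i" if "i \<le> Suc h" "\<forall>j\<le>Suc h. label n h (ranks \<rho>) (y i) \<le> label n h (ranks \<rho>) (y j)" for i
      proof -
        have "\<rho> (idx (y i)) \<le> \<rho> (idx (y j))" if "j \<le> Suc h" for j
        proof -
          have "ranks \<rho> (fst (y i) * Suc h + snd (y i)) \<le> ranks \<rho> (fst (y j) * Suc h + snd (y j))"
            by (rule label_le_imp[where n = n]) (use yb \<open>j \<le> Suc h\<close> \<open>\<forall>j\<le>Suc h. _ j\<close> in auto)
          then show ?thesis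
            using nonneg[OF idx_lt[OF \<open>i \<le> Suc h\<close>]] nonneg[OF idx_lt[OF \<open>j \<le> Suc h\<close>]]
            unfolding ranks_def idx_def by (simp only: nat_le_eq_zle)
        qed
        then show ?thesis by (auto simp: first_def)
      qed
      ultimately show "\<rho> \<in> first 0 \<union> first (Suc h)" by blast
    qed
    then have "measure_pmf.prob (labels n h) {\<rho>. side n h (ranks \<rho>) ?par u = side n h (ranks \<rho>) ?par w}
        \<le> measure_pmf.prob (labels n h) (first 0 \<union> first (Suc h))"
      by (subst measure_Int_set_pmf[symmetric]) (intro measure_pmf.finite_measure_mono, auto)
    also have "\<dots> \<le> measure_pmf.prob (labels n h) (first 0) + measure_pmf.prob (labels n h) (first (Suc h))"
      by (intro measure_Un_le) auto
    also have "\<dots> \<le> 6 / (real h + 2)" using first[of 0] first[of "Suc h"] by simp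
    finally show ?thesis .
  next
    case False
    have "{\<rho>. side n h (ranks \<rho>) ?par u = side n h (ranks \<rho>) ?par w} = {}"
    proof (rule ccontr)
      assume "\<not> ?thesis"
      then obtain \<rho> where "side n h (ranks \<rho>) ?par u = side n h (ranks \<rho>) ?par w" by blast
      then have "inj_on (\<lambda>i. (step_back ?par ^^ i) (w, 0)) {..Suc h}"
        using conflict_imp_extreme[of ?par w u n f h "ranks \<rho>"] par uw wn parent_inj[OF A(1)] A(2) colour
        by blast
      then show False using False by (simp add: y_def[abs_def])
    qed
    then show ?thesis by simp
  qed
qed

section \<open>The random matching\<close>

definition adjacent :: "nat set set \<Rightarrow> nat \<Rightarrow> nat \<Rightarrow> bool" where
  "adjacent E u w \<longleftrightarrow> {u, w} \<in> E"

text \<open>Relative to \<open>coin_range\<close>, this is the rate 1/(k^2 deg w) rounded down.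
  Division by zero makes it 0 at isolated vertices, which receive no proposals.\<close>

definition threshold :: "nat \<Rightarrow> nat set set \<Rightarrow> nat \<Rightarrow> int" where
  "threshold n E w = int (2 * Suc n div deg E w)"

text \<open>Independent of the edges, so that the same coins serve a graph and the graph with an
  edge deleted. The factor \<open>2 * Suc n\<close> keeps the quotient in \<open>threshold\<close>
  positive at every vertex of positive degree.\<close>

definition coin_range :: "nat \<Rightarrow> nat \<Rightarrow> int" where
  "coin_range n k = int (2 * (k * k) * Suc n)"

definition arc_set :: "nat \<Rightarrow> nat \<Rightarrow> nat set set \<Rightarrow> (int \<Rightarrow> int) \<Rightarrow> (nat \<times> nat) set" where
  "arc_set n k E \<omega> = deferred_acceptance.arcs n k (adjacent E) {..<n}
     (deferred_acceptance.below n k (threshold n E) \<omega>)"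

definition matched_edges ::
    "nat \<Rightarrow> nat \<Rightarrow> nat \<Rightarrow> nat set set \<Rightarrow> (int \<Rightarrow> int) \<Rightarrow> (int \<Rightarrow> int) \<Rightarrow> bool \<Rightarrow> nat set set" where
  "matched_edges n k h E \<omega> \<rho> b = (\<lambda>(u, w). {u, w}) ` selected n h (ranks \<rho>) b (arc_set n k E \<omega>)"

definition randomness :: "nat \<Rightarrow> nat \<Rightarrow> nat \<Rightarrow> ((int \<Rightarrow> int) \<times> (int \<Rightarrow> int) \<times> int) pmf" where
  "randomness n k h =
     pair_pmf (deferred_acceptance.coins n k (coin_range n k)) (pair_pmf (labels n h) (uniform 2))"

definition random_matching :: "nat \<Rightarrow> nat \<Rightarrow> nat \<Rightarrow> nat set set \<Rightarrow> nat set set pmf" where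
  "random_matching n k h E =
     map_pmf (\<lambda>(\<omega>, \<rho>, b). matched_edges n k h E \<omega> \<rho> (0 < b)) (randomness n k h)"

section \<open>Degrees and quitting thresholds\<close>

lemma coin_range_pos: "0 < k \<Longrightarrow> 0 < coin_range n k"
  unfolding coin_range_def by (simp only: of_nat_0_less_iff) simp

lemma finite_randomness: "0 < k \<Longrightarrow> finite (set_pmf (randomness n k h))"
  by (simp add: randomness_def deferred_acceptance.finite_coins finite_labels coin_range_pos set_uniform)

lemma simple_graph_edge:
  assumes "simple_graph {..<n} E" "{u, w} \<in> E"
  shows "u < n" "w < n" "u \<noteq> w"
  using assms by (auto simp: simple_graph_def)

lemma finite_edges:
  assumes "simple_graph V E"
  shows "finite E"
  using assms by (auto simp: simple_graph_def intro: finite_subset[of E "Pow V"])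

lemma deg_eq:
  assumes "simple_graph {..<n} E"
  shows "deg E w = card {u. u < n \<and> adjacent E u w}"
proof -
  have "bij_betw (\<lambda>u. {u, w}) {u. u < n \<and> adjacent E u w} {e \<in> E. w \<in> e}"
    unfolding bij_betw_def
  proof
    show "inj_on (\<lambda>u. {u, w}) {u. u < n \<and> adjacent E u w}"
      by (auto simp: inj_on_def doubleton_eq_iff)
    show "(\<lambda>u. {u, w}) ` {u. u < n \<and> adjacent E u w} = {e \<in> E. w \<in> e}"
    proof (intro equalityI subsetI)
      fix e assume "e \<in> {e \<in> E. w \<in> e}"
      then have e: "e \<in> E" "w \<in> e" "card e = 2" "e \<subseteq> {..<n}" using assms by (auto simp: simple_graph_def)
      then obtain u where "e = {u, w}" by (metis card_2_iff doubleton_eq_iff insertE singletonD)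
      then show "e \<in> (\<lambda>u. {u, w}) ` {u. u < n \<and> adjacent E u w}"
        using e by (auto simp: adjacent_def)
    qed (auto simp: adjacent_def)
  qed
  then show ?thesis unfolding deg_def by (metis bij_betw_same_card)
qed

lemma deg_le_max_degree: "w < n \<Longrightarrow> deg E w \<le> max_degree {..<n :: nat} E"
  unfolding max_degree_def by (intro Max_ge) auto

lemma deg_le_n:
  assumes "simple_graph {..<n} E"
  shows "deg E w \<le> n"
  unfolding deg_eq[OF assms] by (rule order_trans[OF card_mono[of "{..<n}"]]) auto

lemma deg_pos:
  fixes u w n :: nat
  assumes "simple_graph {..<n} E" "{u, w} \<in> E"
  shows "0 < deg E w"
  unfolding deg_eq[OF assms(1)] using assms simple_graph_edge[OF assms]
  by (auto simp: card_gt_0_iff adjacent_def)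

lemma threshold_bounds:
  assumes "0 < k"
  shows "0 \<le> threshold n E w" "threshold n E w \<le> coin_range n k"
proof -
  have "2 * Suc n div deg E w \<le> 2 * Suc n" by (rule div_le_dividend)
  also have "\<dots> \<le> (k * k) * (2 * Suc n)" using assms by (cases k) simp_all
  also have "\<dots> = 2 * (k * k) * Suc n" by (simp only: ac_simps)
  finally show "threshold n E w \<le> coin_range n k"
    unfolding threshold_def coin_range_def by (simp only: of_nat_le_iff)
qed (simp add: threshold_def)

lemma threshold_upper:
  assumes "0 < k"
  shows "real (deg E w) * (of_int (threshold n E w) / of_int (coin_range n k)) \<le> 1 / real k ^ 2"
proof -
  have "deg E w * (2 * Suc n div deg E w) \<le> 2 * Suc n" by (rule times_div_less_eq_dividend)
  then have "real (deg E w) * real (2 * Suc n div deg E w) \<le> real (2 * Suc n)"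
    by (simp only: of_nat_le_iff flip: of_nat_mult)
  then have "real (deg E w) * of_int (threshold n E w) \<le> real (2 * Suc n)"
    unfolding threshold_def by simp
  then have "real (deg E w) * of_int (threshold n E w) / real (2 * Suc n) \<le> 1" by (simp add: field_simps)
  moreover have "real_of_int (coin_range n k) = real k ^ 2 * real (2 * Suc n)"
    by (simp add: coin_range_def power2_eq_square algebra_simps)
  ultimately have "real (deg E w) * (of_int (threshold n E w) / of_int (coin_range n k)) =
      (real (deg E w) * of_int (threshold n E w) / real (2 * Suc n)) * (1 / real k ^ 2)" by simp
  also have "\<dots> \<le> 1 * (1 / real k ^ 2)"
    using \<open>_ \<le> 1\<close> by (intro mult_right_mono) simp_all
  finally show ?thesis by simp
qed

lemma threshold_lower:
  assumes k: "0 < k" and d: "0 < deg E w" "deg E w \<le> n" "deg E w \<le> \<Delta>"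
  shows "1 / (2 * real k ^ 2 * real \<Delta>) \<le> of_int (threshold n E w) / of_int (coin_range n k)"
proof -
  let ?d = "deg E w" and ?q = "2 * Suc n div deg E w"
  have "1 \<le> ?q" using d by (metis One_nat_def Suc_leI div_greater_zero_iff le_SucI mult_2 trans_le_add1)
  \<comment> \<open>The rounding error is below \<open>?d\<close>, hence below or equal to
    \<open>?q * ?d\<close>; this is where the factor 2 of \<open>threshold\<close> is spent.\<close>
  moreover have "2 * Suc n < ?q * ?d + ?d" using d(1) by (metis dividend_less_div_times add.commute)
  ultimately have "2 * Suc n < 2 * (?q * ?d)"
    by (metis add_less_cancel_left linorder_not_less mult_2 mult_le_mono1 nat_add_left_cancel_le
        nat_mult_1 order_less_le_trans)
  then have "Suc n \<le> ?q * ?d" by simp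
  also have "\<dots> \<le> ?q * \<Delta>" using d by simp
  finally have "real (Suc n) \<le> of_int (threshold n E w) * real \<Delta>"
    unfolding threshold_def by (simp only: of_int_of_nat_eq of_nat_le_iff flip: of_nat_mult)
  then have "1 \<le> of_int (threshold n E w) * real \<Delta> / real (Suc n)" by (simp add: field_simps)
  then have "1 / (2 * real k ^ 2 * real \<Delta>) * 1 \<le>
      1 / (2 * real k ^ 2 * real \<Delta>) * (of_int (threshold n E w) * real \<Delta> / real (Suc n))"
    by (intro mult_left_mono) simp_all
  also have "\<dots> = of_int (threshold n E w) / (2 * real k ^ 2 * real (Suc n))" using d by simp
  also have "2 * real k ^ 2 * real (Suc n) = real_of_int (coin_range n k)"
    by (simp add: coin_range_def power2_eq_square algebra_simps)
  finally show ?thesis by simp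
qed

section \<open>From selected arcs to a large matching\<close>

lemma arc_set_adjacent: "(u, w) \<in> arc_set n k E \<omega> \<Longrightarrow> {u, w} \<in> E"
  unfolding arc_set_def by (drule deferred_acceptance.arc_adj) (simp add: adjacent_def)

lemma arc_set_partial_matching: "partial_matching (arc_set n k E \<omega>)"
  unfolding partial_matching_def arc_set_def
  using deferred_acceptance.finite_sets(5)[of "{..<n}" n k "adjacent E"]
  by (auto simp: inj_on_def
      dest: deferred_acceptance.arcs_left_unique deferred_acceptance.arcs_right_unique[OF _ _ order_refl])

lemma arc_set_bounds: "simple_graph {..<n} E \<Longrightarrow> arc_set n k E \<omega> \<subseteq> {..<n} \<times> {..<n}"
  using simple_graph_edge[of n E] by (auto dest!: arc_set_adjacent)

text \<open>Tails lie on side \<open>b\<close> and heads on the other side, so two selected arcs can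
  meet only in a common tail or a common head, and in a partial matching they are then
  equal.\<close>

lemma selected_disjoint:
  assumes "partial_matching A" "(u, w) \<in> selected n h r b A" "(u', w') \<in> selected n h r b A"
    "{u, w} \<inter> {u', w'} \<noteq> {}"
  shows "(u, w) = (u', w')"
proof -
  have "u \<noteq> w'" "w \<noteq> u'" using assms(2,3) by (auto simp: selected_def)
  then have "u = u' \<or> w = w'" using assms(4) by auto
  then show ?thesis
    using assms(1-3) inj_onD[of fst A "(u, w)" "(u', w')"] inj_onD[of snd A "(u, w)" "(u', w')"]
    by (auto simp: selected_def partial_matching_def)
qed

lemma matching_matched_edges: "matching E (matched_edges n k h E \<omega> \<rho> b)"
  unfolding matching_def
proof (intro conjI ballI impI)
  show "matched_edges n k h E \<omega> \<rho> b \<subseteq> E"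
    using arc_set_adjacent by (auto simp: matched_edges_def selected_def)
  fix e f assume ef: "e \<in> matched_edges n k h E \<omega> \<rho> b" "f \<in> matched_edges n k h E \<omega> \<rho> b" "e \<noteq> f"
  then obtain u w u' w' where *: "e = {u, w}" "f = {u', w'}"
    "(u, w) \<in> selected n h (ranks \<rho>) b (arc_set n k E \<omega>)" "(u', w') \<in> selected n h (ranks \<rho>) b (arc_set n k E \<omega>)"
    by (auto simp: matched_edges_def)
  show "e \<inter> f = {}"
  proof (rule ccontr)
    assume "e \<inter> f \<noteq> {}"
    from selected_disjoint[OF arc_set_partial_matching *(3,4)] this * ef(3) show False by simp
  qed
qed

lemma card_matched_edges:
  "card (matched_edges n k h E \<omega> \<rho> b) = card (selected n h (ranks \<rho>) b (arc_set n k E \<omega>))"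
  unfolding matched_edges_def
proof (rule card_image, rule inj_onI, clarify)
  fix u w u' w'
  assume "(u, w) \<in> selected n h (ranks \<rho>) b (arc_set n k E \<omega>)"
    "(u', w') \<in> selected n h (ranks \<rho>) b (arc_set n k E \<omega>)" "{u, w} = {u', w'}"
  then have "(u, w) = (u', w')" by (intro selected_disjoint[OF arc_set_partial_matching]) auto
  then show "u = u' \<and> w = w'" by simp
qed

lemma bipartite_colouring:
  assumes "bipartite_graph V E"
  obtains f where "\<And>u w. {u, w} \<in> E \<Longrightarrow> f u = (\<not> f w)"
proof -
  from assms obtain L R where LR: "L \<inter> R = {}" "\<And>e. e \<in> E \<Longrightarrow> \<exists>u\<in>L. \<exists>v\<in>R. e = {u, v}"
    unfolding bipartite_graph_def by metis
  have "(u \<in> L) = (w \<notin> L)" if "{u, w} \<in> E" for u w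
    using LR(2)[OF that] LR(1) by (auto simp: doubleton_eq_iff)
  then show ?thesis by (rule that)
qed

lemma bipartite_simple: "bipartite_graph V E \<Longrightarrow> simple_graph V E"
  by (simp add: bipartite_graph_def)

lemma bipartite_subset:
  assumes "bipartite_graph V E" "F \<subseteq> E"
  shows "bipartite_graph V F"
proof -
  from assms(1) obtain L R where "simple_graph V E" "L \<union> R = V \<and> L \<inter> R = {}"
    "\<forall>e\<in>E. \<exists>u\<in>L. \<exists>v\<in>R. e = {u, v}"
    unfolding bipartite_graph_def by metis
  moreover from this have "\<forall>e\<in>F. \<exists>u\<in>L. \<exists>v\<in>R. e = {u, v}" "simple_graph V F"
    using assms(2) by (auto simp: simple_graph_def)
  ultimately show ?thesis unfolding bipartite_graph_def by metis
qed

lemma finite_selected: "finite A \<Longrightarrow> finite (selected n h r b A)"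
  unfolding selected_def by (rule finite_subset[of _ A]) auto

text \<open>An arc whose ends guess different sides is selected for exactly one of the two values of
  \<open>b\<close>, which gives the factor 1/2; the other factor is the probability that no conflict
  occurs.\<close>

lemma expected_selected_ge:
  assumes A: "partial_matching A" "A \<subseteq> {..<n} \<times> {..<n}"
    and colour: "\<And>u w. (u, w) \<in> A \<Longrightarrow> f u = (\<not> f w)"
  shows "(1 - 6 / (real h + 2)) / 2 * real (card A) \<le>
    measure_pmf.expectation (labels n h) (\<lambda>\<rho>. measure_pmf.expectation (uniform 2)
      (\<lambda>b. real (card (selected n h (ranks \<rho>) (0 < b) A))))"
proof -
  have finA: "finite A" using A by (simp add: partial_matching_def)
  define conf where "conf x = {\<rho>. side n h (ranks \<rho>) (parent A) (fst x) = side n h (ranks \<rho>) (parent A) (snd x)}" for x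
  have half: "measure_pmf.expectation (uniform 2) (\<lambda>b. real (card (selected n h (ranks \<rho>) (0 < b) A)))
      = real (card {x \<in> A. \<rho> \<notin> conf x}) / 2" for \<rho>
  proof -
    have two: "{0..<2::int} = {0, 1}" by auto
    have "measure_pmf.expectation (uniform 2) (\<lambda>b. real (card (selected n h (ranks \<rho>) (0 < b) A)))
        = (real (card (selected n h (ranks \<rho>) False A)) + real (card (selected n h (ranks \<rho>) True A))) / 2"
      by (subst integral_pmf_of_set) (auto simp: two)
    also have "card (selected n h (ranks \<rho>) False A) + card (selected n h (ranks \<rho>) True A)
        = card (selected n h (ranks \<rho>) False A \<union> selected n h (ranks \<rho>) True A)"
      using finA by (intro card_Un_disjoint[symmetric] finite_selected) (auto simp: selected_def)
    then have "real (card (selected n h (ranks \<rho>) False A)) + real (card (selected n h (ranks \<rho>) True A))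
        = real (card (selected n h (ranks \<rho>) False A \<union> selected n h (ranks \<rho>) True A))" by linarith
    also have "selected n h (ranks \<rho>) False A \<union> selected n h (ranks \<rho>) True A = {x \<in> A. \<rho> \<notin> conf x}"
      by (auto simp: selected_def conf_def)
    finally show ?thesis .
  qed
  have int: "integrable (measure_pmf (labels n h)) (g :: (int \<Rightarrow> int) \<Rightarrow> real)" for g
    by (intro integrable_measure_pmf_finite finite_labels)
  have "measure_pmf.expectation (labels n h) (\<lambda>\<rho>. real (card {x \<in> A. \<rho> \<notin> conf x}))
      = measure_pmf.expectation (labels n h) (\<lambda>\<rho>. \<Sum>x\<in>A. 1 - indicator (conf x) \<rho>)"
  proof (rule arg_cong[where f = "measure_pmf.expectation (labels n h)"], rule ext)
    fix \<rho>
    have "real (card {x \<in> A. \<rho> \<notin> conf x}) = (\<Sum>x\<in>{x \<in> A. \<rho> \<notin> conf x}. 1)" by simp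
    also have "\<dots> = (\<Sum>x\<in>A. if \<rho> \<notin> conf x then 1 else 0)" using finA by (rule sum.inter_filter)
    also have "\<dots> = (\<Sum>x\<in>A. 1 - indicator (conf x) \<rho>)" by (intro sum.cong) auto
    finally show "real (card {x \<in> A. \<rho> \<notin> conf x}) = (\<Sum>x\<in>A. 1 - indicator (conf x) \<rho>)" .
  qed
  also have "\<dots> = (\<Sum>x\<in>A. 1 - measure_pmf.prob (labels n h) (conf x))"
    by (subst Bochner_Integration.integral_sum) (auto simp: int Bochner_Integration.integral_diff)
  also have "\<dots> \<ge> (\<Sum>x\<in>A. 1 - 6 / (real h + 2))"
  proof (rule sum_mono)
    fix x assume "x \<in> A"
    then have "(fst x, snd x) \<in> A" by simp
    from prob_conflict_le[where f = f and h = h, OF A colour this]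
    show "1 - 6 / (real h + 2) \<le> 1 - measure_pmf.prob (labels n h) (conf x)"
      unfolding conf_def by simp
  qed
  finally have "(1 - 6 / (real h + 2)) * real (card A)
      \<le> measure_pmf.expectation (labels n h) (\<lambda>\<rho>. real (card {x \<in> A. \<rho> \<notin> conf x}))"
    by (simp add: mult.commute)
  then show ?thesis unfolding half by simp
qed

text \<open>Both orientations of a maximum matching form a set \<open>D\<close> of 2 \<nu> pairs,
  which makes up for the factor 1/2 of the selection. With h = 6 k conflicts have probability at
  most 1/k, and (1 - 1/k) k/(k + 2) = 1 - 3/(k + 2).\<close>

lemma expected_random_matching_ge:
  assumes E: "bipartite_graph {..<n} E" and k: "0 < k"
  shows "(1 - 3 / real k) * real (matching_number E) \<le>
    measure_pmf.expectation (random_matching n k (6 * k) E) (\<lambda>M. real (card M))"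
proof -
  let ?h = "6 * k" and ?\<Omega> = "deferred_acceptance.coins n k (coin_range n k)"
  have sg: "simple_graph {..<n} E" using E by (rule bipartite_simple)
  obtain f where f: "\<And>u w. {u, w} \<in> E \<Longrightarrow> f u = (\<not> f w)" using bipartite_colouring[OF E] by blast
  have fin: "finite (set_pmf ?\<Omega>)" using coin_range_pos[OF k] by (rule deferred_acceptance.finite_coins)
  define \<nu> where "\<nu> = matching_number E"
  have "finite {M. matching E M}"
    using finite_edges[OF sg] by (rule finite_subset[rotated, OF finite_Pow_iff[THEN iffD2]]) (auto simp: matching_def)
  then have "\<nu> \<in> card ` {M. matching E M}"
    unfolding \<nu>_def matching_number_def
    by (intro Max_in finite_imageI) (auto simp: matching_def[of _ "{}"] intro: exI[of _ "{}"])
  then obtain M where M: "matching E M" "card M = \<nu>" by auto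
  define D where "D = {(u, w). {u, w} \<in> M}"
  have ME: "M \<subseteq> E" using M by (simp add: matching_def)
  have finM: "finite M" using finite_subset[OF ME finite_edges[OF sg]] .
  have D: "D \<subseteq> {(u, w). u < n \<and> w < n \<and> adjacent E u w}"
    using ME simple_graph_edge[OF sg] by (auto simp: D_def adjacent_def)
  have uniq: "e = e'" if "e \<in> M" "e' \<in> M" "x \<in> e" "x \<in> e'" for e e' x
    using M that by (auto simp: matching_def)
  have injD: "inj_on fst D" "inj_on snd D"
  proof -
    show "inj_on fst D"
    proof (rule inj_onI, clarsimp simp: D_def)
      fix u w w' assume "{u, w} \<in> M" "{u, w'} \<in> M"
      from uniq[OF this, of u] show "w = w'" by (auto simp: doubleton_eq_iff)
    qed
    show "inj_on snd D"
    proof (rule inj_onI, clarsimp simp: D_def)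
      fix u u' w assume "{u, w} \<in> M" "{u', w} \<in> M"
      from uniq[OF this, of w] show "u = u'" by (auto simp: doubleton_eq_iff)
    qed
  qed
  have cardD: "card D = 2 * \<nu>"
  proof -
    have "card D = (\<Sum>e\<in>M. card {x \<in> D. (\<lambda>(u, w). {u, w}) x = e})"
    proof (subst card_eq_sum, subst sum.group[symmetric, where g = "\<lambda>(u, w). {u, w}" and T = M])
      show "finite D" using finite_subset[OF D] by (auto intro: finite_subset[of _ "{..<n} \<times> {..<n}"])
    qed (auto simp: finM D_def)
    also have "\<dots> = (\<Sum>e\<in>M. 2)"
    proof (rule sum.cong)
      fix e assume e: "e \<in> M"
      then have "card e = 2" using ME sg by (auto simp: simple_graph_def)
      then obtain a b where ab: "e = {a, b}" "a \<noteq> b" by (auto simp: card_2_iff)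
      have "{x \<in> D. (\<lambda>(u, w). {u, w}) x = e} = {(a, b), (b, a)}"
        using e ab by (auto simp: D_def doubleton_eq_iff insert_commute)
      then show "card {x \<in> D. (\<lambda>(u, w). {u, w}) x = e} = 2" using ab by simp
    qed simp
    finally show ?thesis using M by simp
  qed
  have "real k * real (card D) \<le> (real k + 2) * measure_pmf.expectation ?\<Omega> (\<lambda>\<omega>. real (card (arc_set n k E \<omega>)))"
    unfolding arc_set_def
    by (rule deferred_acceptance.expected_arcs_ge[OF coin_range_pos[OF k] threshold_bounds[OF k] D injD k])
       (use threshold_upper[OF k, of E _ n] in \<open>simp only: deg_eq[OF sg]\<close>)
  then have arcs: "2 * real k * real \<nu> \<le> (real k + 2) * measure_pmf.expectation ?\<Omega> (\<lambda>\<omega>. real (card (arc_set n k E \<omega>)))"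
    by (simp add: cardD)
  let ?c = "(1 - 6 / (real ?h + 2)) / 2"
  have "?c * measure_pmf.expectation ?\<Omega> (\<lambda>\<omega>. real (card (arc_set n k E \<omega>)))
      = measure_pmf.expectation ?\<Omega> (\<lambda>\<omega>. ?c * real (card (arc_set n k E \<omega>)))" by simp
  also have "\<dots> \<le> measure_pmf.expectation ?\<Omega> (\<lambda>\<omega>. measure_pmf.expectation (labels n ?h)
      (\<lambda>\<rho>. measure_pmf.expectation (uniform 2) (\<lambda>b. real (card (matched_edges n k ?h E \<omega> \<rho> (0 < b))))))"
    unfolding card_matched_edges
    by (intro expectation_mono_pmf[OF fin] expected_selected_ge[where f = f] arc_set_partial_matching
        arc_set_bounds sg f) (rule arc_set_adjacent)
  also have "\<dots> = measure_pmf.expectation (random_matching n k ?h E) (\<lambda>M. real (card M))"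
    unfolding random_matching_def randomness_def
    by (simp add: case_prod_unfold expectation_pair_pmf_finite fin finite_labels set_uniform)
  finally have "?c * measure_pmf.expectation ?\<Omega> (\<lambda>\<omega>. real (card (arc_set n k E \<omega>)))
      \<le> measure_pmf.expectation (random_matching n k ?h E) (\<lambda>M. real (card M))" .
  moreover have "(1 - 3 / real k) * real \<nu> \<le> ?c * measure_pmf.expectation ?\<Omega> (\<lambda>\<omega>. real (card (arc_set n k E \<omega>)))"
  proof -
    let ?X = "measure_pmf.expectation ?\<Omega> (\<lambda>\<omega>. real (card (arc_set n k E \<omega>)))"
    have X: "2 * real k * real \<nu> / (real k + 2) \<le> ?X" using arcs by (simp add: field_simps)
    have X0: "0 \<le> ?X" by (rule integral_nonneg_AE) simp
    have "1 - 1 / real k \<le> 1 - 6 / (real ?h + 2)" using k by (simp add: field_simps)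
    then have c: "(1 - 1 / real k) / 2 \<le> ?c" by simp
    have "(1 - 3 / real k) * real \<nu> \<le> (1 - 1 / real k) / 2 * (2 * real k * real \<nu> / (real k + 2))"
    proof -
      have "3 / (real k + 2) \<le> 3 / real k" using k by (intro frac_le) auto
      moreover have "(1 - 1 / real k) * (real k / (real k + 2)) = (real k - 1) / (real k + 2)"
        using k by (simp add: left_diff_distrib diff_divide_distrib)
      moreover have "(real k - 1) / (real k + 2) = 1 - 3 / (real k + 2)" by (simp add: field_simps)
      ultimately have "1 - 3 / real k \<le> (1 - 1 / real k) * (real k / (real k + 2))" by linarith
      then have "(1 - 3 / real k) * real \<nu> \<le> (1 - 1 / real k) * (real k / (real k + 2)) * real \<nu>"
        by (rule mult_right_mono) simp
      also have "\<dots> = (1 - 1 / real k) / 2 * (2 * real k * real \<nu> / (real k + 2))" by simp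
      finally show ?thesis .
    qed
    also have "\<dots> \<le> (1 - 1 / real k) / 2 * ?X" using k by (intro mult_left_mono X) simp
    also have "\<dots> \<le> ?c * ?X" using c X0 by (rule mult_right_mono)
    finally show ?thesis .
  qed
  ultimately show ?thesis unfolding \<nu>_def by linarith
qed

section \<open>Deleting one edge\<close>

lemma max_degree_mono:
  assumes "finite E" "F \<subseteq> E"
  shows "max_degree {..<n} F \<le> max_degree {..<n :: nat} E"
proof -
  have "deg F w \<le> max_degree {..<n} E" if "w < n" for w
  proof -
    have "deg F w \<le> deg E w" unfolding deg_def using assms by (intro card_mono) auto
    also have "\<dots> \<le> max_degree {..<n} E" using that by (rule deg_le_max_degree)
    finally show ?thesis .
  qed
  then show ?thesis unfolding max_degree_def[of _ F] by (subst Max_le_iff) auto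
qed

lemma card_sym_diff_triangle:
  assumes "finite A" "finite B" "finite C"
  shows "card (sym_diff A C) \<le> card (sym_diff A B) + card (sym_diff B C)"
proof -
  have "card (sym_diff A C) \<le> card (sym_diff A B \<union> sym_diff B C)"
    using assms by (intro card_mono) auto
  also have "\<dots> \<le> card (sym_diff A B) + card (sym_diff B C)" by (rule card_Un_le)
  finally show ?thesis .
qed

text \<open>Once all neighbours of both ends of \<open>e\<close> are kept from proposing, the two instances coincide.\<close>

lemma expected_arc_set_change:
  assumes sg: "simple_graph {..<n} E" and e: "e \<in> E" and k: "0 < k"
  shows "measure_pmf.expectation (deferred_acceptance.coins n k (coin_range n k))
      (\<lambda>\<omega>. real (card (sym_diff (arc_set n k E \<omega>) (arc_set n k (E - {e}) \<omega>))))
    \<le> 20 * real k ^ 2 * real (max_degree {..<n} E) ^ 2"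
proof -
  let ?F = "E - {e}" and ?\<Omega> = "deferred_acceptance.coins n k (coin_range n k)"
  define \<Delta> where "\<Delta> = max_degree {..<n} E"
  have sgF: "simple_graph {..<n} ?F" using sg by (auto simp: simple_graph_def)
  obtain a b where ab: "e = {a, b}" using sg e by (auto simp: simple_graph_def card_2_iff)
  then have abn: "a < n" "b < n" using simple_graph_edge[OF sg] e by auto
  \<comment> \<open>Both ends of \<open>e\<close> lie in \<open>X\<close> too, being adjacent to
    each other. A proposer outside \<open>X\<close> has neither end as a neighbour, so it sees no
    change in its list or in the degrees of its receivers.\<close>
  define X where "X = {u. u < n \<and> adjacent E u a} \<union> {u. u < n \<and> adjacent E u b}"
  define S where "S = {..<n} - X"
  have S: "S \<subseteq> {..<n}" by (auto simp: S_def)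
  have "deg E a \<le> \<Delta>" "deg E b \<le> \<Delta>" unfolding \<Delta>_def using abn by (auto intro: deg_le_max_degree)
  then have cardX: "card X \<le> 2 * \<Delta>"
    unfolding X_def using card_Un_le[of "{u. u < n \<and> adjacent E u a}" "{u. u < n \<and> adjacent E u b}"]
    by (simp add: deg_eq[OF sg])
  have SX: "{..<n} - S = X" by (auto simp: S_def X_def)
  have \<Delta>1: "1 \<le> \<Delta>"
    using deg_pos[OF sg, of a b] e ab \<open>deg E b \<le> \<Delta>\<close> by simp
  \<comment> \<open>The lower bound of \<open>threshold_lower\<close> for the quitting rate, valid
    for \<open>E\<close> and for \<open>E - {e}\<close> with the same \<Delta>.\<close>
  define c where "c = 1 / (2 * real k ^ 2 * real \<Delta>)"
  have c: "0 < c" using k \<Delta>1 by (simp add: c_def)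
  have fin: "finite (set_pmf ?\<Omega>)" using coin_range_pos[OF k] by (rule deferred_acceptance.finite_coins)
  define arcsS where "arcsS H \<omega> = deferred_acceptance.arcs n k (adjacent H) S
     (deferred_acceptance.below n k (threshold n H) \<omega>)" for H \<omega>
  have bound: "measure_pmf.expectation ?\<Omega> (\<lambda>\<omega>. real (card (sym_diff (arcsS H \<omega>) (arc_set n k H \<omega>))))
      \<le> (2 / c + 1) * real (card X)" if H: "simple_graph {..<n} H" "H \<subseteq> E" for H
    unfolding arcsS_def arc_set_def SX[symmetric]
  proof (rule deferred_acceptance.expected_arcs_change[OF coin_range_pos[OF k] threshold_bounds[OF k] S order_refl c])
    fix u w assume "u \<in> {..<n}" "adjacent H u w" "w < n"
    moreover have "max_degree {..<n} H \<le> \<Delta>" unfolding \<Delta>_def using finite_edges[OF sg] H(2) by (rule max_degree_mono)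
    ultimately show "c \<le> of_int (threshold n H w) / of_int (coin_range n k)"
      unfolding c_def using deg_pos[OF H(1), of u w] deg_le_n[OF H(1)] deg_le_max_degree[of w n H]
      by (intro threshold_lower k) (auto simp: adjacent_def)
  qed
  have cong: "arcsS E \<omega> = arcsS ?F \<omega>" for \<omega>
    unfolding arcsS_def
  proof (rule arcs_cong[OF S])
    fix u w assume "u \<in> S"
    then show adj: "adjacent E u w = adjacent ?F u w"
      using ab abn e by (auto simp: S_def X_def adjacent_def doubleton_eq_iff insert_commute)
  next
    fix u p assume u: "u \<in> S" "adjacent E u (p mod n)"
    let ?w = "p mod n"
    have "?w \<noteq> a" "?w \<noteq> b" using u by (auto simp: S_def X_def)
    then have "{e \<in> E. ?w \<in> e} = {e \<in> ?F. ?w \<in> e}" using ab by auto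
    then have "deg E ?w = deg ?F ?w" unfolding deg_def by simp
    then show "deferred_acceptance.below n k (threshold n E) \<omega> u p = deferred_acceptance.below n k (threshold n ?F) \<omega> u p"
      by (simp add: deferred_acceptance.below_def threshold_def)
  qed
  have finA: "finite (arc_set n k H \<omega>)" "finite (arcsS H \<omega>)" for H \<omega>
    unfolding arc_set_def arcsS_def using finite_subset[OF S]
    by (auto intro!: deferred_acceptance.finite_sets(5))
  have "measure_pmf.expectation ?\<Omega> (\<lambda>\<omega>. real (card (sym_diff (arc_set n k E \<omega>) (arc_set n k ?F \<omega>))))
      \<le> measure_pmf.expectation ?\<Omega> (\<lambda>\<omega>. real (card (sym_diff (arcsS E \<omega>) (arc_set n k E \<omega>))) +
          real (card (sym_diff (arcsS ?F \<omega>) (arc_set n k ?F \<omega>))))"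
  proof (rule expectation_mono_pmf[OF fin])
    fix \<omega>
    have "card (sym_diff (arc_set n k E \<omega>) (arc_set n k ?F \<omega>)) \<le>
        card (sym_diff (arc_set n k E \<omega>) (arcsS E \<omega>)) + card (sym_diff (arcsS E \<omega>) (arc_set n k ?F \<omega>))"
      by (rule card_sym_diff_triangle) (fact finA)+
    then show "real (card (sym_diff (arc_set n k E \<omega>) (arc_set n k ?F \<omega>))) \<le>
        real (card (sym_diff (arcsS E \<omega>) (arc_set n k E \<omega>))) + real (card (sym_diff (arcsS ?F \<omega>) (arc_set n k ?F \<omega>)))"
      unfolding cong[symmetric] by (simp add: Un_commute)
  qed
  also have "\<dots> = measure_pmf.expectation ?\<Omega> (\<lambda>\<omega>. real (card (sym_diff (arcsS E \<omega>) (arc_set n k E \<omega>)))) +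
      measure_pmf.expectation ?\<Omega> (\<lambda>\<omega>. real (card (sym_diff (arcsS ?F \<omega>) (arc_set n k ?F \<omega>))))"
    by (intro Bochner_Integration.integral_add integrable_measure_pmf_finite fin)
  also have "\<dots> \<le> 2 * ((2 / c + 1) * real (card X))"
    using bound[OF sg order_refl] bound[OF sgF Diff_subset] by linarith
  \<comment> \<open>At most 2 \<Delta> proposers are barred and 2/c = 4 k^2 \<Delta>, so the two
    comparisons add up to 16 k^2 \<Delta>^2 + 4 \<Delta>, whence the constant 20.\<close>
  also have "\<dots> \<le> 2 * ((2 / c + 1) * (2 * real \<Delta>))"
    using cardX c by (intro mult_left_mono) auto
  also have "\<dots> = 16 * (real k ^ 2 * real \<Delta> ^ 2) + 4 * real \<Delta>"
    by (simp add: c_def algebra_simps power2_eq_square)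
  also have "\<dots> \<le> 16 * (real k ^ 2 * real \<Delta> ^ 2) + 4 * (real k ^ 2 * real \<Delta> ^ 2)"
  proof -
    have "1 \<le> real k ^ 2" using k by (intro one_le_power) simp
    moreover have "real \<Delta> \<le> real \<Delta> ^ 2" using \<Delta>1 by (simp add: power2_eq_square)
    ultimately have "1 * real \<Delta> \<le> real k ^ 2 * real \<Delta> ^ 2" by (intro mult_mono) auto
    then show ?thesis by linarith
  qed
  finally show ?thesis by (simp add: \<Delta>_def)
qed

text \<open>Feeding both functions from the same random source gives one admissible coupling; the
  costs are bounded below by 0, so the infimum lies below its cost.\<close>

lemma wasserstein_map_le:
  assumes "finite (set_pmf \<Omega>)"
  shows "wasserstein (map_pmf f \<Omega>) (map_pmf g \<Omega>) \<le>
    measure_pmf.expectation \<Omega> (\<lambda>x. real (card (sym_diff (f x) (g x))))"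
proof -
  let ?\<pi> = "map_pmf (\<lambda>x. (f x, g x)) \<Omega>"
  have "?\<pi> \<in> couplings (map_pmf f \<Omega>) (map_pmf g \<Omega>)"
    by (simp add: couplings_def pmf.map_comp o_def)
  then have "wasserstein (map_pmf f \<Omega>) (map_pmf g \<Omega>) \<le>
      measure_pmf.expectation ?\<pi> (\<lambda>(X, Y). real (card (sym_diff X Y)))"
    unfolding wasserstein_def
    by (intro cINF_lower bdd_belowI2[where m = 0] integral_nonneg_AE) (auto simp: case_prod_unfold)
  then show ?thesis by simp
qed

lemma wasserstein_random_matching_le:
  assumes sg: "simple_graph {..<n} E" and e: "e \<in> E" and k: "0 < k"
  shows "wasserstein (random_matching n k h E) (random_matching n k h (E - {e})) \<le>
    (2 * real h + 3) * (20 * real k ^ 2 * real (max_degree {..<n} E) ^ 2)"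
proof -
  let ?F = "E - {e}" and ?\<Omega> = "deferred_acceptance.coins n k (coin_range n k)"
  let ?\<Lambda> = "pair_pmf (labels n h) (uniform 2)"
  have fin: "finite (set_pmf ?\<Omega>)" using coin_range_pos[OF k] by (rule deferred_acceptance.finite_coins)
  have fin\<Lambda>: "finite (set_pmf ?\<Lambda>)" by (simp add: finite_labels set_uniform)
  have "wasserstein (random_matching n k h E) (random_matching n k h ?F) \<le>
      measure_pmf.expectation (randomness n k h)
        (\<lambda>x. real (card (sym_diff (case x of (\<omega>, \<rho>, b) \<Rightarrow> matched_edges n k h E \<omega> \<rho> (0 < b))
          (case x of (\<omega>, \<rho>, b) \<Rightarrow> matched_edges n k h ?F \<omega> \<rho> (0 < b)))))"
    unfolding random_matching_def by (rule wasserstein_map_le[OF finite_randomness[OF k]])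
  also have "\<dots> \<le> measure_pmf.expectation (randomness n k h)
      (\<lambda>x. (2 * real h + 3) * real (card (sym_diff (arc_set n k E (fst x)) (arc_set n k ?F (fst x)))))"
  proof (rule expectation_mono_pmf[OF finite_randomness[OF k]])
    fix x :: "(int \<Rightarrow> int) \<times> (int \<Rightarrow> int) \<times> int"
    obtain \<omega> \<rho> b where [simp]: "x = (\<omega>, \<rho>, b)" by (cases x)
    let ?s = "\<lambda>H. selected n h (ranks \<rho>) (0 < b) (arc_set n k H \<omega>)"
    have finS: "finite (?s H)" for H
      using arc_set_partial_matching by (intro finite_selected) (auto simp: partial_matching_def)
    have "sym_diff (matched_edges n k h E \<omega> \<rho> (0 < b)) (matched_edges n k h ?F \<omega> \<rho> (0 < b))
        \<subseteq> (\<lambda>(u, w). {u, w}) ` sym_diff (?s E) (?s ?F)"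
      unfolding matched_edges_def by blast
    then have "card (sym_diff (matched_edges n k h E \<omega> \<rho> (0 < b)) (matched_edges n k h ?F \<omega> \<rho> (0 < b)))
        \<le> card (sym_diff (?s E) (?s ?F))"
      using finS by (intro surj_card_le) auto
    also have "\<dots> \<le> (2 * h + 3) * card (sym_diff (arc_set n k E \<omega>) (arc_set n k ?F \<omega>))"
      by (intro card_sym_diff_selected arc_set_partial_matching)
    finally have "real (card (sym_diff (matched_edges n k h E \<omega> \<rho> (0 < b)) (matched_edges n k h ?F \<omega> \<rho> (0 < b))))
        \<le> real ((2 * h + 3) * card (sym_diff (arc_set n k E \<omega>) (arc_set n k ?F \<omega>)))"
      by (rule of_nat_mono)
    then show "real (card (sym_diff (case x of (\<omega>, \<rho>, b) \<Rightarrow> matched_edges n k h E \<omega> \<rho> (0 < b))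
          (case x of (\<omega>, \<rho>, b) \<Rightarrow> matched_edges n k h ?F \<omega> \<rho> (0 < b))))
        \<le> (2 * real h + 3) * real (card (sym_diff (arc_set n k E (fst x)) (arc_set n k ?F (fst x))))"
      by simp
  qed
  also have "\<dots> = (2 * real h + 3) * measure_pmf.expectation ?\<Omega>
      (\<lambda>\<omega>. real (card (sym_diff (arc_set n k E \<omega>) (arc_set n k ?F \<omega>))))"
    unfolding randomness_def by (subst expectation_pair_pmf_finite[OF fin fin\<Lambda>]) simp
  also have "\<dots> \<le> (2 * real h + 3) * (20 * real k ^ 2 * real (max_degree {..<n} E) ^ 2)"
    by (intro mult_left_mono expected_arc_set_change[OF sg e k]) simp
  finally show ?thesis .
qed

text \<open>Every edge becomes a pair of opposite arcs, whatever the coins are. The walk from either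
  end runs round a cycle of length 2, and \<open>conflict_imp_extreme\<close> excludes conflicts on
  a walk that repeats a node.\<close>

lemma random_matching_degree_one:
  assumes E: "bipartite_graph {..<n} E" and \<Delta>: "max_degree {..<n} E \<le> 1" and k: "0 < k" and h: "0 < h"
  shows "random_matching n k h E = return_pmf E"
proof -
  have sg: "simple_graph {..<n} E" using E by (rule bipartite_simple)
  obtain f where f: "\<And>u w. {u, w} \<in> E \<Longrightarrow> f u = (\<not> f w)" using bipartite_colouring[OF E] by blast
  have uniq: "u = u'" if "adjacent E u w" "adjacent E u' w" for u u' w
  proof -
    have "u < n" "u' < n" "w < n" using that simple_graph_edge[OF sg] by (auto simp: adjacent_def)
    then have "card {u. u < n \<and> adjacent E u w} \<le> 1"
      using deg_le_max_degree[of w n E] \<Delta> by (simp add: deg_eq[OF sg])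
    then show ?thesis using that \<open>u < n\<close> \<open>u' < n\<close>
      by (auto simp: card_le_Suc0_iff_eq)
  qed
  have arcs: "(u, w) \<in> arc_set n k E \<omega>" if uw: "{u, w} \<in> E" for u w \<omega>
    unfolding arc_set_def
  proof (rule deferred_acceptance.arcs_if_no_competition)
    show "u < n" "w < n" using simple_graph_edge[OF sg uw] by auto
    show "adjacent E u w" using uw by (simp add: adjacent_def)
    fix w' assume "adjacent E u w'"
    then show "w' = w" using uniq[of w' u w] uw by (simp add: adjacent_def insert_commute)
  qed (use uniq k in auto)
  have "matched_edges n k h E \<omega> \<rho> b = E" for \<omega> \<rho> b
  proof (intro equalityI subsetI)
    fix e assume e: "e \<in> E"
    then obtain u w where uw: "e = {u, w}" using sg by (auto simp: simple_graph_def card_2_iff)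
    let ?A = "arc_set n k E \<omega>" and ?side = "side n h (ranks \<rho>) (parent (arc_set n k E \<omega>))"
    have A: "(u, w) \<in> ?A" "(w, u) \<in> ?A" using arcs e uw by (auto simp: insert_commute)
    have par: "parent ?A x = Some v \<longleftrightarrow> (v, x) \<in> ?A" for x v
      using arc_set_partial_matching[of n k E \<omega>] by (simp add: partial_matching_def parent_eq_Some_iff)
    have n: "u < n" "w < n" "u \<noteq> w" using simple_graph_edge[OF sg] e uw by auto
    have "?side u \<noteq> ?side w"
    proof
      assume side: "?side u = ?side w"
      show False
      proof -
        have "inj_on (\<lambda>i. (step_back (parent ?A) ^^ i) (w, 0)) {..Suc h}"
        proof (rule conflict_imp_extreme[where f = f, THEN conjunct1])
          show "parent ?A w = Some u" using A par by simp
          show "\<And>x y u. parent ?A x = Some u \<Longrightarrow> parent ?A y = Some u \<Longrightarrow> x = y"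
            by (rule parent_inj[OF arc_set_partial_matching])
          show "\<And>x u. x < n \<Longrightarrow> parent ?A x = Some u \<Longrightarrow> u < n"
            using par simple_graph_edge(1)[OF sg arc_set_adjacent] by metis
          show "\<And>x u. parent ?A x = Some u \<Longrightarrow> f u = (\<not> f x)"
            using par f[OF arc_set_adjacent] by metis
        qed (fact n side)+
        \<comment> \<open>Positions 0 and 2 of the walk are both \<open>w\<close>;
          \<open>0 < h\<close> puts 2 inside the range of injectivity.\<close>
        then have "(step_back (parent ?A) ^^ 0) (w, 0) \<noteq> (step_back (parent ?A) ^^ 2) (w, 0)"
          using h by (auto dest!: inj_onD[where x = 0 and y = 2])
        then show False using par[of w u] par[of u w] A by (simp add: numeral_2_eq_2)
      qed
    qed
    then have "(u, w) \<in> selected n h (ranks \<rho>) b ?A \<or> (w, u) \<in> selected n h (ranks \<rho>) b ?A"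
      using A by (auto simp: selected_def)
    then show "e \<in> matched_edges n k h E \<omega> \<rho> b"
      unfolding matched_edges_def uw by (force simp: insert_commute)
  qed (use matching_matched_edges[of E n k h \<omega> \<rho> b] in \<open>auto simp: matching_def\<close>)
  then show ?thesis by (simp add: random_matching_def case_prod_unfold map_pmf_const)
qed

section \<open>A cost calculus for programs with bounded memory\<close>

definition mem_le :: "int \<Rightarrow> memory \<Rightarrow> bool" where
  "mem_le B s \<longleftrightarrow> (\<forall>a i. \<bar>s a i\<bar> \<le> B)"

fun expr_size :: "expr \<Rightarrow> nat" where
  "expr_size (Lit x) = 1"
| "expr_size (Read a e) = expr_size e + 1"
| "expr_size (Plus e f) = expr_size e + expr_size f + 1"
| "expr_size (Minus e f) = expr_size e + expr_size f + 1"
| "expr_size (Times e f) = expr_size e + expr_size f + 1"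
| "expr_size (Div e f) = expr_size e + expr_size f + 1"

fun lits_le :: "int \<Rightarrow> expr \<Rightarrow> bool" where
  "lits_le B (Lit x) \<longleftrightarrow> \<bar>x\<bar> \<le> B"
| "lits_le B (Read a e) \<longleftrightarrow> lits_le B e"
| "lits_le B (Plus e f) \<longleftrightarrow> lits_le B e \<and> lits_le B f"
| "lits_le B (Minus e f) \<longleftrightarrow> lits_le B e \<and> lits_le B f"
| "lits_le B (Times e f) \<longleftrightarrow> lits_le B e \<and> lits_le B f"
| "lits_le B (Div e f) \<longleftrightarrow> lits_le B e \<and> lits_le B f"

text \<open>The size 40 leaves room for every expression of the program and for the guards of its
  loops. Values are then at most \<open>B ^ 40\<close>, so their bit lengths are a constant multiple
  of \<open>bits B\<close>.\<close>

definition small :: "int \<Rightarrow> expr \<Rightarrow> bool" where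
  "small B e \<longleftrightarrow> lits_le B e \<and> expr_size e \<le> 40"

section \<open>Values and costs of small expressions\<close>

lemma abs_div_le: "\<bar>x div y\<bar> \<le> \<bar>x :: int\<bar>"
proof -
  have pos: "\<bar>x div y\<bar> \<le> \<bar>x\<bar>" if "0 < y" for x y :: int
  proof (cases "0 \<le> x")
    case True
    then have "0 \<le> x div y" "x div y \<le> x"
      using that zdiv_mono2[of x 1 y] by (auto simp: pos_imp_zdiv_nonneg_iff)
    then show ?thesis using True by simp
  next
    case False
    have "x \<le> x div y"
    proof -
      have "x * y \<le> x" using False that by (simp add: mult_le_cancel_left1)
      then have "x * y div y \<le> x div y" using that by (intro zdiv_mono1) auto
      then show ?thesis using that by simp
    qed
    moreover have "x div y < 0" using False that by (intro div_neg_pos_less0) auto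
    ultimately show ?thesis by simp
  qed
  consider "0 < y" | "y = 0" | "y < 0" by linarith
  then show ?thesis
  proof cases
    case 3
    then have "\<bar>(- x) div (- y)\<bar> \<le> \<bar>- x\<bar>" by (intro pos) simp
    then show ?thesis by simp
  qed (auto intro: pos)
qed

lemma add_le_twice_mult:
  assumes "1 \<le> a" "1 \<le> (b :: int)"
  shows "a + b \<le> 2 * (a * b)"
proof -
  have "a * 1 \<le> a * b" "1 * b \<le> a * b"
    using assms by (auto intro: mult_left_mono mult_right_mono simp del: mult_1 mult_1_right)
  then show ?thesis by linarith
qed

text \<open>Every node of the syntax tree contributes one factor \<open>B\<close>: a sum of two
  bounds that are at least 1 is at most twice their product, and \<open>2 \<le> B\<close>.\<close>

lemma abs_val_le:
  assumes B: "2 \<le> B" and s: "mem_le B s"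
  shows "lits_le B e \<Longrightarrow> \<bar>val e s\<bar> \<le> B ^ expr_size e"
proof (induction e)
  case (Read a e)
  have "\<bar>s a (val e s)\<bar> \<le> B" using s by (simp add: mem_le_def)
  also have "B \<le> B ^ (expr_size e + 1)" using B by (intro self_le_power) auto
  finally show ?case by simp
next
  case (Plus e f)
  let ?a = "B ^ expr_size e" and ?b = "B ^ expr_size f"
  have 1: "1 \<le> ?a" "1 \<le> ?b" using B by (auto intro: one_le_power)
  have "\<bar>val e s + val f s\<bar> \<le> ?a + ?b" using Plus by (simp add: abs_triangle_ineq[THEN order_trans])
  also have "\<dots> \<le> 2 * (?a * ?b)"
    using 1 by (rule add_le_twice_mult)
  also have "\<dots> \<le> B * (?a * ?b)" using B 1 by (intro mult_right_mono) auto
  finally show ?case by (simp add: power_add)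
next
  case (Minus e f)
  let ?a = "B ^ expr_size e" and ?b = "B ^ expr_size f"
  have 1: "1 \<le> ?a" "1 \<le> ?b" using B by (auto intro: one_le_power)
  have "\<bar>val e s - val f s\<bar> \<le> ?a + ?b" using Minus by (simp add: abs_triangle_ineq4[THEN order_trans])
  also have "\<dots> \<le> 2 * (?a * ?b)"
    using 1 by (rule add_le_twice_mult)
  also have "\<dots> \<le> B * (?a * ?b)" using B 1 by (intro mult_right_mono) auto
  finally show ?case by (simp add: power_add)
next
  case (Times e f)
  let ?a = "B ^ expr_size e" and ?b = "B ^ expr_size f"
  have 1: "1 \<le> ?a" "1 \<le> ?b" using B by (auto intro: one_le_power)
  have "\<bar>val e s * val f s\<bar> \<le> 1 * (?a * ?b)" using Times 1 by (auto simp: abs_mult intro!: mult_mono)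
  also have "\<dots> \<le> B * (?a * ?b)" using B 1 by (intro mult_right_mono) auto
  finally show ?case by (simp add: power_add)
next
  case (Div e f)
  have "\<bar>val e s div val f s\<bar> \<le> B ^ expr_size e" using Div abs_div_le[of "val e s" "val f s"] by simp
  also have "\<dots> \<le> B ^ (expr_size e + expr_size f + 1)" using B by (intro power_increasing) auto
  finally show ?case by simp
qed simp

lemma bits_le:
  assumes B: "2 \<le> B" and x: "\<bar>x\<bar> \<le> B ^ j" and j: "0 < j"
  shows "bits x \<le> j * bits B"
proof -
  let ?l = "floorlog 2 (nat B)"
  have "nat B < 2 ^ ?l" using floorlog_bounds[of "nat B" 2] B by simp
  then have "B < 2 ^ ?l" by (simp add: nat_less_iff)
  have "\<bar>x\<bar> < 2 ^ (j * ?l)"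
  proof -
    have "B ^ j < (2 ^ ?l) ^ j" using \<open>B < 2 ^ ?l\<close> B j by (intro power_strict_mono) auto
    then show ?thesis using x by (simp add: power_mult[symmetric] mult.commute)
  qed
  then have "nat \<bar>x\<bar> < 2 ^ (j * ?l)" by (simp add: nat_less_iff)
  then have "floorlog 2 (nat \<bar>x\<bar>) \<le> j * ?l" by (intro floorlog_leI) auto
  then have "bits x \<le> j + j * ?l" using j by (simp add: bits_def)
  also have "\<dots> = j * bits B" using B by (simp add: bits_def algebra_simps)
  finally show ?thesis .
qed

lemma expr_size_pos: "0 < expr_size e"
  by (cases e) auto

lemma bits_val_le:
  assumes "2 \<le> B" "mem_le B s" "lits_le B e"
  shows "bits (val e s) \<le> expr_size e * bits B"
  using assms by (intro bits_le abs_val_le expr_size_pos)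

lemma binary_cost_le:
  assumes "c \<le> 2 * x ^ 2 * L" "d \<le> 2 * y ^ 2 * L" "b \<le> x * L" "b' \<le> y * L"
  shows "c + d + b + b' \<le> 2 * (x + y + 1) ^ 2 * (L :: nat)"
proof -
  have "c + d + b + b' \<le> 2 * x ^ 2 * L + 2 * y ^ 2 * L + x * L + y * L" using assms by linarith
  also have "\<dots> = (2 * x ^ 2 + 2 * y ^ 2 + x + y) * L" by (simp add: algebra_simps)
  also have "\<dots> \<le> 2 * (x + y + 1) ^ 2 * L"
    by (intro mult_le_mono1) (simp add: power2_eq_square algebra_simps)
  finally show ?thesis .
qed

text \<open>Quadratic in the size, because each node is charged for bit lengths that are themselves
  linear in the sizes of its subterms.\<close>

lemma exp_cost_le:
  assumes B: "2 \<le> B" and s: "mem_le B s"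
  shows "lits_le B e \<Longrightarrow> exp_cost e s \<le> 2 * (expr_size e) ^ 2 * bits B"
proof (induction e)
  case (Lit x)
  then show ?case using bits_val_le[OF B s, of "Lit x"] by simp
next
  case (Read a e)
  let ?x = "expr_size e"
  have "bits (s a (val e s)) \<le> 1 * bits B" using s by (intro bits_le B) (auto simp: mem_le_def)
  then have "exp_cost (Read a e) s \<le> 2 * ?x ^ 2 * bits B + ?x * bits B + 1 * bits B"
    using Read bits_val_le[OF B s, of e] by simp
  also have "\<dots> = (2 * ?x ^ 2 + ?x + 1) * bits B" by (simp add: algebra_simps)
  also have "\<dots> \<le> (2 * (?x + 1) ^ 2) * bits B"
    by (intro mult_le_mono1) (simp add: power2_eq_square algebra_simps)
  finally show ?case by simp
qed (auto intro!: binary_cost_le bits_val_le[OF B s] simp del: One_nat_def)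

text \<open>Covers one elementary command or one guard: two small expressions cost at most 2 * 3200
  multiples of \<open>bits B\<close>, and the bit lengths of their values add 2 * 40.\<close>

definition unit_cost :: "int \<Rightarrow> nat" where
  "unit_cost B = 10000 * bits B"

lemma exp_cost_small:
  assumes "2 \<le> B" "mem_le B s" "small B e"
  shows "exp_cost e s \<le> 3200 * bits B" "bits (val e s) \<le> 40 * bits B"
proof -
  have e: "lits_le B e" "expr_size e \<le> 40" using assms(3) by (auto simp: small_def)
  have "exp_cost e s \<le> 2 * (expr_size e) ^ 2 * bits B" using assms e by (intro exp_cost_le)
  also have "\<dots> \<le> 2 * 40 ^ 2 * bits B" using e by (intro mult_le_mono power_mono) auto
  finally show "exp_cost e s \<le> 3200 * bits B" by simp
  have "bits (val e s) \<le> expr_size e * bits B" using assms e by (intro bits_val_le)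
  also have "\<dots> \<le> 40 * bits B" using e by (intro mult_le_mono1)
  finally show "bits (val e s) \<le> 40 * bits B" .
qed

lemma mem_le_set_cell: "mem_le B s \<Longrightarrow> \<bar>x\<bar> \<le> B \<Longrightarrow> mem_le B (set_cell a i x s)"
  by (simp add: mem_le_def set_cell_def)

lemma set_cell_array: "set_cell a i x s a' = (if a' = a then (s a)(i := x) else s a')"
  by (simp add: set_cell_def)

text \<open>\<open>yields B c T \<mu> s\<close>: started in \<open>s\<close>, the command \<open>c\<close> terminates within \<open>T\<close> units of time in a
  memory distributed according to \<open>\<mu>\<close>, all of whose entries are bounded by \<open>B\<close>.\<close>

definition yields :: "int \<Rightarrow> com \<Rightarrow> nat \<Rightarrow> memory pmf \<Rightarrow> memory \<Rightarrow> bool" where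
  "yields B c T \<mu> s \<longleftrightarrow> map_pmf (\<lambda>r. snd (the r)) (exec c s) = \<mu> \<and>
     (\<forall>r\<in>set_pmf (exec c s). \<exists>t s'. r = Some (t, s') \<and> t \<le> T * unit_cost B \<and> mem_le B s')"

lemma yieldsI:
  assumes "exec c s = map_pmf (\<lambda>x. Some (t x, f x)) p" "map_pmf f p = \<mu>"
    and "\<And>x. x \<in> set_pmf p \<Longrightarrow> t x \<le> T * unit_cost B \<and> mem_le B (f x)"
  shows "yields B c T \<mu> s"
  unfolding yields_def using assms by (auto simp: pmf.map_comp o_def)

lemma yields_mem_le: "yields B c T \<mu> s \<Longrightarrow> s' \<in> set_pmf \<mu> \<Longrightarrow> mem_le B s'"
  unfolding yields_def by fastforce

lemma yields_mono: "yields B c T \<mu> s \<Longrightarrow> T \<le> T' \<Longrightarrow> yields B c T' \<mu> s"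
  unfolding yields_def by (meson le_trans mult_le_mono1)

text \<open>The common core of sequencing and of a loop iteration; \<open>d\<close> is the cost of
  the guard, and 0 for a sequence.\<close>

lemma yields_bind:
  fixes d T1 T2 :: nat
  assumes p: "map_pmf (\<lambda>r. snd (the r)) p = \<mu>"
      "\<And>r. r \<in> set_pmf p \<Longrightarrow> \<exists>t s'. r = Some (t, s') \<and> t \<le> T1 \<and> mem_le B s'"
    and q: "\<And>s'. s' \<in> set_pmf \<mu> \<Longrightarrow> map_pmf (\<lambda>r. snd (the r)) (q s') = \<nu> s'"
      "\<And>s' r. s' \<in> set_pmf \<mu> \<Longrightarrow> r \<in> set_pmf (q s') \<Longrightarrow> \<exists>t s''. r = Some (t, s'') \<and> t \<le> T2 \<and> mem_le B s''"
  defines "z \<equiv> bind_spmf p (\<lambda>(t1, s1). bind_spmf (q s1) (\<lambda>(t2, s2). return_spmf (d + t1 + t2, s2)))"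
  shows "map_pmf (\<lambda>r. snd (the r)) z = bind_pmf \<mu> \<nu>"
    "r \<in> set_pmf z \<Longrightarrow> \<exists>t s'. r = Some (t, s') \<and> t \<le> d + T1 + T2 \<and> mem_le B s'"
proof -
  have some: "\<exists>t s'. r = Some (t, s') \<and> s' \<in> set_pmf \<mu> \<and> t \<le> T1" if "r \<in> set_pmf p" for r
  proof -
    from p(2)[OF that] obtain t s' where r: "r = Some (t, s')" "t \<le> T1" by blast
    then have "s' \<in> set_pmf \<mu>" using that unfolding p(1)[symmetric] by force
    then show ?thesis using r by blast
  qed
  have z: "z = bind_pmf p (\<lambda>r. map_pmf (\<lambda>r'. Some (d + fst (the r) + fst (the r'), snd (the r'))) (q (snd (the r))))"
    unfolding z_def bind_spmf_def
  proof (rule bind_pmf_cong[OF refl])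
    fix r assume "r \<in> set_pmf p"
    from some[OF this] obtain t s' where r: "r = Some (t, s')" "s' \<in> set_pmf \<mu>" by blast
    show "(case r of None \<Rightarrow> return_pmf None | Some (t1, s1) \<Rightarrow> bind_pmf (q s1)
        (\<lambda>a. case a of None \<Rightarrow> return_pmf None | Some (t2, s2) \<Rightarrow> return_spmf (d + t1 + t2, s2)))
      = map_pmf (\<lambda>r'. Some (d + fst (the r) + fst (the r'), snd (the r'))) (q (snd (the r)))"
      unfolding map_pmf_def r(1) option.case prod.case option.sel snd_conv
    proof (rule bind_pmf_cong[OF refl])
      fix r' assume "r' \<in> set_pmf (q s')"
      from q(2)[OF r(2) this] show "(case r' of None \<Rightarrow> return_pmf None | Some (t2, s2) \<Rightarrow> return_spmf (d + t + t2, s2))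
        = return_pmf (Some (d + fst (t, s') + fst (the r'), snd (the r')))" by auto
    qed
  qed
  have "map_pmf (\<lambda>r. snd (the r)) z = bind_pmf p (\<lambda>r. \<nu> (snd (the r)))"
    unfolding z map_bind_pmf pmf.map_comp o_def
  proof (rule bind_pmf_cong[OF refl])
    fix r assume "r \<in> set_pmf p"
    from some[OF this] q(1)
    show "map_pmf (\<lambda>x. snd (the (Some (d + fst (the r) + fst (the x), snd (the x))))) (q (snd (the r))) = \<nu> (snd (the r))"
      by auto
  qed
  also have "\<dots> = bind_pmf \<mu> \<nu>" by (simp add: p(1)[symmetric] bind_map_pmf)
  finally show "map_pmf (\<lambda>r. snd (the r)) z = bind_pmf \<mu> \<nu>" .
  assume "r \<in> set_pmf z"
  then obtain r1 r2 where r: "r1 \<in> set_pmf p" "r2 \<in> set_pmf (q (snd (the r1)))"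
    "r = Some (d + fst (the r1) + fst (the r2), snd (the r2))"
    unfolding z by auto
  from some[OF r(1)] obtain t s' where 1: "r1 = Some (t, s')" "s' \<in> set_pmf \<mu>" "t \<le> T1" by blast
  from q(2)[OF 1(2), of r2] r 1 show "\<exists>t s'. r = Some (t, s') \<and> t \<le> d + T1 + T2 \<and> mem_le B s'" by auto
qed

lemma yields_Seq:
  assumes c1: "yields B c1 T1 \<mu> s" and c2: "\<And>s'. s' \<in> set_pmf \<mu> \<Longrightarrow> yields B c2 T2 (\<nu> s') s'"
  shows "yields B (Seq c1 c2) (T1 + T2) (bind_pmf \<mu> \<nu>) s"
proof -
  note c1 = c1[unfolded yields_def] and c2 = c2[unfolded yields_def]
  note * = yields_bind[where d = 0 and p = "exec c1 s" and q = "exec c2" and \<mu> = \<mu> and \<nu> = \<nu>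
      and ?T1.0 = "T1 * unit_cost B" and ?T2.0 = "T2 * unit_cost B" and B = B]
  have "map_pmf (\<lambda>r. snd (the r)) (exec (Seq c1 c2) s) = bind_pmf \<mu> \<nu>"
    using *(1) c1 c2 by simp
  moreover have "\<exists>t s'. r = Some (t, s') \<and> t \<le> (T1 + T2) * unit_cost B \<and> mem_le B s'"
    if "r \<in> set_pmf (exec (Seq c1 c2) s)" for r
    using *(2)[of r] c1 c2 that by (simp add: add_mult_distrib)
  ultimately show ?thesis by (simp add: yields_def)
qed

lemma exec_WhilePos:
  "exec (WhilePos b c) s =
     (if 0 < val b s then
        bind_spmf (exec c s) (\<lambda>(t1, s1).
        bind_spmf (exec (WhilePos b c) s1) (\<lambda>(t2, s2).
        return_spmf (exp_cost b s + t1 + t2, s2)))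
      else return_spmf (exp_cost b s, s))"
  unfolding exec.simps by (rule loop.simps)

lemma yields_While_step:
  assumes B: "2 \<le> B" and s: "mem_le B s" and b: "small B b" "0 < val b s"
    and c: "yields B c T1 \<mu> s" and w: "\<And>s'. s' \<in> set_pmf \<mu> \<Longrightarrow> yields B (WhilePos b c) T2 (\<nu> s') s'"
  shows "yields B (WhilePos b c) (1 + T1 + T2) (bind_pmf \<mu> \<nu>) s"
proof -
  note c = c[unfolded yields_def] and w = w[unfolded yields_def]
  note * = yields_bind[where d = "exp_cost b s" and p = "exec c s" and q = "exec (WhilePos b c)" and \<mu> = \<mu> and \<nu> = \<nu>
      and ?T1.0 = "T1 * unit_cost B" and ?T2.0 = "T2 * unit_cost B" and B = B]
  note ex = exec_WhilePos[of b c s, unfolded if_P[OF b(2)]]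
  have "map_pmf (\<lambda>r. snd (the r)) (exec (WhilePos b c) s) = bind_pmf \<mu> \<nu>"
    unfolding ex by (rule *(1)) (use c w in auto)
  moreover have "\<exists>t s'. r = Some (t, s') \<and> t \<le> (1 + T1 + T2) * unit_cost B \<and> mem_le B s'"
    if r: "r \<in> set_pmf (exec (WhilePos b c) s)" for r
  proof -
    have "\<exists>t s'. r = Some (t, s') \<and> t \<le> exp_cost b s + T1 * unit_cost B + T2 * unit_cost B \<and> mem_le B s'"
      by (rule *(2)) (use c w r[unfolded ex] in auto)
    then obtain t s' where "r = Some (t, s')" "t \<le> exp_cost b s + T1 * unit_cost B + T2 * unit_cost B" "mem_le B s'"
      by blast
    moreover have "exp_cost b s \<le> unit_cost B"
      using exp_cost_small(1)[OF B s b(1)] by (simp add: unit_cost_def)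
    moreover have "(1 + T1 + T2) * unit_cost B = unit_cost B + T1 * unit_cost B + T2 * unit_cost B"
      by (simp add: algebra_simps)
    ultimately show ?thesis by auto
  qed
  ultimately show ?thesis by (simp add: yields_def)
qed

lemma yields_While_stop:
  assumes B: "2 \<le> B" and s: "mem_le B s" and b: "small B b" "\<not> 0 < val b s"
  shows "yields B (WhilePos b c) 1 (return_pmf s) s"
proof -
  have "exp_cost b s \<le> unit_cost B"
    using exp_cost_small(1)[OF B s b(1)] by (simp add: unit_cost_def)
  then show ?thesis using s
    unfolding yields_def exec_WhilePos[of b c s, unfolded if_not_P[OF b(2)]] by auto
qed

lemma yields_Write:
  assumes B: "2 \<le> B" and s: "mem_le B s" and e: "small B i" "small B e" "\<bar>val e s\<bar> \<le> B"
  shows "yields B (Write a i e) 1 (return_pmf (set_cell a (val i s) (val e s) s)) s"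
proof -
  have "exp_cost i s + exp_cost e s + bits (val i s) + bits (val e s) \<le> unit_cost B"
    using exp_cost_small[OF B s e(1)] exp_cost_small[OF B s e(2)] by (simp add: unit_cost_def)
  then show ?thesis using mem_le_set_cell[OF s e(3)] by (auto simp: yields_def)
qed

lemma yields_Draw:
  assumes B: "2 \<le> B" and s: "mem_le B s" and e: "small B i" "small B e" "0 < val e s" "val e s \<le> B"
  shows "yields B (Draw a i e) 1 (map_pmf (\<lambda>x. set_cell a (val i s) x s) (uniform (val e s))) s"
proof (rule yieldsI)
  let ?t = "exp_cost i s + exp_cost e s + bits (val i s) + bits (val e s)"
  show "exec (Draw a i e) s = map_pmf (\<lambda>x. Some (?t, set_cell a (val i s) x s)) (uniform (val e s))"
    using e by (simp add: spmf_of_set_def bind_spmf_of_pmf map_pmf_def del: spmf_of_pmf_pmf_of_set)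
  fix x assume "x \<in> set_pmf (uniform (val e s))"
  then have "\<bar>x\<bar> \<le> B" using e by (simp add: set_uniform)
  then show "?t \<le> 1 * unit_cost B \<and> mem_le B (set_cell a (val i s) x s)"
    using exp_cost_small[OF B s e(1)] exp_cost_small[OF B s e(2)] mem_le_set_cell[OF s]
    by (simp add: unit_cost_def)
qed simp

text \<open>Once all random numbers are drawn, the program is deterministic; the rest is handled
  with point distributions, as a total-correctness calculus with a time bound.\<close>

definition wp :: "int \<Rightarrow> com \<Rightarrow> nat \<Rightarrow> (memory \<Rightarrow> bool) \<Rightarrow> memory \<Rightarrow> bool" where
  "wp B c T Q s \<longleftrightarrow> (\<exists>s'. yields B c T (return_pmf s') s \<and> Q s')"

lemma wp_mono: "wp B c T Q s \<Longrightarrow> T \<le> T' \<Longrightarrow> (\<And>s'. mem_le B s' \<Longrightarrow> Q s' \<Longrightarrow> Q' s') \<Longrightarrow> wp B c T' Q' s"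
  unfolding wp_def using yields_mono yields_mem_le[of B c T "return_pmf _" s] by fastforce

lemma wp_Seq: "wp B c1 T1 (wp B c2 T2 Q) s \<Longrightarrow> wp B (Seq c1 c2) (T1 + T2) Q s"
proof -
  assume "wp B c1 T1 (wp B c2 T2 Q) s"
  then obtain s1 s2 where "yields B c1 T1 (return_pmf s1) s" "yields B c2 T2 (return_pmf s2) s1" "Q s2"
    by (auto simp: wp_def)
  moreover from this have "yields B (Seq c1 c2) (T1 + T2) (bind_pmf (return_pmf s1) (\<lambda>_. return_pmf s2)) s"
    by (intro yields_Seq) auto
  ultimately show ?thesis by (auto simp: wp_def bind_return_pmf)
qed

lemma wp_Skip: "mem_le B s \<Longrightarrow> Q s \<Longrightarrow> wp B Skip 1 Q s"
  unfolding wp_def by (rule exI[of _ s]) (auto simp: yields_def unit_cost_def bits_def)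

lemma wp_Write:
  assumes "2 \<le> B" "mem_le B s" "small B i" "small B e" "\<bar>val e s\<bar> \<le> B"
    "mem_le B (set_cell a (val i s) (val e s) s) \<Longrightarrow> Q (set_cell a (val i s) (val e s) s)"
  shows "wp B (Write a i e) 1 Q s"
  unfolding wp_def using yields_Write[OF assms(1-5)] assms mem_le_set_cell by blast

lemma wp_If:
  assumes B: "2 \<le> B" and s: "mem_le B s" and b: "small B b"
    and c: "0 < val b s \<Longrightarrow> wp B c1 T Q s" "\<not> 0 < val b s \<Longrightarrow> wp B c2 T Q s"
  shows "wp B (IfPos b c1 c2) (T + 1) Q s"
proof -
  have le: "exp_cost b s \<le> unit_cost B"
    using exp_cost_small(1)[OF B s b(1)] by (simp add: unit_cost_def)
  define c where "c = (if 0 < val b s then c1 else c2)"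
  have "wp B c T Q s" using c by (simp add: c_def)
  then obtain s' where s': "yields B c T (return_pmf s') s" "Q s'" by (auto simp: wp_def)
  have ex: "exec (IfPos b c1 c2) s = bind_spmf (exec c s) (\<lambda>(t, s'). return_spmf (exp_cost b s + t, s'))"
    by (simp add: c_def)
  have ex': "exec (IfPos b c1 c2) s = map_pmf (\<lambda>r. Some (exp_cost b s + fst (the r), snd (the r))) (exec c s)"
    unfolding ex bind_spmf_def map_pmf_def
    by (rule bind_pmf_cong[OF refl]) (use s'(1) in \<open>fastforce simp: yields_def\<close>)
  have "yields B (IfPos b c1 c2) (T + 1) (return_pmf s') s"
  proof (rule yieldsI[OF ex'])
    show "map_pmf (\<lambda>r. snd (the r)) (exec c s) = return_pmf s'" using s'(1) by (simp add: yields_def)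
    fix r assume "r \<in> set_pmf (exec c s)"
    then obtain t s'' where "r = Some (t, s'')" "t \<le> T * unit_cost B" "mem_le B s''"
      using s'(1) by (auto simp: yields_def)
    then show "exp_cost b s + fst (the r) \<le> (T + 1) * unit_cost B \<and> mem_le B (snd (the r))"
      using le by simp
  qed
  then show ?thesis using s'(2) by (auto simp: wp_def)
qed

definition For :: "int \<Rightarrow> expr \<Rightarrow> com \<Rightarrow> com" where
  "For v b c = Seq (Write 0 (Lit v) (Lit 0))
     (WhilePos (Minus b (Read 0 (Lit v))) (Seq c (Write 0 (Lit v) (Plus (Read 0 (Lit v)) (Lit 1)))))"

text \<open>An iteration costs \<open>T + 2\<close> for guard, body and increment; the final 2 pays
  for the initialisation and the last test. The guard has three nodes more than \<open>b\<close>,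
  hence 37 instead of 40.\<close>

lemma wp_For:
  assumes B: "2 \<le> B" "\<bar>v\<bar> \<le> B" "lits_le B b" "expr_size b \<le> 37" "int N \<le> B" and s: "mem_le B s"
    and init: "I 0 (set_cell 0 v 0 s)"
    and b: "\<And>j s. j \<le> N \<Longrightarrow> I j s \<Longrightarrow> val b s = int N"
    and v: "\<And>j s. j \<le> N \<Longrightarrow> I j s \<Longrightarrow> s 0 v = int j"
    and body: "\<And>j s. j < N \<Longrightarrow> mem_le B s \<Longrightarrow> I j s \<Longrightarrow>
        wp B c T (\<lambda>s'. s' 0 v = int j \<and> I (Suc j) (set_cell 0 v (int (Suc j)) s')) s"
    and Q: "\<And>s. mem_le B s \<Longrightarrow> I N s \<Longrightarrow> Q s"
    and T': "N * (T + 2) + 2 \<le> T'"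
  shows "wp B (For v b c) T' Q s"
proof -
  let ?b = "Minus b (Read 0 (Lit v))"
  let ?c = "Seq c (Write 0 (Lit v) (Plus (Read 0 (Lit v)) (Lit 1)))"
  have sm: "small B ?b" using B by (simp add: small_def)
  have loop: "wp B (WhilePos ?b ?c) ((N - j) * (T + 2) + 1) Q s" if "j \<le> N" "mem_le B s" "I j s" for j s
    using that
  proof (induction "N - j" arbitrary: j s)
    case 0
    then have "\<not> 0 < val ?b s" using b[of j s] v[of j s] by simp
    then have "yields B (WhilePos ?b ?c) 1 (return_pmf s) s"
      using B(1) 0(3) sm by (intro yields_While_stop)
    then show ?case using 0 Q[of s] by (auto simp: wp_def)
  next
    case (Suc m)
    then have j: "j < N" by simp
    then have pos: "0 < val ?b s" using b[of j s] v[of j s] Suc by simp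
    have "wp B ?c (T + 1) (\<lambda>s'. I (Suc j) s' \<and> mem_le B s') s"
    proof (rule wp_Seq, rule wp_mono[OF body[OF j Suc(4,5)] order_refl])
      fix s' assume s': "mem_le B s'" "s' 0 v = int j \<and> I (Suc j) (set_cell 0 v (int (Suc j)) s')"
      show "wp B (Write 0 (Lit v) (Plus (Read 0 (Lit v)) (Lit 1))) 1 (\<lambda>s'. I (Suc j) s' \<and> mem_le B s') s'"
        by (rule wp_Write) (use B s' j in \<open>auto simp: small_def add.commute\<close>)
    qed
    then obtain s1 where s1: "yields B ?c (T + 1) (return_pmf s1) s" "I (Suc j) s1" "mem_le B s1"
      by (auto simp: wp_def)
    have "wp B (WhilePos ?b ?c) ((N - Suc j) * (T + 2) + 1) Q s1"
      using Suc j s1 by (intro Suc(1)) auto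
    then obtain s2 where s2: "yields B (WhilePos ?b ?c) ((N - Suc j) * (T + 2) + 1) (return_pmf s2) s1" "Q s2"
      by (auto simp: wp_def)
    have "yields B (WhilePos ?b ?c) (1 + (T + 1) + ((N - Suc j) * (T + 2) + 1))
        (bind_pmf (return_pmf s1) (\<lambda>_. return_pmf s2)) s"
      using B(1) Suc(4) sm pos s1(1) s2(1) by (intro yields_While_step) auto
    moreover have "1 + (T + 1) + ((N - Suc j) * (T + 2) + 1) = (N - j) * (T + 2) + 1"
      using j by (simp add: Suc_diff_Suc[symmetric] del: diff_Suc_Suc)
    ultimately show ?case using s2(2) by (auto simp: wp_def bind_return_pmf)
  qed
  have "wp B (For v b c) (1 + ((N - 0) * (T + 2) + 1)) Q s"
    unfolding For_def
  proof (rule wp_Seq, rule wp_Write)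
    assume "mem_le B (set_cell 0 (val (Lit v) s) (val (Lit 0) s) s)"
    then show "wp B (WhilePos ?b ?c) ((N - 0) * (T + 2) + 1) Q (set_cell 0 (val (Lit v) s) (val (Lit 0) s) s)"
      using init by (intro loop) auto
  qed (use B s in \<open>auto simp: small_def\<close>)
  then show ?thesis by (rule wp_mono) (use T' in auto)
qed

text \<open>Filling an array with independent draws yields a product distribution; each iteration
  splits off one factor by \<open>Pi_pmf_insert'\<close>. The predicate \<open>J\<close> records
  what the bound and the range depend on and survives writes to the counter and to array
  \<open>a\<close>.\<close>

lemma yields_For_Draw:
  assumes B: "2 \<le> B" "\<bar>v\<bar> \<le> B" "lits_le B b" "expr_size b \<le> 37" "small B e" "int N \<le> B"
    and s: "mem_le B s" and a: "a \<noteq> 0" and J: "J s"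
    and J_v: "\<And>s x. J s \<Longrightarrow> J (set_cell 0 v x s)" and J_a: "\<And>s i x. J s \<Longrightarrow> J (set_cell a i x s)"
    and b: "\<And>s. J s \<Longrightarrow> val b s = int N" and e: "\<And>s. J s \<Longrightarrow> val e s = R" and R: "0 < R" "R \<le> B"
  shows "yields B (For v b (Draw a (Read 0 (Lit v)) e)) (N * 3 + 2)
    (map_pmf (\<lambda>f. (set_cell 0 v (int N) s)(a := \<lambda>i. if i \<in> {0..<int N} then f i else s a i))
      (Pi_pmf {0..<int N} 0 (\<lambda>_. uniform R))) s"
proof -
  let ?b = "Minus b (Read 0 (Lit v))"
  let ?c = "Seq (Draw a (Read 0 (Lit v)) e) (Write 0 (Lit v) (Plus (Read 0 (Lit v)) (Lit 1)))"
  \<comment> \<open>The final memory if the cells from \<open>j\<close> on receive the values of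
    \<open>f\<close>; the cells below \<open>j\<close> have already been drawn.\<close>
  define fill where "fill j f s = (set_cell 0 v (int N) s)(a := \<lambda>i. if i \<in> {int j..<int N} then f i else s a i)"
    for j :: nat and f :: "int \<Rightarrow> int" and s
  have sm: "small B ?b" using B by (simp add: small_def)
  have loop: "yields B (WhilePos ?b ?c) ((N - j) * 3 + 1)
      (map_pmf (\<lambda>f. fill j f s) (Pi_pmf {int j..<int N} 0 (\<lambda>_. uniform R))) s"
    if "j \<le> N" "mem_le B s" "J s" "s 0 v = int j" for j s
    using that
  proof (induction "N - j" arbitrary: j s)
    case 0
    then have "\<not> 0 < val ?b s" using b[of s] by simp
    then have "yields B (WhilePos ?b ?c) 1 (return_pmf s) s"
      using B(1) 0(3) sm by (intro yields_While_stop)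
    moreover have "fill j (\<lambda>_. 0) s = s"
      using 0 a by (auto simp: fill_def set_cell_def fun_eq_iff)
    ultimately show ?case using 0 by simp
  next
    case (Suc m)
    then have j: "j < N" by simp
    then have pos: "0 < val ?b s" using b[of s] Suc by simp
    let ?g = "\<lambda>x. set_cell 0 v (int (Suc j)) (set_cell a (int j) x s)"
    have c: "yields B ?c (1 + 1) (bind_pmf (map_pmf (\<lambda>x. set_cell a (int j) x s) (uniform R))
        (\<lambda>s'. return_pmf (set_cell 0 v (int (Suc j)) s'))) s"
    proof (rule yields_Seq)
      have "yields B (Draw a (Read 0 (Lit v)) e) 1
          (map_pmf (\<lambda>x. set_cell a (val (Read 0 (Lit v)) s) x s) (uniform (val e s))) s"
        using B Suc e[OF Suc(5)] R by (intro yields_Draw) (auto simp: small_def)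
      then show "yields B (Draw a (Read 0 (Lit v)) e) 1 (map_pmf (\<lambda>x. set_cell a (int j) x s) (uniform R)) s"
        using Suc e[OF Suc(5)] by simp
      fix s' assume "s' \<in> set_pmf (map_pmf (\<lambda>x. set_cell a (int j) x s) (uniform R))"
      then obtain x where x: "s' = set_cell a (int j) x s" "\<bar>x\<bar> \<le> B" using R by (auto simp: set_uniform)
      then have "mem_le B s'" "s' 0 v = int j" using Suc a by (auto simp: mem_le_set_cell set_cell_array)
      then show "yields B (Write 0 (Lit v) (Plus (Read 0 (Lit v)) (Lit 1))) 1 (return_pmf (set_cell 0 v (int (Suc j)) s')) s'"
        using yields_Write[of B s' "Lit v" "Plus (Read 0 (Lit v)) (Lit 1)" 0] B j
        by (simp add: small_def add.commute)
    qed
    have "bind_pmf (map_pmf (\<lambda>x. set_cell a (int j) x s) (uniform R))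
        (\<lambda>s'. return_pmf (set_cell 0 v (int (Suc j)) s')) = map_pmf ?g (uniform R)"
      by (simp add: map_pmf_def bind_assoc_pmf bind_return_pmf)
    with c have c: "yields B ?c 2 (map_pmf ?g (uniform R)) s" by (simp only: one_add_one)
    have "yields B (WhilePos ?b ?c) (1 + 2 + ((N - Suc j) * 3 + 1)) (bind_pmf (map_pmf ?g (uniform R))
        (\<lambda>s'. map_pmf (\<lambda>f. fill (Suc j) f s') (Pi_pmf {int (Suc j)..<int N} 0 (\<lambda>_. uniform R)))) s"
    proof (rule yields_While_step[OF B(1) Suc(4) sm pos c])
      fix s' assume s': "s' \<in> set_pmf (map_pmf ?g (uniform R))"
      then have "mem_le B s'" using yields_mem_le[OF c] by blast
      moreover from s' obtain x where "s' = ?g x" by auto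
      ultimately show "yields B (WhilePos ?b ?c) ((N - Suc j) * 3 + 1)
          (map_pmf (\<lambda>f. fill (Suc j) f s') (Pi_pmf {int (Suc j)..<int N} 0 (\<lambda>_. uniform R))) s'"
        using Suc j J_v J_a by (intro Suc(1)) (auto simp: set_cell_array)
    qed
    moreover have "bind_pmf (map_pmf ?g (uniform R))
        (\<lambda>s'. map_pmf (\<lambda>f. fill (Suc j) f s') (Pi_pmf {int (Suc j)..<int N} 0 (\<lambda>_. uniform R)))
      = map_pmf (\<lambda>f. fill j f s) (Pi_pmf {int j..<int N} 0 (\<lambda>_. uniform R))"
    proof -
      have ins: "{int j..<int N} = insert (int j) {int (Suc j)..<int N}" using j by auto
      have fill: "fill (Suc j) f (?g x) = fill j (f(int j := x)) s" for f x
        using a j by (auto simp: fill_def set_cell_def fun_eq_iff)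
      show ?thesis unfolding ins
        by (subst Pi_pmf_insert') (auto simp: map_pmf_def bind_assoc_pmf bind_return_pmf fill simp del: of_nat_Suc)
    qed
    moreover have "1 + 2 + ((N - Suc j) * 3 + 1) = (N - j) * 3 + 1" using j by simp
    ultimately show ?case by simp
  qed
  have "yields B (For v b (Draw a (Read 0 (Lit v)) e)) (1 + (N * 3 + 1))
    (bind_pmf (return_pmf (set_cell 0 v 0 s)) (\<lambda>s'. map_pmf (\<lambda>f. fill 0 f s') (Pi_pmf {int 0..<int N} 0 (\<lambda>_. uniform R)))) s"
    unfolding For_def
  proof (rule yields_Seq)
    show "yields B (Write 0 (Lit v) (Lit 0)) 1 (return_pmf (set_cell 0 v 0 s)) s"
      using yields_Write[of B s "Lit v" "Lit 0" 0] B s by (simp add: small_def)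
    fix s' assume "s' \<in> set_pmf (return_pmf (set_cell 0 v 0 s))"
    then have "s' = set_cell 0 v 0 s" by simp
    then show "yields B (WhilePos ?b ?c) (N * 3 + 1) (map_pmf (\<lambda>f. fill 0 f s') (Pi_pmf {int 0..<int N} 0 (\<lambda>_. uniform R))) s'"
      using loop[of 0 s'] s J J_v mem_le_set_cell[OF s, of 0] B by (simp add: set_cell_array)
  qed
  moreover have "fill 0 f (set_cell 0 v 0 s) = (set_cell 0 v (int N) s)(a := \<lambda>i. if i \<in> {0..<int N} then f i else s a i)" for f
    using a by (auto simp: fill_def set_cell_def fun_eq_iff)
  ultimately show ?thesis by (simp add: bind_return_pmf)
qed

section \<open>The program\<close>

lemma wp_weaken: "wp B c T Q s \<Longrightarrow> T \<le> T' \<Longrightarrow> wp B c T' Q s"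
  by (rule wp_mono)

lemma wp_If_max:
  assumes "2 \<le> B" "mem_le B s" "small B b"
    "0 < val b s \<Longrightarrow> wp B c1 T1 Q s" "\<not> 0 < val b s \<Longrightarrow> wp B c2 T2 Q s"
  shows "wp B (IfPos b c1 c2) (max T1 T2 + 1) Q s"
  using assms by (intro wp_If) (auto intro: wp_weaken)

lemmas wp_intros = wp_Seq wp_Write wp_If_max wp_Skip

abbreviation V :: "int \<Rightarrow> expr" where
  "V i \<equiv> Read 0 (Lit i)"

abbreviation Assign :: "int \<Rightarrow> expr \<Rightarrow> com" where
  "Assign i e \<equiv> Write 0 (Lit i) e"

abbreviation Mod :: "expr \<Rightarrow> expr \<Rightarrow> expr" where
  "Mod e f \<equiv> Minus e (Times (Div e f) f)"

text \<open>Memory layout. Array 0 has \<open>n\<close> in cell 0, loop counters in cells 1 and 2,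
  and scratch values in cells 4 to 8. Array 1 is the adjacency matrix, 2 the output, 3 the coins, 4
  the ranks, 5 the positions, 6 the best key of each receiver, 7 the degrees, 8 the guessed sides,
  and cell 0 of array 9 the bit that fixes the side.\<close>

definition degree_phase :: com where
  "degree_phase = For 1 (V 0) (For 2 (V 0)
     (IfPos (Read 1 (Plus (Times (V 1) (V 0)) (V 2)))
       (Write 7 (V 2) (Plus (Read 7 (V 2)) (Lit 1))) Skip))"

definition bid_phase :: "nat \<Rightarrow> com" where
  "bid_phase k = For 2 (V 0)
     (Seq (Assign 4 (Read 5 (V 2)))
     (Seq (Assign 5 (Mod (V 4) (V 0)))
     (Seq (Assign 6 (Plus (Plus (Times (V 4) (V 0)) (V 2)) (Lit 1)))
       (IfPos (Minus (Times (Lit (int k)) (V 0)) (V 4))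
         (IfPos (Read 1 (Plus (Times (V 2) (V 0)) (V 5)))
           (IfPos (Minus (V 6) (Read 6 (V 5))) (Write 6 (V 5) (V 6)) Skip)
           Skip)
         Skip))))"

text \<open>The innermost guard, coin + 1 - threshold > 0, says that the coin is not below the
  threshold, that is, that the rejected proposer carries on.\<close>

definition advance_phase :: "nat \<Rightarrow> com" where
  "advance_phase k = For 2 (V 0)
     (Seq (Assign 4 (Read 5 (V 2)))
     (Seq (Assign 5 (Mod (V 4) (V 0)))
     (Seq (Assign 6 (Plus (Plus (Times (V 4) (V 0)) (V 2)) (Lit 1)))
       (IfPos (Minus (Times (Lit (int k)) (V 0)) (V 4))
         (IfPos (Read 1 (Plus (Times (V 2) (V 0)) (V 5)))
           (IfPos (Minus (Read 6 (V 5)) (V 6))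
             (IfPos (Minus (Plus (Read 3 (Plus (Times (V 2) (Times (Lit (int k)) (V 0))) (V 4))) (Lit 1))
                 (Div (Times (Lit 2) (Plus (V 0) (Lit 1))) (Read 7 (V 5))))
               (Write 5 (V 2) (Plus (V 4) (Lit 1))) Skip)
             Skip)
           (Write 5 (V 2) (Plus (V 4) (Lit 1))))
         Skip))))"

text \<open>Keys are shifted by 1, so that the initial memory value 0 means that no proposal has
  arrived.\<close>

definition best_key :: "nat \<Rightarrow> (nat \<times> nat) set \<Rightarrow> nat \<Rightarrow> nat" where
  "best_key n P w = Max (insert 0 ((\<lambda>(u, p). p * n + u + 1) ` {x \<in> P. snd x mod n = w}))"

lemma best_key_empty [simp]: "best_key n {} w = 0"
  by (simp add: best_key_def)

lemma best_key_insert: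
  assumes "finite P"
  shows "best_key n (insert (u, p) P) w =
    (if p mod n = w then max (best_key n P w) (p * n + u + 1) else best_key n P w)"
proof (cases "p mod n = w")
  case True
  then have "{x \<in> insert (u, p) P. snd x mod n = w} = insert (u, p) {x \<in> P. snd x mod n = w}" by auto
  then show ?thesis using True assms by (simp add: best_key_def insert_commute[of 0] max.commute)
next
  case False
  then have "{x \<in> insert (u, p) P. snd x mod n = w} = {x \<in> P. snd x mod n = w}" by auto
  then show ?thesis using False by (simp add: best_key_def)
qed

lemma best_key_ge: "finite P \<Longrightarrow> (u, p) \<in> P \<Longrightarrow> p mod n = w \<Longrightarrow> p * n + u + 1 \<le> best_key n P w"
  unfolding best_key_def by (rule Max_ge) (auto intro!: image_eqI[of _ _ "(u, p)"])

lemma best_key_cases: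
  assumes "finite P" "0 < best_key n P w"
  obtains u p where "(u, p) \<in> P" "p mod n = w" "best_key n P w = p * n + u + 1"
proof -
  have "best_key n P w \<in> insert 0 ((\<lambda>(u, p). p * n + u + 1) ` {x \<in> P. snd x mod n = w})"
    unfolding best_key_def using assms(1) by (intro Max_in) auto
  with assms(2) that show ?thesis by auto
qed

context deferred_acceptance
begin

lemma outbid_iff_best_key:
  assumes "finite S"
  shows "outbid S pos u p \<longleftrightarrow> p * n + u + 1 < best_key n (proposals S pos) (p mod n)"
proof
  assume "outbid S pos u p"
  then obtain u' p' where "(u', p') \<in> proposals S pos" "p' mod n = p mod n" "p * n + u < p' * n + u'"
    by (auto simp: outbid_def)
  with best_key_ge[OF finite_proposals[OF assms], of u' p' pos n "p mod n"]
  show "p * n + u + 1 < best_key n (proposals S pos) (p mod n)" by simp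
next
  assume lt: "p * n + u + 1 < best_key n (proposals S pos) (p mod n)"
  then have "0 < best_key n (proposals S pos) (p mod n)" by simp
  then obtain u' p' where "(u', p') \<in> proposals S pos" "p' mod n = p mod n"
    "best_key n (proposals S pos) (p mod n) = p' * n + u' + 1"
    using best_key_cases[OF finite_proposals[OF assms]] by metis
  with lt show "outbid S pos u p" by (auto simp: outbid_def)
qed

lemma proposals_stage_0: "proposals S (stage S q 0) = {(u, p). u \<in> S \<and> p = 0 \<and> p < k * n \<and> adj u (p mod n)}"
  by (auto simp: proposals_def)

text \<open>Positions move by at most one per round, so it suffices to enter the current proposals
  round by round: nothing of the history is missed.\<close>

lemma proposals_stage_Suc:
  "proposals S (stage S q (Suc t)) = proposals S (stage S q t) \<union>
     {(u, p). u \<in> S \<and> p = stage S q (Suc t) u \<and> p < k * n \<and> adj u (p mod n)}"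
proof -
  have "stage S q (Suc t) u = stage S q t u \<or> stage S q (Suc t) u = Suc (stage S q t u)" for u
    by (auto simp: stage_Suc advance_def)
  moreover have "stage S q t u \<le> stage S q (Suc t) u" for u
    using stage_mono[of t "Suc t" S q] by (simp add: le_fun_def)
  ultimately show ?thesis
    unfolding proposals_def by (auto simp: le_Suc_eq) (metis le_Suc_eq)+
qed

text \<open>The best key belongs to the held proposal; after undoing the shift, its proposer is the
  remainder modulo \<open>n\<close>.\<close>

lemma parent_arcs_best_key:
  fixes q :: "nat \<Rightarrow> nat \<Rightarrow> bool"
  assumes S: "S \<subseteq> {..<n}" and w: "w < n"
  defines "b \<equiv> best_key n (proposals S (final S q)) w"
  shows "parent (arcs S q) w = (if 0 < b then Some ((b - 1) mod n) else None)"
proof (cases "0 < b")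
  case True
  have fin: "finite (proposals S (final S q))" using finite_subset[OF S] by (intro finite_proposals) simp
  obtain u p where up: "(u, p) \<in> proposals S (final S q)" "p mod n = w" "b = p * n + u + 1"
    using best_key_cases[OF fin True[unfolded b_def]] unfolding b_def by metis
  have "u < n" using up(1) S by (auto simp: proposals_def)
  have "\<not> outbid S (final S q) u p"
    using up(2,3) finite_subset[OF S] by (simp add: outbid_iff_best_key b_def)
  then have "(u, p) \<in> held S q" using up(1) by (simp add: held_def)
  then have "(u, w) \<in> arcs S q" unfolding arcs_def using up(2) by force
  moreover have "inj_on snd (arcs S q)"
    using arcs_right_unique[OF _ _ S] by (auto simp: inj_on_def)
  ultimately have "parent (arcs S q) w = Some u" by (simp add: parent_eq_Some_iff)
  then show ?thesis using True up(3) \<open>u < n\<close> by simp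
next
  case False
  have "(u, w) \<notin> arcs S q" for u
  proof
    assume "(u, w) \<in> arcs S q"
    then obtain p where "(u, p) \<in> proposals S (final S q)" "p mod n = w"
      by (auto simp: arcs_def held_def)
    moreover have "finite (proposals S (final S q))" using finite_subset[OF S] by (intro finite_proposals) simp
    ultimately have "p * n + u + 1 \<le> b" unfolding b_def by (intro best_key_ge)
    then show False using False by simp
  qed
  then show ?thesis using False by (simp add: parent_def)
qed

end

lemma int_mod_expr: "int p - int p div int n * int n = int (p mod n)"
  by (simp add: minus_div_mult_eq_mod zmod_int)

text \<open>Fixes one outcome of all random numbers, so that the remaining computation is
  deterministic. The conditions on \<open>B\<close> list the magnitudes that get stored: vertices,
  coins, keys, labels and loop counters.\<close>

locale matching_program =
  fixes n k h :: nat and E :: "nat set set" and \<omega> \<rho> adjm :: "int \<Rightarrow> int" and bit B :: int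
  assumes sg: "simple_graph {..<n} E" and k: "0 < k"
    and adjm: "\<And>u w. u < n \<Longrightarrow> w < n \<Longrightarrow> adjm (int u * int n + int w) = (if adjacent E u w then 1 else 0)"
    and \<rho>: "\<And>i. 0 \<le> \<rho> i" "\<And>i. \<rho> i < int h + 2"
    and bit: "bit = 0 \<or> bit = 1"
    and B: "100 \<le> B" "int n \<le> B" "int (2 * (k * k) * Suc n) \<le> B" "int (n * (k * n) + n + 1) \<le> B"
      "int ((h + 3) * (n * Suc h)) \<le> B" "int (h + 3) \<le> B"
begin

sublocale deferred_acceptance n k "adjacent E" .

abbreviation S :: "nat set" where "S \<equiv> {..<n}"
abbreviation q :: "nat \<Rightarrow> nat \<Rightarrow> bool" where "q \<equiv> below (threshold n E) \<omega>"

definition base :: "memory \<Rightarrow> bool" where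
  "base s \<longleftrightarrow> s 0 0 = int n \<and> s 1 = adjm \<and> s 3 = \<omega> \<and> s 4 = \<rho> \<and> s 9 0 = bit"

lemma base_set_cell [simp]:
  "i \<noteq> 0 \<Longrightarrow> base (set_cell 0 i x s) = base s"
  "a \<in> {2, 5, 6, 7, 8} \<Longrightarrow> base (set_cell a i x s) = base s"
  by (auto simp: base_def set_cell_array)

lemma B_k: "int k \<le> B" "int k * int n \<le> B"
proof -
  have "k \<le> 2 * (k * k) * Suc n" by (cases k) simp_all
  then show "int k \<le> B" using B(3) by linarith
  have "k * n \<le> n * (k * n) + n + 1" by (cases n) auto
  then have "int (k * n) \<le> B" using B(4) by linarith
  then show "int k * int n \<le> B" by simp
qed

lemma wp_degree_phase:
  assumes s: "mem_le B s" "base s" "\<And>w. s 7 w = 0"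
  shows "wp B degree_phase (n * (n * 4 + 4) + 2) (\<lambda>s'. base s' \<and> (\<forall>a\<in>{2, 5, 6, 8}. s' a = s a) \<and>
     (\<forall>w<n. s' 7 (int w) = int (deg E w))) s"
proof -
  define c where "c u w = card {x. x < u \<and> adjacent E x w}" for u w
  have c_Suc: "c (Suc u) w = c u w + (if adjacent E u w then 1 else 0)" for u w
  proof -
    have "{x. x < Suc u \<and> adjacent E x w} = {x. x < u \<and> adjacent E x w} \<union> (if adjacent E u w then {u} else {})"
      by (auto simp: less_Suc_eq)
    then show ?thesis by (simp add: c_def)
  qed
  have c_le: "c u w \<le> u" for u w unfolding c_def
    by (rule order_trans[OF card_mono[of "{..<u}"]]) auto
  let ?fr = "\<lambda>s'. base s' \<and> (\<forall>a\<in>{2, 5, 6, 8}. s' a = s a)"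
  show ?thesis unfolding degree_phase_def
  proof (rule wp_For[where N = n and T = "n * 4 + 2" and I = "\<lambda>u s'. ?fr s' \<and> s' 0 1 = int u \<and> (\<forall>w<n. s' 7 (int w) = int (c u w))"])
    fix u s1 assume u: "u < n" "mem_le B s1" "?fr s1 \<and> s1 0 1 = int u \<and> (\<forall>w<n. s1 7 (int w) = int (c u w))"
    show "wp B (For 2 (V 0) (IfPos (Read 1 (Plus (Times (V 1) (V 0)) (V 2)))
       (Write 7 (V 2) (Plus (Read 7 (V 2)) (Lit 1))) Skip)) (n * 4 + 2)
       (\<lambda>s'. s' 0 1 = int u \<and> ?fr (set_cell 0 1 (int (Suc u)) s') \<and> set_cell 0 1 (int (Suc u)) s' 0 1 = int (Suc u) \<and>
         (\<forall>w<n. set_cell 0 1 (int (Suc u)) s' 7 (int w) = int (c (Suc u) w))) s1"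
    proof (rule wp_For[where N = n and T = 2 and I = "\<lambda>i s'. ?fr s' \<and> s' 0 1 = int u \<and> s' 0 2 = int i \<and>
          (\<forall>w<n. s' 7 (int w) = int (if w < i then c (Suc u) w else c u w))"])
      fix i s2 assume i: "i < n" "mem_le B s2" "?fr s2 \<and> s2 0 1 = int u \<and> s2 0 2 = int i \<and>
          (\<forall>w<n. s2 7 (int w) = int (if w < i then c (Suc u) w else c u w))"
      have "c u i + 1 \<le> n" using c_le[of u i] u by linarith
      then have "int (c u i) + 1 \<le> B" using B(2) by linarith
      then show "wp B (IfPos (Read 1 (Plus (Times (V 1) (V 0)) (V 2)))
         (Write 7 (V 2) (Plus (Read 7 (V 2)) (Lit 1))) Skip) 2 (\<lambda>s'. s' 0 2 = int i \<and> ?fr (set_cell 0 2 (int (Suc i)) s') \<and>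
           set_cell 0 2 (int (Suc i)) s' 0 1 = int u \<and> set_cell 0 2 (int (Suc i)) s' 0 2 = int (Suc i) \<and>
          (\<forall>w<n. set_cell 0 2 (int (Suc i)) s' 7 (int w) = int (if w < Suc i then c (Suc u) w else c u w))) s2"
        using i u B adjm[of u i]
        by (intro wp_weaken[OF wp_If_max[OF _ _ _ wp_Write wp_Skip]])
           (auto simp: small_def base_def set_cell_array c_Suc less_Suc_eq split: if_splits)
    qed (use u B(1,2) in \<open>auto simp: base_def set_cell_array\<close>)
  qed (use s B(1,2) in \<open>auto simp: base_def set_cell_array c_def deg_eq[OF sg] algebra_simps\<close>)
qed

text \<open>Shared by \<open>bid_phase\<close> and \<open>advance_phase\<close>, which both begin by
  loading the position of a proposer, the receiver it stands for and the shifted key.\<close>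

lemma wp_load_proposal:
  assumes s: "mem_le B s" "base s" "s 0 2 = int i" "s 5 (int i) = int p" and i: "i < n" and p: "p \<le> k * n"
    and cont: "\<And>s'. mem_le B s' \<Longrightarrow> base s' \<Longrightarrow> s' 0 1 = s 0 1 \<Longrightarrow> s' 0 2 = int i \<Longrightarrow> s' 0 4 = int p \<Longrightarrow>
      s' 0 5 = int (p mod n) \<Longrightarrow> s' 0 6 = int (p * n + i + 1) \<Longrightarrow> (\<And>a. a \<noteq> 0 \<Longrightarrow> s' a = s a) \<Longrightarrow> wp B c T Q s'"
  shows "wp B (Seq (Assign 4 (Read 5 (V 2))) (Seq (Assign 5 (Mod (V 4) (V 0)))
     (Seq (Assign 6 (Plus (Plus (Times (V 4) (V 0)) (V 2)) (Lit 1))) c))) (1 + (1 + (1 + T))) Q s"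
proof -
  define s1 where "s1 = set_cell 0 4 (int p) s"
  define s2 where "s2 = set_cell 0 5 (int (p mod n)) s1"
  define s3 where "s3 = set_cell 0 6 (int (p * n + i + 1)) s2"
  have "p * n \<le> (k * n) * n" using p by (rule mult_le_mono1)
  then have "p * n + i + 1 \<le> n * (k * n) + n + 1" using i by (simp only: mult.commute[of "k * n"])
  then have keyB: "int (p * n + i + 1) \<le> B" using B(4) by linarith
  have pB: "int p \<le> B" using p B_k(2) by (metis of_nat_mono of_nat_mult order_trans)
  have "p mod n < n" using i by simp
  then have wB: "int (p mod n) \<le> B" using B(2) by linarith
  have 1: "mem_le B s1" "base s1" "s1 0 2 = int i" "s1 0 4 = int p"
    using s pB by (auto simp: s1_def mem_le_set_cell set_cell_array)
  have 2: "mem_le B s2" "base s2" "s2 0 2 = int i" "s2 0 4 = int p"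
    using 1 wB by (auto simp: s2_def mem_le_set_cell set_cell_array)
  have 3: "mem_le B s3" "base s3"
    using 2 mem_le_set_cell[OF 2(1), of "int (p * n + i + 1)" 0 6] keyB by (simp_all add: s3_def)
  have "wp B c T Q s3"
    using 3 s by (intro cont) (simp_all add: s1_def s2_def s3_def set_cell_array)
  moreover have "val (Read 5 (V 2)) s = int p" using s by simp
  moreover have "val (Mod (V 4) (V 0)) s1 = int (p mod n)" using 1 by (simp add: base_def int_mod_expr)
  moreover have "val (Plus (Plus (Times (V 4) (V 0)) (V 2)) (Lit 1)) s2 = int (p * n + i + 1)"
    using 2 by (simp add: base_def)
  ultimately show ?thesis
    using s(1) 1(1) 2(1) B(1) pB wB keyB unfolding s3_def s2_def s1_def
    by (intro wp_Seq wp_Write) (auto simp: small_def simp del: val.simps(2-) of_nat_add of_nat_mult)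
qed

lemma wp_bid_phase:
  assumes s: "mem_le B s" "base s" and P: "finite P"
    and pos: "\<And>u. u < n \<Longrightarrow> s 5 (int u) = int (pos u)" "\<And>u. pos u \<le> k * n"
    and key: "\<And>w. w < n \<Longrightarrow> s 6 (int w) = int (best_key n P w)"
  shows "wp B (bid_phase k) (n * 9 + 2) (\<lambda>s'. base s' \<and> (\<forall>a\<in>{2, 5, 7, 8}. s' a = s a) \<and> s' 0 1 = s 0 1 \<and>
     (\<forall>w<n. s' 6 (int w) = int (best_key n (P \<union> {(u, p). u \<in> S \<and> p = pos u \<and> p < k * n \<and> adjacent E u (p mod n)}) w))) s"
proof -
  define C where "C i = {(u, p). u < i \<and> p = pos u \<and> p < k * n \<and> adjacent E u (p mod n)}" for i
  have C_Suc: "C (Suc i) = (if pos i < k * n \<and> adjacent E i (pos i mod n) then insert (i, pos i) (C i) else C i)" for i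
    unfolding C_def by (auto simp: less_Suc_eq)
  have "C i \<subseteq> (\<lambda>u. (u, pos u)) ` {..<i}" for i by (auto simp: C_def)
  then have "finite (C i)" for i by (rule finite_subset) simp
  then have finC: "finite (P \<union> C i)" for i using P by simp
  let ?fr = "\<lambda>s'. base s' \<and> (\<forall>a\<in>{2, 5, 7, 8}. s' a = s a) \<and> s' 0 1 = s 0 1"
  show ?thesis unfolding bid_phase_def
  proof (rule wp_For[where N = n and T = 7 and I = "\<lambda>i s'. ?fr s' \<and> s' 0 2 = int i \<and>
      (\<forall>w<n. s' 6 (int w) = int (best_key n (P \<union> C i) w))"])
    fix i s1 assume i: "i < n" "mem_le B s1" and I: "?fr s1 \<and> s1 0 2 = int i \<and>
      (\<forall>w<n. s1 6 (int w) = int (best_key n (P \<union> C i) w))"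
    let ?p = "pos i"
    have w: "?p mod n < n" using i by simp
    have p: "s1 5 (int i) = int ?p" using I pos(1)[OF i(1)] by simp
    have adj: "adjm (int i * int n + int (?p mod n)) = (if adjacent E i (?p mod n) then 1 else 0)"
      using adjm[OF i(1) w] .
    define \<kappa> where "\<kappa> = ?p * n + i + 1"
    have lt: "int ?p < int k * int n \<longleftrightarrow> ?p < k * n" by (simp flip: of_nat_mult)
    have best: "best_key n (P \<union> C (Suc i)) v = (if ?p < k * n \<and> adjacent E i (?p mod n) \<and> ?p mod n = v
        then max (best_key n (P \<union> C i) v) \<kappa> else best_key n (P \<union> C i) v)" for v
      using finC[of i] by (auto simp: C_Suc best_key_insert \<kappa>_def)
    let ?Q = "\<lambda>s'. s' 0 2 = int i \<and> ?fr (set_cell 0 2 (int (Suc i)) s') \<and>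
           set_cell 0 2 (int (Suc i)) s' 0 2 = int (Suc i) \<and>
           (\<forall>w<n. set_cell 0 2 (int (Suc i)) s' 6 (int w) = int (best_key n (P \<union> C (Suc i)) w))"
    have "wp B (Seq (Assign 4 (Read 5 (V 2)))
     (Seq (Assign 5 (Mod (V 4) (V 0)))
     (Seq (Assign 6 (Plus (Plus (Times (V 4) (V 0)) (V 2)) (Lit 1)))
       (IfPos (Minus (Times (Lit (int k)) (V 0)) (V 4))
         (IfPos (Read 1 (Plus (Times (V 2) (V 0)) (V 5)))
           (IfPos (Minus (V 6) (Read 6 (V 5))) (Write 6 (V 5) (V 6)) Skip)
           Skip)
         Skip)))) (1 + (1 + (1 + 4))) ?Q s1"
    proof (rule wp_load_proposal[OF i(2) _ _ p i(1) pos(2)])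
      fix s2 assume s2: "mem_le B s2" "base s2" "s2 0 1 = s1 0 1" "s2 0 2 = int i" "s2 0 4 = int ?p"
        "s2 0 5 = int (?p mod n)" "s2 0 6 = int (?p * n + i + 1)" and eq: "\<And>a. a \<noteq> 0 \<Longrightarrow> s2 a = s1 a"
      have \<kappa>: "s2 0 6 = int \<kappa>" using s2 by (simp only: \<kappa>_def)
      have \<kappa>B: "int \<kappa> \<le> B" using s2(1) \<kappa> by (metis abs_of_nat mem_le_def)
      have arr: "s2 2 = s 2" "s2 5 = s 5" "s2 7 = s 7" "s2 8 = s 8" "s2 6 = s1 6" using eq I by auto
      have b: "s2 0 0 = int n" "s2 (Suc 0) = adjm" "s2 3 = \<omega>" "s2 4 = \<rho>" "s2 9 0 = bit"
        using s2(2) by (auto simp: base_def)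
      have key: "s1 6 (int v) = int (best_key n (P \<union> C i) v)" if "v < n" for v using I that by simp
      have "s2 0 1 = s 0 1" using s2(3) I by simp
      note facts = b this s2(1,2,4-6) \<kappa> \<kappa>B arr key w
      have B2: "0 \<le> B" "1 \<le> B" "2 \<le> B" "4 \<le> B" "5 \<le> B" "6 \<le> B" using B(1) by auto
      show "wp B (IfPos (Minus (Times (Lit (int k)) (V 0)) (V 4))
         (IfPos (Read 1 (Plus (Times (V 2) (V 0)) (V 5)))
           (IfPos (Minus (V 6) (Read 6 (V 5))) (Write 6 (V 5) (V 6)) Skip)
           Skip) Skip) 4 ?Q s2"
        apply (rule wp_weaken)
         apply ((rule wp_intros | (simp add: facts B2 B_k(1) small_def; fail)
            | (auto simp: facts set_cell_array adj lt best max_def split: if_splits; fail))+)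
        done
    qed (use I in auto)
    then show "wp B (Seq (Assign 4 (Read 5 (V 2)))
     (Seq (Assign 5 (Mod (V 4) (V 0)))
     (Seq (Assign 6 (Plus (Plus (Times (V 4) (V 0)) (V 2)) (Lit 1)))
       (IfPos (Minus (Times (Lit (int k)) (V 0)) (V 4))
         (IfPos (Read 1 (Plus (Times (V 2) (V 0)) (V 5)))
           (IfPos (Minus (V 6) (Read 6 (V 5))) (Write 6 (V 5) (V 6)) Skip)
           Skip)
         Skip)))) 7 ?Q s1" by simp
  qed (use s B(1,2) key in \<open>auto simp: base_def set_cell_array C_def algebra_simps\<close>)
qed

end

text \<open>One round more than \<open>final\<close> uses: a round bids with the positions it finds
  and advances afterwards, so the keys lag one stage behind the positions.\<close>

definition auction :: "nat \<Rightarrow> com" where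
  "auction k = For 1 (Plus (Times (V 0) (Times (Lit (int k)) (V 0))) (Lit 1))
     (Seq (bid_phase k) (advance_phase k))"

definition index_expr :: "nat \<Rightarrow> expr" where
  "index_expr h = Plus (Times (V 4) (Lit (int h + 1))) (V 5)"

definition label_expr :: "nat \<Rightarrow> expr" where
  "label_expr h = Plus (Times (Read 4 (index_expr h)) (Times (V 0) (Lit (int h + 1)))) (index_expr h)"

definition step_back_com :: com where
  "step_back_com = IfPos (V 5) (Assign 5 (Plus (V 5) (Lit 1)))
     (IfPos (Read 6 (V 4)) (Assign 4 (Mod (Minus (Read 6 (V 4)) (Lit 1)) (V 0))) (Assign 5 (Lit 1)))"

definition leader_phase :: "nat \<Rightarrow> com" where
  "leader_phase h = For 1 (V 0)
     (Seq (Assign 4 (V 1)) (Seq (Assign 5 (Lit 0)) (Seq (Assign 6 (label_expr h)) (Seq (Assign 7 (Lit 0))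
     (Seq (For 2 (Lit (int h))
            (Seq step_back_com
            (Seq (Assign 8 (label_expr h))
              (IfPos (Minus (V 6) (V 8)) (Seq (Assign 6 (V 8)) (Assign 7 (Plus (V 2) (Lit 1)))) Skip))))
       (Write 8 (V 1) (Mod (V 7) (Lit 2))))))))"

text \<open>Guards can only test positivity. For 0/1 values x, y and b, the inequality (x - b)^2 >
  (y - b)^2 expresses that x \<noteq> b and y = b.\<close>

definition square_expr :: "expr \<Rightarrow> expr" where
  "square_expr e = Times e e"

definition output_phase :: com where
  "output_phase = For 1 (V 0)
     (IfPos (Read 6 (V 1))
       (Seq (Assign 4 (Mod (Minus (Read 6 (V 1)) (Lit 1)) (V 0)))
         (IfPos (Minus (square_expr (Minus (Read 8 (V 1)) (Read 9 (Lit 0))))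
                       (square_expr (Minus (Read 8 (V 4)) (Read 9 (Lit 0)))))
           (Seq (Write 2 (Plus (Times (V 4) (V 0)) (V 1)) (Lit 1))
                (Write 2 (Plus (Times (V 1) (V 0)) (V 4)) (Lit 1)))
           Skip))
       Skip)"

context matching_program
begin

text \<open>Updating in place simulates the simultaneous step, since the keys stay fixed during the
  phase and a proposer reads no position but its own.\<close>

lemma wp_advance_phase:
  assumes s: "mem_le B s" "base s"
    and pos: "\<And>u. u < n \<Longrightarrow> s 5 (int u) = int (pos u)" "\<And>u. pos u \<le> k * n"
    and key: "\<And>w. w < n \<Longrightarrow> s 6 (int w) = int (best_key n (proposals S pos) w)"
    and dg: "\<And>w. w < n \<Longrightarrow> s 7 (int w) = int (deg E w)"
  shows "wp B (advance_phase k) (n * 10 + 2) (\<lambda>s'. base s' \<and> (\<forall>a\<in>{2, 6, 7, 8}. s' a = s a) \<and> s' 0 1 = s 0 1 \<and>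
     (\<forall>u<n. s' 5 (int u) = int (advance S q pos u))) s"
proof -
  let ?fr = "\<lambda>s'. base s' \<and> (\<forall>a\<in>{2, 6, 7, 8}. s' a = s a) \<and> s' 0 1 = s 0 1"
  let ?tail = "IfPos (Minus (Times (Lit (int k)) (V 0)) (V 4))
         (IfPos (Read 1 (Plus (Times (V 2) (V 0)) (V 5)))
           (IfPos (Minus (Read 6 (V 5)) (V 6))
             (IfPos (Minus (Plus (Read 3 (Plus (Times (V 2) (Times (Lit (int k)) (V 0))) (V 4))) (Lit 1))
                 (Div (Times (Lit 2) (Plus (V 0) (Lit 1))) (Read 7 (V 5))))
               (Write 5 (V 2) (Plus (V 4) (Lit 1))) Skip)
             Skip)
           (Write 5 (V 2) (Plus (V 4) (Lit 1))))
         Skip"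
  show ?thesis unfolding advance_phase_def
  proof (rule wp_For[where N = n and T = 8 and I = "\<lambda>i s'. ?fr s' \<and> s' 0 2 = int i \<and>
      (\<forall>u<n. s' 5 (int u) = int (if u < i then advance S q pos u else pos u))"])
    fix i s1 assume i: "i < n" "mem_le B s1" and I: "?fr s1 \<and> s1 0 2 = int i \<and>
      (\<forall>u<n. s1 5 (int u) = int (if u < i then advance S q pos u else pos u))"
    let ?p = "pos i"
    have w: "?p mod n < n" using i by simp
    have p: "s1 5 (int i) = int ?p" using I i by simp
    have adj: "adjm (int i * int n + int (?p mod n)) = (if adjacent E i (?p mod n) then 1 else 0)"
      using adjm[OF i(1) w] .
    have lt: "int ?p < int k * int n \<longleftrightarrow> ?p < k * n" by (simp flip: of_nat_mult)
    define \<kappa> where "\<kappa> = ?p * n + i + 1"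
    define b where "b = best_key n (proposals S pos) (?p mod n)"
    define th where "th = 2 * Suc n div deg E (?p mod n)"
    define cn where "cn = \<omega> (int (i * (k * n) + ?p))"
    have coin: "\<omega> (int i * (int k * int n) + int ?p) = cn" by (simp add: cn_def)
    have thr: "(2 * int n + 2) div int (deg E (?p mod n)) = int th"
      by (simp add: th_def zdiv_int add.commute)
    have adv: "advance S q pos i = (if ?p < k * n \<and> (adjacent E i (?p mod n) \<longrightarrow> \<kappa> < b \<and> int th \<le> cn) then Suc ?p else ?p)"
      using i(1) by (auto simp: advance_def outbid_iff_best_key below_def threshold_def \<kappa>_def b_def th_def cn_def)
    have "?p + 1 \<le> n * (k * n) + n + 1" using pos(2)[of i] i(1)
      by (cases n) (auto intro: le_trans[of _ "k * n"])
    then have pB: "int ?p + 1 \<le> B" using B(4) by linarith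
    let ?Q = "\<lambda>s'. s' 0 2 = int i \<and> ?fr (set_cell 0 2 (int (Suc i)) s') \<and>
           set_cell 0 2 (int (Suc i)) s' 0 2 = int (Suc i) \<and>
           (\<forall>u<n. set_cell 0 2 (int (Suc i)) s' 5 (int u) = int (if u < Suc i then advance S q pos u else pos u))"
    have "wp B (Seq (Assign 4 (Read 5 (V 2))) (Seq (Assign 5 (Mod (V 4) (V 0)))
     (Seq (Assign 6 (Plus (Plus (Times (V 4) (V 0)) (V 2)) (Lit 1))) ?tail))) (1 + (1 + (1 + 5))) ?Q s1"
    proof (rule wp_load_proposal[OF i(2) _ _ p i(1) pos(2)])
      fix s2 assume s2: "mem_le B s2" "base s2" "s2 0 1 = s1 0 1" "s2 0 2 = int i" "s2 0 4 = int ?p"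
        "s2 0 5 = int (?p mod n)" "s2 0 6 = int (?p * n + i + 1)" and eq: "\<And>a. a \<noteq> 0 \<Longrightarrow> s2 a = s1 a"
      have \<kappa>: "s2 0 6 = int \<kappa>" using s2 by (simp only: \<kappa>_def)
      have arr: "s2 2 = s 2" "s2 6 = s 6" "s2 7 = s 7" "s2 8 = s 8" "s2 5 = s1 5" using eq I by auto
      have bs: "s2 0 0 = int n" "s2 (Suc 0) = adjm" "s2 3 = \<omega>" "s2 4 = \<rho>" "s2 9 0 = bit"
        using s2(2) by (auto simp: base_def)
      have key': "s 6 (int (?p mod n)) = int b" using key[OF w] by (simp add: b_def)
      have dg': "s 7 (int (?p mod n)) = int (deg E (?p mod n))" using dg[OF w] .
      have pos': "s1 5 (int v) = int (if v < i then advance S q pos v else pos v)" if "v < n" for v using I that by simp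
      have "s2 0 1 = s 0 1" using s2(3) I by simp
      note facts = bs this s2(1,2,4-6) \<kappa> arr key' dg' pos' w
      have B2: "0 \<le> B" "1 \<le> B" "2 \<le> B" "4 \<le> B" "5 \<le> B" "6 \<le> B" using B(1) by auto
      show "wp B ?tail 5 ?Q s2"
        apply (rule wp_weaken)
         apply ((rule wp_intros | (simp add: facts B2 pB B_k(1) small_def; fail)
            | (auto simp: facts set_cell_array adj lt adv coin thr less_Suc_eq split: if_splits; fail))+)
        done
    qed (use I in auto)
    then show "wp B (Seq (Assign 4 (Read 5 (V 2))) (Seq (Assign 5 (Mod (V 4) (V 0)))
     (Seq (Assign 6 (Plus (Plus (Times (V 4) (V 0)) (V 2)) (Lit 1))) ?tail))) 8 ?Q s1" by simp
  qed (use s B(1,2) pos in \<open>auto simp: base_def set_cell_array algebra_simps\<close>)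
qed

lemma wp_auction:
  assumes s: "mem_le B s" "base s" "\<And>w. s 5 w = 0" "\<And>w. s 6 w = 0"
    and dg: "\<And>w. w < n \<Longrightarrow> s 7 (int w) = int (deg E w)"
  shows "wp B (auction k) ((n * (k * n) + 1) * (n * 19 + 6) + 2) (\<lambda>s'. base s' \<and> (\<forall>a\<in>{2, 8}. s' a = s a) \<and>
     (\<forall>w<n. s' 6 (int w) = int (best_key n (proposals S (final S q)) w))) s"
proof -
  \<comment> \<open>The proposals entered into the keys before round \<open>t\<close>; the empty set
    at \<open>t = 0\<close> matches the zeros in array 6.\<close>
  define prev where "prev t = (if t = 0 then {} else proposals S (stage S q (t - 1)))" for t
  have prev_Suc: "prev t \<union> {(u, p). u \<in> S \<and> p = stage S q t u \<and> p < k * n \<and> adjacent E u (p mod n)} = prev (Suc t)" for t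
  proof (cases t)
    case 0
    then show ?thesis using proposals_stage_0[of S q] by (simp add: prev_def)
  next
    case (Suc t')
    then show ?thesis using proposals_stage_Suc[of S q t'] by (simp add: prev_def)
  qed
  have finp: "finite (prev t)" for t by (simp add: prev_def finite_proposals)
  let ?fr = "\<lambda>s'. base s' \<and> (\<forall>a\<in>{2, 7, 8}. s' a = s a)"
  let ?N = "n * (k * n) + 1"
  let ?I = "\<lambda>t s'. ?fr s' \<and> s' 0 1 = int t \<and> (\<forall>u<n. s' 5 (int u) = int (stage S q t u)) \<and>
      (\<forall>w<n. s' 6 (int w) = int (best_key n (prev t) w))"
  show ?thesis unfolding auction_def
  proof (rule wp_For[where N = ?N and T = "(n * 9 + 2) + (n * 10 + 2)" and I = ?I])
    fix t s1 assume t: "t < ?N" "mem_le B s1" "?I t s1"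
    let ?Q = "\<lambda>s'. s' 0 1 = int t \<and> ?I (Suc t) (set_cell 0 1 (int (Suc t)) s')"
    have pos: "s1 5 (int u) = int (stage S q t u)" if "u < n" for u using t that by blast
    have key: "s1 6 (int w) = int (best_key n (prev t) w)" if "w < n" for w using t that by blast
    have "base s1" using t by blast
    show "wp B (Seq (bid_phase k) (advance_phase k)) ((n * 9 + 2) + (n * 10 + 2)) ?Q s1"
    proof (rule wp_Seq, rule wp_mono[OF wp_bid_phase[OF t(2) \<open>base s1\<close> finp pos stage_le key] order_refl])
      fix s2 assume s2: "mem_le B s2" and s2': "base s2 \<and> (\<forall>a\<in>{2, 5, 7, 8}. s2 a = s1 a) \<and> s2 0 1 = s1 0 1 \<and>
        (\<forall>w<n. s2 6 (int w) = int (best_key n (prev t \<union> {(u, p). u \<in> S \<and> p = stage S q t u \<and> p < k * n \<and> adjacent E u (p mod n)}) w))"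
      then have b2: "base s2" and a2: "s2 5 = s1 5" "s2 7 = s1 7" "s2 2 = s1 2" "s2 8 = s1 8" "s2 0 1 = s1 0 1"
        and k2: "\<And>w. w < n \<Longrightarrow> s2 6 (int w) = int (best_key n (prev (Suc t)) w)"
        unfolding prev_Suc by auto
      have prev: "prev (Suc t) = proposals S (stage S q t)" by (simp add: prev_def)
      show "wp B (advance_phase k) (n * 10 + 2) ?Q s2"
      proof (rule wp_mono[OF wp_advance_phase[where pos = "stage S q t"] order_refl])
        show "s2 5 (int u) = int (stage S q t u)" if "u < n" for u using pos that a2 by simp
        show "s2 6 (int w) = int (best_key n (proposals S (stage S q t)) w)" if "w < n" for w
          using k2 that prev by simp
        show "s2 7 (int w) = int (deg E w)" if "w < n" for w using a2 t dg that by simp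
        fix s3 assume "base s3 \<and> (\<forall>a\<in>{2, 6, 7, 8}. s3 a = s2 a) \<and> s3 0 1 = s2 0 1 \<and>
          (\<forall>u<n. s3 5 (int u) = int (advance S q (stage S q t) u))"
        then show "?Q s3" using t(3) a2 k2 by (simp add: set_cell_array stage_Suc)
      qed (fact s2 b2 stage_le)+
    qed
  next
    fix s1 assume "?I ?N s1"
    then show "base s1 \<and> (\<forall>a\<in>{2, 8}. s1 a = s a) \<and> (\<forall>w<n. s1 6 (int w) = int (best_key n (proposals S (final S q)) w))"
      by (simp add: prev_def final_def)
  next
    have "n * (k * n) + 1 \<le> n * (k * n) + n + 1" by simp
    then show "int ?N \<le> B" using B(4) by linarith
  qed (use s B(1,2) B_k in \<open>auto simp: base_def set_cell_array prev_def algebra_simps\<close>)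
qed


section \<open>Finding the leaders and writing the output\<close>

abbreviation bk :: "nat \<Rightarrow> nat" where
  "bk \<equiv> best_key n (proposals S (final S q))"

abbreviation par :: "nat \<Rightarrow> nat option" where
  "par \<equiv> parent (arc_set n k E \<omega>)"

abbreviation lab :: "nat \<times> nat \<Rightarrow> nat" where
  "lab \<equiv> label n h (ranks \<rho>)"

lemma par_eq: "w < n \<Longrightarrow> par w = (if 0 < bk w then Some ((bk w - 1) mod n) else None)"
  unfolding arc_set_def using parent_arcs_best_key[OF order_refl, of w q] by simp

lemma par_less: "w < n \<Longrightarrow> par w = Some u \<Longrightarrow> u < n"
  by (auto simp: par_eq split: if_splits)

lemma val_label_expr:
  assumes "base s" "s 0 4 = int x" "s 0 5 = int i"
  shows "val (label_expr h) s = int (lab (x, i))"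
proof -
  have idx: "val (index_expr h) s = int (x * Suc h + i)"
    using assms by (simp add: index_expr_def algebra_simps)
  have "s 4 (int (x * Suc h + i)) = int (ranks \<rho> (x * Suc h + i))"
    using assms(1) \<rho>(1) by (simp add: base_def ranks_def)
  then have "val (label_expr h) s = int (ranks \<rho> (x * Suc h + i)) * (int n * (int h + 1)) + int (x * Suc h + i)"
    unfolding label_expr_def val.simps idx using assms(1) by (simp add: base_def)
  also have "\<dots> = int (ranks \<rho> (x * Suc h + i) * (n * Suc h) + (x * Suc h + i))" by (simp add: algebra_simps)
  finally show ?thesis by (simp add: label_def Let_def del: of_nat_add of_nat_mult)
qed

lemma lab_le:
  assumes "x < n" "i \<le> h"
  shows "int (lab (x, i)) \<le> B"
proof -
  have "x * Suc h + i \<le> Suc x * Suc h" using assms by simp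
  also have "\<dots> \<le> n * Suc h" using assms by (intro mult_le_mono1) simp
  finally have j: "x * Suc h + i \<le> n * Suc h" .
  have "ranks \<rho> (x * Suc h + i) \<le> h + 2" using \<rho>(2)[of "int (x * Suc h + i)"] by (simp add: ranks_def)
  then have "ranks \<rho> (x * Suc h + i) * (n * Suc h) \<le> (h + 2) * (n * Suc h)" by (rule mult_le_mono1)
  then have "lab (x, i) \<le> (h + 2) * (n * Suc h) + n * Suc h"
    using j unfolding label_def Let_def fst_conv snd_conv by (rule add_le_mono)
  also have "\<dots> = (h + 3) * (n * Suc h)" by (simp add: algebra_simps)
  finally show ?thesis using B(5) by linarith
qed

lemma small_label_expr: "small B (label_expr h)"
  using B(1,6) by (simp add: small_def label_expr_def index_expr_def)

text \<open>A best key of 0 marks a vertex without predecessor; there, and from then on, only the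
  virtual part of the node advances.\<close>

lemma wp_step_back_com:
  assumes s: "mem_le B s" "base s" "s 0 4 = int x" "s 0 5 = int i" and x: "x < n" and i: "i < h"
    and key: "\<And>w. w < n \<Longrightarrow> s 6 (int w) = int (bk w)"
  shows "wp B step_back_com 3 (\<lambda>s'. base s' \<and> (\<forall>a. a \<noteq> 0 \<longrightarrow> s' a = s a) \<and>
     (\<forall>v. v \<noteq> 4 \<and> v \<noteq> 5 \<longrightarrow> s' 0 v = s 0 v) \<and>
     s' 0 4 = int (fst (step_back par (x, i))) \<and> s' 0 5 = int (snd (step_back par (x, i)))) s"
proof -
  have b: "s 0 0 = int n" "s 0 4 = int x" "s 0 5 = int i" "s 6 (int x) = int (bk x)" using s key[OF x] by (auto simp: base_def)
  have B2: "0 \<le> B" "1 \<le> B" "2 \<le> B" "4 \<le> B" "5 \<le> B" "6 \<le> B" using B(1) by auto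
  have iB: "int i + 1 \<le> B" using i B(6) by linarith
  define m where "m = (bk x - 1) mod n"
  have "m < n" using x by (simp add: m_def)
  then have mB: "int m \<le> B" using B(2) by linarith
  have md: "0 < bk x \<Longrightarrow> int (bk x) - 1 - (int (bk x) - 1) div int n * int n = int m"
    using int_mod_expr[of "bk x - 1" n] by (simp add: m_def of_nat_diff)
  have par: "par x = (if 0 < bk x then Some m else None)" using par_eq[OF x] by (simp add: m_def)
  show ?thesis unfolding step_back_com_def
    apply (rule wp_weaken)
     apply ((rule wp_intros | (simp add: b s B2 iB mB md small_def; fail)
        | (auto simp: b s set_cell_array par; fail) | (auto simp: b s set_cell_array par md mB; fail))+)
    done
qed

lemma wp_leader_phase:
  assumes s: "mem_le B s" "base s" and key: "\<And>w. w < n \<Longrightarrow> s 6 (int w) = int (bk w)"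
  shows "wp B (leader_phase h) (n * (h * 9 + 10) + 2) (\<lambda>s'. base s' \<and> s' 2 = s 2 \<and> s' 6 = s 6 \<and>
     (\<forall>v<n. s' 8 (int v) = (if side n h (ranks \<rho>) par v then 1 else 0))) s"
proof -
  let ?z = "\<lambda>v j. (step_back par ^^ j) (v, 0)" and ?ld = "\<lambda>v j. lead n h (ranks \<rho>) par v j"
  let ?fr = "\<lambda>s'. base s' \<and> s' 2 = s 2 \<and> s' 6 = s 6"
  let ?sd = "\<lambda>v. if side n h (ranks \<rho>) par v then 1 else (0 :: int)"
  let ?walk = "Seq step_back_com (Seq (Assign 8 (label_expr h))
              (IfPos (Minus (V 6) (V 8)) (Seq (Assign 6 (V 8)) (Assign 7 (Plus (V 2) (Lit 1)))) Skip))"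
  have zb: "fst (?z v j) < n \<and> snd (?z v j) \<le> j" if "v < n" for v j
    using step_back_bounds[of n par "(v, 0)" j] par_less that by simp
  have B2: "0 \<le> B" "1 \<le> B" "2 \<le> B" "4 \<le> B" "5 \<le> B" "6 \<le> B" "7 \<le> B" "8 \<le> B" "int h \<le> B" using B(1,6) by auto
  have labB: "int (lab (?z v j)) \<le> B" if "v < n" "j \<le> h" for v j
    using lab_le[of "fst (?z v j)" "snd (?z v j)"] zb[OF that(1), of j] that by simp
  show ?thesis unfolding leader_phase_def
  proof (rule wp_For[where N = n and T = "h * 9 + 8" and I = "\<lambda>v s'. ?fr s' \<and> s' 0 1 = int v \<and> (\<forall>u<v. s' 8 (int u) = ?sd u)"])
    fix v s1 assume v: "v < n" "mem_le B s1" and I: "?fr s1 \<and> s1 0 1 = int v \<and> (\<forall>u<v. s1 8 (int u) = ?sd u)"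
    let ?Q = "\<lambda>s'. s' 0 1 = int v \<and> ?fr (set_cell 0 1 (int (Suc v)) s') \<and>
        set_cell 0 1 (int (Suc v)) s' 0 1 = int (Suc v) \<and> (\<forall>u<Suc v. set_cell 0 1 (int (Suc v)) s' 8 (int u) = ?sd u)"
    \<comment> \<open>Cells 4 and 5 hold the current node of the walk, cell 6 the least label so far
      and cell 7 its position.\<close>
    let ?J = "\<lambda>j s'. ?fr s' \<and> s' 8 = s1 8 \<and> s' 0 1 = int v \<and> s' 0 2 = int j \<and> s' 0 4 = int (fst (?z v j)) \<and>
        s' 0 5 = int (snd (?z v j)) \<and> s' 0 6 = int (lab (?z v (?ld v j))) \<and> s' 0 7 = int (?ld v j)"
    have vB: "int v \<le> B" using v B(2) by linarith
    have walk: "wp B (For 2 (Lit (int h)) ?walk) (h * 9 + 2) (\<lambda>s'. ?J h s' \<and> mem_le B s') s2"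
      if s2: "mem_le B s2" "?fr s2 \<and> s2 8 = s1 8 \<and> s2 0 1 = int v \<and> s2 0 4 = int v \<and> s2 0 5 = 0 \<and> s2 0 6 = int (lab (v, 0)) \<and> s2 0 7 = 0" for s2
    proof (rule wp_For[where N = h and T = 7 and I = ?J])
      fix j s3 assume j: "j < h" "mem_le B s3" and J: "?J j s3"
      let ?R = "\<lambda>s'. s' 0 2 = int j \<and> ?J (Suc j) (set_cell 0 2 (int (Suc j)) s')"
      have z: "?z v (Suc j) = step_back par (fst (?z v j), snd (?z v j))" by simp
      have zj: "fst (?z v j) < n" "snd (?z v j) < h" using zb[OF v(1), of j] j by auto
      have "wp B ?walk (3 + (1 + 3)) ?R s3"
      proof (rule wp_Seq, rule wp_mono[OF wp_step_back_com[OF j(2) _ _ _ zj] order_refl])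
        fix s4 assume s4: "mem_le B s4" and "base s4 \<and> (\<forall>a. a \<noteq> 0 \<longrightarrow> s4 a = s3 a) \<and>
          (\<forall>v. v \<noteq> 4 \<and> v \<noteq> 5 \<longrightarrow> s4 0 v = s3 0 v) \<and>
          s4 0 4 = int (fst (step_back par (fst (?z v j), snd (?z v j)))) \<and>
          s4 0 5 = int (snd (step_back par (fst (?z v j), snd (?z v j))))"
        then have s4': "base s4" "s4 2 = s 2" "s4 6 = s 6" "s4 8 = s1 8" "s4 0 1 = int v" "s4 0 2 = int j"
          "s4 0 4 = int (fst (?z v (Suc j)))" "s4 0 5 = int (snd (?z v (Suc j)))"
          "s4 0 6 = int (lab (?z v (?ld v j)))" "s4 0 7 = int (?ld v j)"
          unfolding z[symmetric] using J by auto
        have lab: "val (label_expr h) s4 = int (lab (?z v (Suc j)))"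
          using val_label_expr[OF s4'(1,7,8)] by (simp only: prod.collapse)
        have lB: "int (lab (?z v (Suc j))) \<le> B" using labB v j by (simp add: Suc_leI del: funpow.simps)
        define l1 where "l1 = lab (?z v (Suc j))"
        define l0 where "l0 = lab (?z v (?ld v j))"
        define s5 where "s5 = set_cell 0 8 (int l1) s4"
        have s5: "mem_le B s5" "base s5" "s5 2 = s 2" "s5 6 = s 6" "s5 8 = s1 8" "s5 0 1 = int v" "s5 0 2 = int j"
          "s5 0 4 = int (fst (?z v (Suc j)))" "s5 0 5 = int (snd (?z v (Suc j)))"
          "s5 0 6 = int l0" "s5 0 7 = int (?ld v j)" "s5 0 8 = int l1"
          using s4 s4' mem_le_set_cell[OF s4, of "int l1" 0 8] lB
          by (simp_all add: s5_def l1_def l0_def set_cell_array del: funpow.simps)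
        have ld: "?ld v (Suc j) = (if l1 < l0 then Suc j else ?ld v j)" by (simp add: l1_def l0_def)
        have jB: "int j + 1 \<le> B" using j B(6) by linarith
        have l: "lab (?z v (Suc j)) = l1" "lab (?z v (?ld v j)) = l0" by (simp_all only: l1_def l0_def)
        have "wp B (IfPos (Minus (V 6) (V 8)) (Seq (Assign 6 (V 8)) (Assign 7 (Plus (V 2) (Lit 1)))) Skip) 3 ?R s5"
          apply (rule wp_weaken)
           apply ((rule wp_intros | (simp add: s5 B2 jB small_def lB[folded l1_def] set_cell_array del: funpow.simps; fail)
              | (auto simp: s5 set_cell_array ld l simp del: funpow.simps lead.simps; fail))+)
          done
        then show "wp B (Seq (Assign 8 (label_expr h)) (IfPos (Minus (V 6) (V 8)) (Seq (Assign 6 (V 8)) (Assign 7 (Plus (V 2) (Lit 1)))) Skip)) (1 + 3) ?R s4"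
          unfolding s5_def l1_def using s4 lB lab small_label_expr B2
          by (intro wp_Seq wp_Write) (simp_all add: small_def del: funpow.simps)
      qed (use J key in auto)
      then show "wp B ?walk 7 ?R s3" by simp
    qed (use s2 B2 B(1,6) in \<open>auto simp: set_cell_array small_def simp del: funpow.simps(2)\<close>)
    define s2 where "s2 = set_cell 0 7 0 (set_cell 0 6 (int (lab (v, 0))) (set_cell 0 5 0 (set_cell 0 4 (int v) s1)))"
    have m1: "mem_le B (set_cell 0 4 (int v) s1)" using v vB by (simp add: mem_le_set_cell)
    then have m2: "mem_le B (set_cell 0 5 0 (set_cell 0 4 (int v) s1))" using B2 by (simp add: mem_le_set_cell)
    have l0B: "int (lab (v, 0)) \<le> B" using lab_le[of v 0] v by simp
    then have m3: "mem_le B (set_cell 0 6 (int (lab (v, 0))) (set_cell 0 5 0 (set_cell 0 4 (int v) s1)))"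
      using m2 by (simp add: mem_le_set_cell)
    then have m4: "mem_le B s2" using B2 by (simp add: s2_def mem_le_set_cell)
    have lab: "val (label_expr h) (set_cell 0 5 0 (set_cell 0 4 (int v) s1)) = int (lab (v, 0))"
      using I by (intro val_label_expr) (auto simp: set_cell_array)
    have tail: "wp B (Seq (For 2 (Lit (int h)) ?walk) (Write 8 (V 1) (Mod (V 7) (Lit 2)))) ((h * 9 + 2) + 1) ?Q s2"
    proof (rule wp_Seq, rule wp_mono[OF walk order_refl])
      fix s3 assume s3: "mem_le B s3" "?J h s3 \<and> mem_le B s3"
      have md: "int (?ld v h) - int (?ld v h) div 2 * 2 = ?sd v"
        using int_mod_expr[of "?ld v h" 2] by (auto simp: side_def odd_iff_mod_2_eq_one even_iff_mod_2_eq_zero)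
      show "wp B (Write 8 (V 1) (Mod (V 7) (Lit 2))) 1 ?Q s3"
        by (rule wp_Write) (use s3 B2 I in \<open>auto simp: small_def md set_cell_array less_Suc_eq\<close>)
    qed (use m4 I in \<open>auto simp: s2_def set_cell_array\<close>)
    have "wp B (Seq (Assign 4 (V 1)) (Seq (Assign 5 (Lit 0)) (Seq (Assign 6 (label_expr h)) (Seq (Assign 7 (Lit 0))
     (Seq (For 2 (Lit (int h)) ?walk) (Write 8 (V 1) (Mod (V 7) (Lit 2)))))))) (1 + (1 + (1 + (1 + ((h * 9 + 2) + 1))))) ?Q s1"
      apply (rule wp_Seq, rule wp_Write)
           apply (use v vB B2 I in \<open>simp_all add: small_def\<close>)[5]
      apply (rule wp_Seq, rule wp_Write)
           apply (use v vB B2 I m1 in \<open>simp_all add: small_def\<close>)[5]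
      apply (rule wp_Seq, rule wp_Write)
           apply (use v vB B2 I m2 lab l0B small_label_expr in \<open>simp_all add: small_def\<close>)[5]
      apply (rule wp_Seq, rule wp_Write)
           apply (use v vB B2 I m3 lab in \<open>simp_all add: small_def\<close>)[5]
      using tail lab I by (simp add: s2_def)
    then show "wp B (Seq (Assign 4 (V 1)) (Seq (Assign 5 (Lit 0)) (Seq (Assign 6 (label_expr h)) (Seq (Assign 7 (Lit 0))
     (Seq (For 2 (Lit (int h)) ?walk) (Write 8 (V 1) (Mod (V 7) (Lit 2)))))))) (h * 9 + 8) ?Q s1"
      by (rule wp_weaken) simp
  qed (use s B(1,2) B2 in \<open>auto simp: set_cell_array base_def algebra_simps\<close>)
qed

text \<open>Each selected arc is written in both orientations, because the edge set is read from the
  strict upper triangle and an arc may point either way.\<close>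

lemma wp_output_phase:
  assumes s: "mem_le B s" "base s" "\<And>x. s 2 x = 0" and key: "\<And>w. w < n \<Longrightarrow> s 6 (int w) = int (bk w)"
    and sd: "\<And>v. v < n \<Longrightarrow> s 8 (int v) = (if side n h (ranks \<rho>) par v then 1 else 0)"
  shows "wp B output_phase (n * 7 + 2) (\<lambda>s'. output_edges n s' = matched_edges n k h E \<omega> \<rho> (0 < bit)) s"
proof -
  let ?A = "selected n h (ranks \<rho>) (0 < bit) (arc_set n k E \<omega>)"
  define cells where "cells v = {x. \<exists>u w. (u, w) \<in> ?A \<and> w < v \<and> (x = int u * int n + int w \<or> x = int w * int n + int u)}" for v
  have arc: "(u, w) \<in> arc_set n k E \<omega> \<longleftrightarrow> par w = Some u" for u w
    using arc_set_partial_matching[of n k E \<omega>] by (simp add: partial_matching_def parent_eq_Some_iff)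
  have cells_Suc: "cells (Suc v) = cells v \<union>
      (case par v of Some u \<Rightarrow> if (u, v) \<in> ?A then {int u * int n + int v, int v * int n + int u} else {} | None \<Rightarrow> {})" for v
  proof -
    have "cells (Suc v) = cells v \<union> {x. \<exists>u. (u, v) \<in> ?A \<and> (x = int u * int n + int v \<or> x = int v * int n + int u)}"
      unfolding cells_def by (auto simp: less_Suc_eq)
    also have "{x. \<exists>u. (u, v) \<in> ?A \<and> (x = int u * int n + int v \<or> x = int v * int n + int u)} =
      (case par v of Some u \<Rightarrow> if (u, v) \<in> ?A then {int u * int n + int v, int v * int n + int u} else {} | None \<Rightarrow> {})"
      by (auto simp: selected_def arc split: option.splits)
    finally show ?thesis .
  qed
  let ?fr = "\<lambda>s'. base s' \<and> s' 6 = s 6 \<and> s' 8 = s 8"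
  have B2: "0 \<le> B" "1 \<le> B" "2 \<le> B" "4 \<le> B" "5 \<le> B" "6 \<le> B" using B(1) by auto
  show ?thesis unfolding output_phase_def
  proof (rule wp_For[where N = n and T = 5 and I = "\<lambda>v s'. ?fr s' \<and> s' 0 1 = int v \<and> (\<forall>x. s' 2 x \<noteq> 0 \<longleftrightarrow> x \<in> cells v)"])
    fix v s1 assume v: "v < n" "mem_le B s1" and I: "?fr s1 \<and> s1 0 1 = int v \<and> (\<forall>x. s1 2 x \<noteq> 0 \<longleftrightarrow> x \<in> cells v)"
    let ?Q = "\<lambda>s'. s' 0 1 = int v \<and> ?fr (set_cell 0 1 (int (Suc v)) s') \<and> set_cell 0 1 (int (Suc v)) s' 0 1 = int (Suc v) \<and>
      (\<forall>x. set_cell 0 1 (int (Suc v)) s' 2 x \<noteq> 0 \<longleftrightarrow> x \<in> cells (Suc v))"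
    define m where "m = (bk v - 1) mod n"
    have mn: "m < n" using v by (simp add: m_def)
    then have mB: "int m \<le> B" using B(2) by linarith
    have md: "0 < bk v \<Longrightarrow> int (bk v) - 1 - (int (bk v) - 1) div int n * int n = int m"
      using int_mod_expr[of "bk v - 1" n] by (simp add: m_def of_nat_diff)
    have par: "par v = (if 0 < bk v then Some m else None)" using par_eq[OF v(1)] by (simp add: m_def)
    have sel: "0 < bk v \<Longrightarrow> (m, v) \<in> ?A \<longleftrightarrow> s 8 (int m) = bit \<and> s 8 (int v) \<noteq> bit"
      using sd[OF mn] sd[OF v(1)] bit par by (auto simp: selected_def arc)
    have sq: "0 < (s 8 (int v) - bit) * (s 8 (int v) - bit) - (s 8 (int m) - bit) * (s 8 (int m) - bit)
        \<longleftrightarrow> s 8 (int m) = bit \<and> s 8 (int v) \<noteq> bit"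
      using sd[OF mn] sd[OF v(1)] bit by auto
    have b: "s1 0 0 = int n" "s1 0 1 = int v" "s1 6 = s 6" "s1 8 = s 8" "s1 9 0 = bit" "s 6 (int v) = int (bk v)"
      using I key[OF v(1)] by (auto simp: base_def)
    show "wp B (IfPos (Read 6 (V 1))
       (Seq (Assign 4 (Mod (Minus (Read 6 (V 1)) (Lit 1)) (V 0)))
         (IfPos (Minus (square_expr (Minus (Read 8 (V 1)) (Read 9 (Lit 0))))
                       (square_expr (Minus (Read 8 (V 4)) (Read 9 (Lit 0)))))
           (Seq (Write 2 (Plus (Times (V 4) (V 0)) (V 1)) (Lit 1))
                (Write 2 (Plus (Times (V 1) (V 0)) (V 4)) (Lit 1)))
           Skip))
       Skip) 5 ?Q s1"
    proof (cases "0 < bk v")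
      case False
      then have "cells (Suc v) = cells v" by (simp add: cells_Suc par)
      then show ?thesis
        using False I b v B2
        by (intro wp_weaken[OF wp_If_max[where ?T1.0 = 0, OF _ _ _ _ wp_Skip]]) (auto simp: small_def set_cell_array)
    next
      case True
      define s2 where "s2 = set_cell 0 4 (int m) s1"
      have s2: "mem_le B s2" "base s2" "s2 0 0 = int n" "s2 0 1 = int v" "s2 0 4 = int m" "s2 6 = s 6" "s2 8 = s 8" "s2 9 0 = bit" "s2 2 = s1 2"
        using I b v mB by (auto simp: s2_def set_cell_array mem_le_set_cell)
      have "wp B (IfPos (Minus (square_expr (Minus (Read 8 (V 1)) (Read 9 (Lit 0))))
                       (square_expr (Minus (Read 8 (V 4)) (Read 9 (Lit 0)))))
           (Seq (Write 2 (Plus (Times (V 4) (V 0)) (V 1)) (Lit 1))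
                (Write 2 (Plus (Times (V 1) (V 0)) (V 4)) (Lit 1)))
           Skip) (max (1 + 1) 1 + 1) ?Q s2"
      proof (rule wp_If_max)
        assume "0 < val (Minus (square_expr (Minus (Read 8 (V 1)) (Read 9 (Lit 0))))
                       (square_expr (Minus (Read 8 (V 4)) (Read 9 (Lit 0))))) s2"
        then have "(m, v) \<in> ?A" using sq sel[OF True] s2 by (simp add: square_expr_def)
        then have c: "cells (Suc v) = cells v \<union> {int m * int n + int v, int v * int n + int m}"
          using True by (simp add: cells_Suc par)
        show "wp B (Seq (Write 2 (Plus (Times (V 4) (V 0)) (V 1)) (Lit 1))
                (Write 2 (Plus (Times (V 1) (V 0)) (V 4)) (Lit 1))) (1 + 1) ?Q s2"
          apply (rule wp_Seq, rule wp_Write)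
               apply (use s2 B2 in \<open>simp_all add: small_def\<close>)[5]
          apply (rule wp_Write)
               apply (use s2 B2 in \<open>simp_all add: small_def set_cell_array\<close>)[5]
          using s2 I c by (auto simp: set_cell_array)
      next
        assume "\<not> 0 < val (Minus (square_expr (Minus (Read 8 (V 1)) (Read 9 (Lit 0))))
                       (square_expr (Minus (Read 8 (V 4)) (Read 9 (Lit 0))))) s2"
        then have "(m, v) \<notin> ?A" using sq sel[OF True] s2 by (simp add: square_expr_def)
        then have c: "cells (Suc v) = cells v" using True by (simp add: cells_Suc par)
        show "wp B Skip 1 ?Q s2" by (rule wp_Skip) (use s2 I c in \<open>auto simp: set_cell_array\<close>)
      qed (use s2 B2 in \<open>auto simp: small_def square_expr_def\<close>)
      then have "wp B (Seq (Assign 4 (Mod (Minus (Read 6 (V 1)) (Lit 1)) (V 0)))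
         (IfPos (Minus (square_expr (Minus (Read 8 (V 1)) (Read 9 (Lit 0))))
                       (square_expr (Minus (Read 8 (V 4)) (Read 9 (Lit 0)))))
           (Seq (Write 2 (Plus (Times (V 4) (V 0)) (V 1)) (Lit 1))
                (Write 2 (Plus (Times (V 1) (V 0)) (V 4)) (Lit 1)))
           Skip)) (1 + (max (1 + 1) 1 + 1)) ?Q s1"
        using b v B2 mB md[OF True] unfolding s2_def
        by (intro wp_Seq wp_Write) (simp_all add: small_def)
      then show ?thesis
        by (intro wp_weaken[OF wp_If_max[where ?T2.0 = 0]]) (use True b v B2 in \<open>auto simp: small_def\<close>)
    qed
  next
    fix s1 assume "?fr s1 \<and> s1 0 1 = int n \<and> (\<forall>x. s1 2 x \<noteq> 0 \<longleftrightarrow> x \<in> cells n)"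
    then have out: "output_edges n s1 = {{u, v} | u v. u < v \<and> v < n \<and> int (u * n + v) \<in> cells n}"
      by (simp add: output_edges_def)
    have An: "u < n \<and> w < n \<and> u \<noteq> w" if "(u, w) \<in> ?A" for u w
    proof -
      have "{u, w} \<in> E" using that by (auto simp: selected_def intro: arc_set_adjacent)
      then show ?thesis using simple_graph_edge[OF sg] by blast
    qed
    have idx: "a = a' \<and> b = b'" if "a * n + b = a' * n + b'" "b < n" "b' < n" for a b a' b' :: nat
    proof -
      have "(a * n + b) div n = (a' * n + b') div n" "(a * n + b) mod n = (a' * n + b') mod n"
        using that(1) by simp_all
      then show ?thesis using that(2,3) by simp
    qed
    have mem: "int (a * n + b) \<in> cells n \<longleftrightarrow> (a, b) \<in> ?A \<or> (b, a) \<in> ?A" if "b < n" for a b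
    proof
      assume "int (a * n + b) \<in> cells n"
      then obtain u w where uw: "(u, w) \<in> ?A" "a * n + b = u * n + w \<or> a * n + b = w * n + u"
        unfolding cells_def by (auto simp flip: of_nat_mult of_nat_add simp del: of_nat_mult of_nat_add)
      then show "(a, b) \<in> ?A \<or> (b, a) \<in> ?A" using idx[of a b u w] idx[of a b w u] An that by auto
    next
      assume "(a, b) \<in> ?A \<or> (b, a) \<in> ?A"
      then show "int (a * n + b) \<in> cells n" unfolding cells_def using An by fastforce
    qed
    show "output_edges n s1 = matched_edges n k h E \<omega> \<rho> (0 < bit)"
    proof (intro equalityI subsetI)
      fix e assume "e \<in> output_edges n s1"
      then obtain u v where "e = {u, v}" "v < n" "int (u * n + v) \<in> cells n" unfolding out by auto
      then show "e \<in> matched_edges n k h E \<omega> \<rho> (0 < bit)"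
        using mem[of v u] unfolding matched_edges_def by (force simp: insert_commute)
    next
      fix e assume "e \<in> matched_edges n k h E \<omega> \<rho> (0 < bit)"
      then obtain u w where uw: "e = {u, w}" "(u, w) \<in> ?A" unfolding matched_edges_def by auto
      then consider "u < w" | "w < u" using An by (meson linorder_neqE_nat)
      then show "e \<in> output_edges n s1"
      proof cases
        case 1
        then show ?thesis unfolding out using uw An[OF uw(2)] mem[of w u] by blast
      next
        case 2
        then show ?thesis unfolding out using uw An[OF uw(2)] mem[of u w] by (auto simp: insert_commute)
      qed
    qed
  qed (use s B(1,2) in \<open>auto simp: set_cell_array base_def cells_def\<close>)
qed

end

section \<open>Correctness, running time and sensitivity\<close>

definition computation :: "nat \<Rightarrow> nat \<Rightarrow> com" where
  "computation k h = Seq degree_phase (Seq (auction k) (Seq (leader_phase h) output_phase))"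

text \<open>All random numbers are drawn before the edges are inspected; their number and ranges
  depend only on \<open>n\<close>, \<open>k\<close> and \<open>h\<close>, as the coupling
  requires.\<close>

definition matching_com :: "nat \<Rightarrow> nat \<Rightarrow> com" where
  "matching_com k h =
     Seq (For 1 (Times (V 0) (Times (Lit (int k)) (V 0)))
           (Draw 3 (V 1) (Times (Lit (int (2 * (k * k)))) (Plus (V 0) (Lit 1)))))
     (Seq (For 1 (Times (V 0) (Lit (int h + 1))) (Draw 4 (V 1) (Lit (int h + 2))))
     (Seq (Draw 9 (Lit 0) (Lit 2)) (computation k h)))"

definition computation_steps :: "nat \<Rightarrow> nat \<Rightarrow> nat \<Rightarrow> nat" where
  "computation_steps n k h = (n * (n * 4 + 4) + 2) + (((n * (k * n) + 1) * (n * 19 + 6) + 2) +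
     ((n * (h * 9 + 10) + 2) + (n * 7 + 2)))"

definition total_steps :: "nat \<Rightarrow> nat \<Rightarrow> nat \<Rightarrow> nat" where
  "total_steps n k h = (n * (k * n) * 3 + 2) + ((n * Suc h * 3 + 2) + (1 + computation_steps n k h))"

context matching_program
begin

lemma wp_computation:
  assumes s: "mem_le B s" "base s" and zero: "\<And>a i. a \<in> {2, 5, 6, 7} \<Longrightarrow> s a i = 0"
  shows "wp B (computation k h) (computation_steps n k h)
    (\<lambda>s'. output_edges n s' = matched_edges n k h E \<omega> \<rho> (0 < bit)) s"
  unfolding computation_def computation_steps_def
proof (rule wp_Seq, rule wp_mono[OF wp_degree_phase[OF s] order_refl])
  fix s1 assume s1: "mem_le B s1"
    "base s1 \<and> (\<forall>a\<in>{2, 5, 6, 8}. s1 a = s a) \<and> (\<forall>w<n. s1 7 (int w) = int (deg E w))"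
  show "wp B (Seq (auction k) (Seq (leader_phase h) output_phase)) (((n * (k * n) + 1) * (n * 19 + 6) + 2) +
     ((n * (h * 9 + 10) + 2) + (n * 7 + 2))) (\<lambda>s'. output_edges n s' = matched_edges n k h E \<omega> \<rho> (0 < bit)) s1"
  proof (rule wp_Seq, rule wp_mono[OF wp_auction order_refl])
    fix s2 assume s2: "mem_le B s2" "base s2 \<and> (\<forall>a\<in>{2, 8}. s2 a = s1 a) \<and>
      (\<forall>w<n. s2 6 (int w) = int (best_key n (proposals {..<n} (final {..<n} (below (threshold n E) \<omega>))) w))"
    show "wp B (Seq (leader_phase h) output_phase) ((n * (h * 9 + 10) + 2) + (n * 7 + 2))
        (\<lambda>s'. output_edges n s' = matched_edges n k h E \<omega> \<rho> (0 < bit)) s2"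
    proof (rule wp_Seq, rule wp_mono[OF wp_leader_phase order_refl])
      fix s3 assume s3: "mem_le B s3" "base s3 \<and> s3 2 = s2 2 \<and> s3 6 = s2 6 \<and>
        (\<forall>v<n. s3 8 (int v) = (if side n h (ranks \<rho>) (parent (arc_set n k E \<omega>)) v then 1 else 0))"
      show "wp B output_phase (n * 7 + 2) (\<lambda>s'. output_edges n s' = matched_edges n k h E \<omega> \<rho> (0 < bit)) s3"
        by (rule wp_output_phase) (use s1 s2 s3 zero in auto)
    qed (use s2 in auto)
  qed (use s1 zero in auto)
qed (use zero in auto)

end

section \<open>Joining the random draws with the deterministic computation\<close>

lemma input_memory_adjacency:
  assumes "u < n" "w < n"
  shows "input_memory n E 1 (int u * int n + int w) = (if adjacent E u w then 1 else 0)"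
proof -
  have uniq: "u = u' \<and> w = w'" if "int u * int n + int w = int (u' * n + w')" "w' < n" for u' w'
  proof -
    from that(1) have "u * n + w = u' * n + w'" by (metis of_nat_add of_nat_eq_iff of_nat_mult)
    then have "(u * n + w) div n = (u' * n + w') div n" "(u * n + w) mod n = (u' * n + w') mod n"
      by simp_all
    then show ?thesis using assms that(2) by simp
  qed
  have "(\<exists>u'<n. \<exists>w'<n. int u * int n + int w = int (u' * n + w') \<and> {u', w'} \<in> E) \<longleftrightarrow> {u, w} \<in> E"
  proof
    assume "{u, w} \<in> E"
    moreover have "int u * int n + int w = int (u * n + w)" by simp
    ultimately show "\<exists>u'<n. \<exists>w'<n. int u * int n + int w = int (u' * n + w') \<and> {u', w'} \<in> E"
      using assms by blast
  qed (use uniq in blast)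
  then show ?thesis by (simp add: input_memory_def adjacent_def)
qed

lemma yields_unique: "yields B c T (return_pmf s1) s \<Longrightarrow> yields B c T' (return_pmf s2) s \<Longrightarrow> s1 = s2"
  by (metis yields_def return_pmf_inj)

lemma yields_matching_com:
  assumes sg: "simple_graph {..<n} E" and k: "0 < k"
    and B: "100 \<le> B" "int n \<le> B" "int (2 * (k * k) * Suc n) \<le> B" "int (n * (k * n) + n + 1) \<le> B"
      "int ((h + 3) * (n * Suc h)) \<le> B" "int (h + 3) \<le> B"
  obtains \<mu> where "yields B (matching_com k h) (total_steps n k h) \<mu> (input_memory n E)"
    "map_pmf (output_edges n) \<mu> = random_matching n k h E"
proof -
  let ?s0 = "input_memory n E"
  let ?\<Omega> = "deferred_acceptance.coins n k (coin_range n k)" and ?\<Lambda> = "labels n h"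
  define g1 where "g1 \<omega> = (set_cell 0 1 (int (n * (k * n))) ?s0)
      (3 := \<lambda>i. if i \<in> {0..<int (n * (k * n))} then \<omega> i else ?s0 3 i)" for \<omega> :: "int \<Rightarrow> int"
  define g2 where "g2 s \<rho> = (set_cell 0 1 (int (n * Suc h)) s)
      (4 := \<lambda>i. if i \<in> {0..<int (n * Suc h)} then \<rho> i else s 4 i)" for s :: memory and \<rho> :: "int \<Rightarrow> int"
  define g3 where "g3 s b = set_cell 9 0 b s" for s :: memory and b :: int
  \<comment> \<open>Picks the final memory of the deterministic part, unique by
    \<open>yields_unique\<close>, as a function of the memory after the draws; \<open>g1\<close>,
    \<open>g2\<close> and \<open>g3\<close> describe the three groups of draws.\<close>
  define H where "H s = (SOME s'. yields B (computation k h) (computation_steps n k h) (return_pmf s') s)" for s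
  define T1 where "T1 = n * (k * n) * 3 + 2"
  define T2 where "T2 = n * Suc h * 3 + 2"
  have B2: "2 \<le> B" "1 \<le> B" "0 \<le> B" using B(1) by auto
  have "2 * (k * k) \<le> 2 * (k * k) * Suc n" "k \<le> 2 * (k * k)" by (simp, cases k, simp_all)
  then have kB: "int (2 * (k * k)) \<le> B" "int k \<le> B" using B(3) by linarith+
  have NB: "int (n * (k * n)) \<le> B" "int (n * Suc h) \<le> B"
  proof -
    show "int (n * (k * n)) \<le> B" using B(4) by linarith
    have "n * Suc h \<le> (h + 3) * (n * Suc h)" by simp
    then show "int (n * Suc h) \<le> B" using B(5) by linarith
  qed
  have m0: "mem_le B ?s0" using B(1,2) by (auto simp: mem_le_def input_memory_def)
  have in0: "?s0 0 0 = int n" by (simp add: input_memory_def)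
  have y1: "yields B (For 1 (Times (V 0) (Times (Lit (int k)) (V 0)))
      (Draw 3 (V 1) (Times (Lit (int (2 * (k * k)))) (Plus (V 0) (Lit 1))))) T1 (map_pmf g1 ?\<Omega>) ?s0"
    unfolding g1_def deferred_acceptance.coins_def T1_def
  proof (rule yields_For_Draw[where J = "\<lambda>s. s 0 0 = int n"])
    show "\<And>s. s 0 0 = int n \<Longrightarrow> val (Times (V 0) (Times (Lit (int k)) (V 0))) s = int (n * (k * n))" by simp
    show "\<And>s. s 0 0 = int n \<Longrightarrow> val (Times (Lit (int (2 * (k * k)))) (Plus (V 0) (Lit 1))) s = coin_range n k"
      by (simp add: coin_range_def algebra_simps)
    show "0 < coin_range n k" using coin_range_pos[OF k] .
    show "coin_range n k \<le> B" using B(3) by (simp only: coin_range_def)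
    show "small B (Times (Lit (int (2 * (k * k)))) (Plus (V 0) (Lit 1)))" using kB B2 by (simp add: small_def)
  qed (use B2 kB NB m0 in0 in \<open>simp_all add: set_cell_array\<close>)
  have y2: "yields B (For 1 (Times (V 0) (Lit (int h + 1))) (Draw 4 (V 1) (Lit (int h + 2)))) T2 (map_pmf (g2 s) ?\<Lambda>) s"
    if "mem_le B s" "s 0 0 = int n" for s
    unfolding g2_def[abs_def] labels_def T2_def
  proof (rule yields_For_Draw[where J = "\<lambda>s. s 0 0 = int n"])
    show "\<And>s. s 0 0 = int n \<Longrightarrow> val (Times (V 0) (Lit (int h + 1))) s = int (n * Suc h)" by (simp add: algebra_simps)
    show "small B (Lit (int h + 2))" using B(6) by (simp add: small_def)
  qed (use B2 B(6) NB that in \<open>simp_all add: set_cell_array\<close>)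
  have y3: "yields B (Draw 9 (Lit 0) (Lit 2)) 1 (map_pmf (g3 s) (uniform 2)) s" if "mem_le B s" for s
    using yields_Draw[of B s "Lit 0" "Lit 2" 9] that B2 by (simp add: small_def g3_def[abs_def])
  have comp: "wp B (computation k h) (computation_steps n k h)
      (\<lambda>s'. output_edges n s' = matched_edges n k h E \<omega> \<rho> (0 < b)) (g3 (g2 (g1 \<omega>) \<rho>) b)"
    if \<omega>: "\<omega> \<in> set_pmf ?\<Omega>" and \<rho>: "\<rho> \<in> set_pmf ?\<Lambda>" and b: "b \<in> {0..<2}" and m: "mem_le B (g3 (g2 (g1 \<omega>) \<rho>) b)" for \<omega> \<rho> b
  proof -
    \<comment> \<open>Samples are 0 outside their index range, just as the untouched memory is, so
      the filled array equals the sample everywhere.\<close>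
    have \<omega>0: "\<omega> i = 0" if "i \<notin> {0..<int (n * (k * n))}" for i
      using \<omega> that set_Pi_pmf_subset[of "{0..<int (n * (k * n))}" 0 "\<lambda>_. uniform (coin_range n k)"]
      by (auto simp: deferred_acceptance.coins_def)
    have "\<rho> \<in> PiE_dflt {0..<int (n * Suc h)} 0 (set_pmf \<circ> (\<lambda>_. uniform (int h + 2)))"
      using \<rho> set_Pi_pmf_subset'[of "{0..<int (n * Suc h)}" 0 "\<lambda>_. uniform (int h + 2)"]
      by (auto simp: labels_def)
    then have \<rho>0: "\<rho> i = 0" if "i \<notin> {0..<int (n * Suc h)}" for i
      using that by (auto simp: PiE_dflt_def)
    have \<rho>1: "0 \<le> \<rho> i \<and> \<rho> i < int h + 2" for i
    proof (cases "i \<in> {0..<int (n * Suc h)}")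
      case True
      then have "\<rho> i \<in> set_pmf (uniform (int h + 2))"
        using \<open>\<rho> \<in> PiE_dflt _ _ _\<close> by (simp only: PiE_dflt_def) auto
      then show ?thesis by (simp add: set_uniform)
    next
      case False
      then show ?thesis using \<rho>0 by simp
    qed
    have bb: "b = 0 \<or> b = 1" using b by auto
    interpret M: matching_program n k h E \<omega> \<rho> "?s0 1" b B
      by (rule matching_program.intro[OF sg k input_memory_adjacency \<rho>1[THEN conjunct1] \<rho>1[THEN conjunct2] bb B])
    have arr: "g3 (g2 (g1 \<omega>) \<rho>) b 3 = \<omega>" "g3 (g2 (g1 \<omega>) \<rho>) b 4 = \<rho>"
    proof -
      have "g3 (g2 (g1 \<omega>) \<rho>) b 3 = (\<lambda>i. if i \<in> {0..<int (n * (k * n))} then \<omega> i else ?s0 3 i)"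
        unfolding g3_def g2_def g1_def by (simp add: set_cell_array)
      also have "\<dots> = \<omega>" by (rule ext) (simp add: \<omega>0 input_memory_def del: of_nat_mult atLeastLessThan_iff)
      finally show "g3 (g2 (g1 \<omega>) \<rho>) b 3 = \<omega>" .
      have "g3 (g2 (g1 \<omega>) \<rho>) b 4 = (\<lambda>i. if i \<in> {0..<int (n * Suc h)} then \<rho> i else ?s0 4 i)"
        unfolding g3_def g2_def g1_def by (rule ext) (auto simp: set_cell_array)
      also have "\<dots> = \<rho>" by (rule ext) (simp add: \<rho>0 input_memory_def del: of_nat_mult atLeastLessThan_iff mult_Suc_right)
      finally show "g3 (g2 (g1 \<omega>) \<rho>) b 4 = \<rho>" .
    qed
    have "M.base (g3 (g2 (g1 \<omega>) \<rho>) b)"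
      unfolding M.base_def arr by (simp add: g3_def g2_def g1_def set_cell_array in0)
    moreover have "g3 (g2 (g1 \<omega>) \<rho>) b a i = 0" if a: "a \<in> {2, 5, 6, 7}" for a i
    proof -
      have ne: "a \<noteq> 0" "a \<noteq> 1" "a \<noteq> 3" "a \<noteq> 4" "a \<noteq> 9" using a by auto
      then have "g3 (g2 (g1 \<omega>) \<rho>) b a = ?s0 a"
        unfolding g3_def g2_def g1_def by (simp add: set_cell_array)
      then show ?thesis using ne by (simp add: input_memory_def)
    qed
    ultimately show ?thesis using m M.wp_computation by blast
  qed
  have mem1: "mem_le B s \<and> s 0 0 = int n" if "s \<in> set_pmf (map_pmf g1 ?\<Omega>)" for s
    using that yields_mem_le[OF y1] by (auto simp: g1_def set_cell_array in0)
  have mem2: "mem_le B s'" if "s \<in> set_pmf (map_pmf g1 ?\<Omega>)" "s' \<in> set_pmf (map_pmf (g2 s) ?\<Lambda>)" for s s'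
    using yields_mem_le[OF y2] mem1[OF that(1)] that(2) by blast
  have y4: "yields B (computation k h) (computation_steps n k h) (return_pmf (H s)) s \<and>
      output_edges n (H s) = matched_edges n k h E \<omega> \<rho> (0 < b)"
    if \<omega>: "\<omega> \<in> set_pmf ?\<Omega>" and \<rho>: "\<rho> \<in> set_pmf ?\<Lambda>" and b: "b \<in> {0..<2}" and s: "s = g3 (g2 (g1 \<omega>) \<rho>) b" for \<omega> \<rho> b s
  proof -
    have "mem_le B (g2 (g1 \<omega>) \<rho>)" by (rule mem2[of "g1 \<omega>"]) (use \<omega> \<rho> in auto)
    then have "mem_le B s" unfolding s g3_def using b B by (intro mem_le_set_cell) auto
    from comp[OF \<omega> \<rho> b this[unfolded s]] obtain s' where s':
      "yields B (computation k h) (computation_steps n k h) (return_pmf s') s"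
      "output_edges n s' = matched_edges n k h E \<omega> \<rho> (0 < b)" unfolding s wp_def by blast
    have "yields B (computation k h) (computation_steps n k h) (return_pmf (H s)) s"
      unfolding H_def by (rule someI[where P = "\<lambda>s'. yields _ _ _ (return_pmf s') s", OF s'(1)])
    moreover from this s'(1) have "H s = s'" by (rule yields_unique)
    ultimately show ?thesis using s'(2) by simp
  qed
  let ?\<mu> = "bind_pmf (map_pmf g1 ?\<Omega>) (\<lambda>s. bind_pmf (map_pmf (g2 s) ?\<Lambda>)
      (\<lambda>s. bind_pmf (map_pmf (g3 s) (uniform 2)) (\<lambda>s. return_pmf (H s))))"
  have two: "set_pmf (uniform 2) = {0..<2}" by (simp add: set_uniform)
  have "yields B (matching_com k h) (T1 + (T2 + (1 + computation_steps n k h))) ?\<mu> ?s0"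
    unfolding matching_com_def
  proof (rule yields_Seq[OF y1], rule yields_Seq[OF y2])
    fix s assume s: "s \<in> set_pmf (map_pmf g1 ?\<Omega>)"
    show "mem_le B s" "s 0 0 = int n" using mem1[OF s] by auto
    fix s' assume s': "s' \<in> set_pmf (map_pmf (g2 s) ?\<Lambda>)"
    show "yields B (Seq (Draw 9 (Lit 0) (Lit 2)) (computation k h)) (1 + computation_steps n k h)
        (bind_pmf (map_pmf (g3 s') (uniform 2)) (\<lambda>s. return_pmf (H s))) s'"
    proof (rule yields_Seq[OF y3[OF mem2[OF s s']]])
      fix s'' assume "s'' \<in> set_pmf (map_pmf (g3 s') (uniform 2))"
      then obtain b where b: "b \<in> {0..<2}" "s'' = g3 s' b" unfolding set_map_pmf two by blast
      from s s' obtain \<omega> \<rho> where "\<omega> \<in> set_pmf ?\<Omega>" "\<rho> \<in> set_pmf ?\<Lambda>" "s'' = g3 (g2 (g1 \<omega>) \<rho>) b"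
        unfolding b(2) by auto
      from y4[OF this(1,2) b(1) this(3)]
      show "yields B (computation k h) (computation_steps n k h) (return_pmf (H s'')) s''" by blast
    qed
  qed
  moreover have "map_pmf (output_edges n) ?\<mu> = random_matching n k h E"
  proof -
    have "?\<mu> = map_pmf (\<lambda>(\<omega>, \<rho>, b). H (g3 (g2 (g1 \<omega>) \<rho>) b)) (randomness n k h)"
      unfolding randomness_def pair_pmf_def
      by (simp add: map_pmf_def bind_assoc_pmf bind_return_pmf)
    then have "map_pmf (output_edges n) ?\<mu> =
        map_pmf (\<lambda>(\<omega>, \<rho>, b). output_edges n (H (g3 (g2 (g1 \<omega>) \<rho>) b))) (randomness n k h)"
      by (simp add: pmf.map_comp o_def case_prod_unfold)
    also have "\<dots> = random_matching n k h E"
      unfolding random_matching_def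
    proof (rule map_pmf_cong[OF refl], clarify)
      fix \<omega> \<rho> b assume "(\<omega>, \<rho>, b) \<in> set_pmf (randomness n k h)"
      then have "\<omega> \<in> set_pmf ?\<Omega>" "\<rho> \<in> set_pmf ?\<Lambda>" "b \<in> {0..<2}"
        unfolding randomness_def set_pair_pmf two by auto
      from y4[OF this refl] show "output_edges n (H (g3 (g2 (g1 \<omega>) \<rho>) b)) = matched_edges n k h E \<omega> \<rho> (0 < b)"
        by blast
    qed
    finally show ?thesis .
  qed
  ultimately show ?thesis using that unfolding total_steps_def T1_def T2_def by blast
qed

section \<open>Numerical bounds\<close>

lemma le_two_powr: "x \<le> 2 powr (x :: real)"
proof (cases "x \<le> 0")
  case True
  then show ?thesis by (meson order_trans powr_ge_zero)
next
  case False
  define m where "m = nat \<lfloor>x\<rfloor>"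
  have m: "real m \<le> x" "x \<le> real m + 1" using False by (auto simp: m_def)
  have "Suc m \<le> 2 ^ m" by (rule Suc_leI) (rule less_exp)
  then have "real m + 1 \<le> 2 ^ m" by (metis of_nat_Suc of_nat_mono of_nat_numeral of_nat_power add.commute)
  also have "\<dots> = 2 powr real m" by (simp add: powr_realpow)
  also have "\<dots> \<le> 2 powr x" using m by simp
  finally show ?thesis using m by linarith
qed

lemma log2_le_self: "0 < x \<Longrightarrow> log 2 x \<le> x"
  using le_two_powr[of x] by (simp add: log_le_iff)

text \<open>With h = 6 k, labels reach (6 k + 3) (6 k + 1) n \<le> 63 k^2 n, and keys are of order k
  n^2; the product form with constant 100 dominates both.\<close>

definition memory_bound :: "nat \<Rightarrow> nat \<Rightarrow> int" where
  "memory_bound n k = int (100 * (k * k) * (Suc n * Suc n))"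

lemma memory_bound_ge:
  assumes "0 < k"
  shows "100 \<le> memory_bound n k" "int n \<le> memory_bound n k"
    "int (2 * (k * k) * Suc n) \<le> memory_bound n k" "int (n * (k * n) + n + 1) \<le> memory_bound n k"
    "int ((6 * k + 3) * (n * Suc (6 * k))) \<le> memory_bound n k" "int (6 * k + 3) \<le> memory_bound n k"
proof -
  let ?M = "100 * (k * k) * (Suc n * Suc n)"
  have kk: "1 \<le> k * k" "k \<le> k * k" using assms by (cases k; simp)+
  have nn: "1 \<le> Suc n * Suc n" "Suc n \<le> Suc n * Suc n" by simp_all
  have mono: "a * b * c \<le> ?M" if "a \<le> 100" "b \<le> k * k" "c \<le> Suc n * Suc n" for a b c
    using that by (intro mult_le_mono)
  have "100 * 1 * 1 \<le> ?M" by (intro mono kk nn) simp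
  then show "100 \<le> memory_bound n k" unfolding memory_bound_def by linarith
  have "1 * 1 * Suc n \<le> ?M" by (intro mono kk nn) simp
  then have "n \<le> ?M" by (rule order_trans[rotated]) simp
  then show "int n \<le> memory_bound n k" unfolding memory_bound_def by (simp only: of_nat_le_iff)
  have "2 * (k * k) * Suc n \<le> ?M" by (intro mono nn) simp_all
  then show "int (2 * (k * k) * Suc n) \<le> memory_bound n k" unfolding memory_bound_def by (simp only: of_nat_le_iff)
  have "n * (k * n) + n + 1 \<le> 1 * k * (Suc n * Suc n)" using assms by (cases k) (simp_all add: algebra_simps)
  also have "\<dots> \<le> ?M" by (intro mono kk) simp_all
  finally show "int (n * (k * n) + n + 1) \<le> memory_bound n k" unfolding memory_bound_def by (simp only: of_nat_le_iff)
  have "(6 * k + 3) * Suc (6 * k) \<le> (9 * k) * (7 * k)" using assms by (intro mult_le_mono) auto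
  then have "(6 * k + 3) * Suc (6 * k) * n \<le> (9 * k) * (7 * k) * n" by (rule mult_le_mono1)
  also have "\<dots> = 63 * (k * k) * n" by simp
  also have "\<dots> \<le> ?M" by (intro mono) simp_all
  finally have "(6 * k + 3) * (n * Suc (6 * k)) \<le> ?M" by (simp only: ac_simps)
  then show "int ((6 * k + 3) * (n * Suc (6 * k))) \<le> memory_bound n k" unfolding memory_bound_def by (simp only: of_nat_le_iff)
  have "6 * k + 3 \<le> 9 * k * 1" using assms by simp
  also have "\<dots> \<le> ?M" by (intro mono kk nn) simp
  finally show "int (6 * k + 3) \<le> memory_bound n k" unfolding memory_bound_def by (simp only: of_nat_le_iff)
qed

text \<open>The constant 11 collects 2 from \<open>bits\<close>, 7 from the logarithm of 100 and 2
  from replacing \<open>Suc n\<close> by 2 n in the square. Each of 1, k and L = \<open>?L\<close>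
  is at most k L, and 11 + 2 + 2 = 15.\<close>

lemma bits_memory_bound_le:
  assumes k: "0 < k"
  shows "real (bits (memory_bound n k)) \<le> 15 * real k * max 1 (log 2 (real n))"
proof -
  let ?L = "max 1 (log 2 (real n))"
  define M where "M = 100 * (k * k) * (Suc n * Suc n)"
  have "0 < M" using k by (simp add: M_def)
  then have M: "1 \<le> M" by simp
  define x where "x = log 2 (real M)"
  have "0 \<le> x" unfolding x_def using M by (subst zero_le_log_cancel_iff) auto
  then have "real (nat \<lfloor>x\<rfloor>) \<le> x" by (rule of_nat_floor)
  moreover have "floorlog 2 M = nat \<lfloor>x\<rfloor> + 1" unfolding floorlog_def x_def using M by simp
  ultimately have "real (floorlog 2 M) \<le> log 2 (real M) + 1" by (simp add: x_def)
  then have "real (bits (memory_bound n k)) \<le> 2 + log 2 (real M)"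
  proof -
    have "memory_bound n k = int M" by (simp only: memory_bound_def M_def)
    then show ?thesis using \<open>real (floorlog 2 M) \<le> _\<close> by (simp add: bits_def)
  qed
  also have "log 2 (real M) = log 2 100 + 2 * log 2 (real k) + 2 * log 2 (real (Suc n))"
  proof -
    have "real M = 100 * (real k * real k) * (real (Suc n) * real (Suc n))"
      by (simp only: M_def of_nat_mult of_nat_numeral)
    then show ?thesis using k by (simp add: log_mult del: of_nat_Suc)
  qed
  also have "log 2 (100 :: real) \<le> 7" by (simp add: log_le_iff powr_numeral)
  also have "log 2 (real k) \<le> real k" using k by (intro log2_le_self) simp
  also have "log 2 (real (Suc n)) \<le> 1 + ?L"
  proof (cases "n = 0")
    case False
    have "log 2 (real (Suc n)) \<le> log 2 (2 * real n)" using False by simp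
    also have "\<dots> = 1 + log 2 (real n)" using False by (simp add: log_mult)
    finally show ?thesis by linarith
  qed simp
  finally have "real (bits (memory_bound n k)) \<le> 11 + 2 * real k + 2 * ?L" by simp
  moreover have "1 * 1 \<le> real k * ?L" by (rule mult_mono) (use k in auto)
  moreover have "real k * 1 \<le> real k * ?L" by (rule mult_mono) (use k in auto)
  moreover have "1 * ?L \<le> real k * ?L" by (rule mult_mono) (use k in auto)
  ultimately have "real (bits (memory_bound n k)) \<le> 15 * (real k * ?L)" by linarith
  then show ?thesis by simp
qed

text \<open>The cubic term comes from the auction, with about k n^2 rounds of O(n) steps. The
  coefficients 3, 21, 4, 19, 64 and 7 of the phases add up to 118.\<close>

lemma total_steps_le:
  assumes "0 < k"
  shows "total_steps n k (6 * k) \<le> 200 * k * Suc n ^ 3"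
proof -
  define N where "N = Suc n"
  have N: "1 \<le> N" "n \<le> N" "1 \<le> k" using assms by (auto simp: N_def)
  have mono: "a * b * c \<le> a * k * N ^ 3" if "b \<le> k" "c \<le> N ^ 3" for a b c
    using that by (intro mult_le_mono) auto
  have N3: "1 \<le> N ^ 3" "N \<le> N ^ 3" "N ^ 2 \<le> N ^ 3"
    using N by (auto intro: one_le_power self_le_power power_increasing)
  have nn: "n * n \<le> N ^ 2" using N by (simp add: power2_eq_square mult_le_mono)
  have 1: "n * (k * n) * 3 + 2 \<le> 3 * k * N ^ 3 + 2"
    using mono[of k "n * n" 3] nn N3 by (simp add: ac_simps)
  have "n * Suc (6 * k) \<le> N * (7 * k)" using N by (intro mult_le_mono) auto
  also have "\<dots> = 7 * k * N" by simp
  finally have 2: "n * Suc (6 * k) * 3 + 2 \<le> 21 * k * N ^ 3 + 2"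
    using mono[of k N 21] N3 by linarith
  have "n * (n * 4 + 4) \<le> N * (N * 4)" by (intro mult_le_mono) (auto simp: N_def)
  then have 3: "n * (n * 4 + 4) + 2 \<le> 4 * k * N ^ 3 + 2"
    using mono[of 1 "N ^ 2" 4] N N3 by (simp add: power2_eq_square ac_simps)
  have "n * (k * n) + 1 \<le> k * (N * N)" using N by (cases k) (simp_all add: N_def algebra_simps)
  then have "(n * (k * n) + 1) * (n * 19 + 6) \<le> (k * (N * N)) * (19 * N)"
    by (intro mult_le_mono) (auto simp: N_def)
  then have 4: "(n * (k * n) + 1) * (n * 19 + 6) + 2 \<le> 19 * k * N ^ 3 + 2"
    by (simp add: power3_eq_cube ac_simps)
  have "n * (6 * k * 9 + 10) \<le> N * (64 * k)" using N by (intro mult_le_mono) auto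
  also have "\<dots> = 64 * k * N" by simp
  finally have 5: "n * (6 * k * 9 + 10) + 2 \<le> 64 * k * N ^ 3 + 2"
    using mono[of k N 64] N3 by linarith
  have 6: "n * 7 + 2 \<le> 7 * k * N ^ 3 + 2"
    using mono[of 1 n 7] N N3 by simp
  have 7: "1 \<le> k * N ^ 3" using N N3 by simp
  have "total_steps n k (6 * k) \<le> 118 * k * N ^ 3 + 13"
    unfolding total_steps_def computation_steps_def using 1 2 3 4 5 6 by linarith
  also have "\<dots> \<le> 200 * k * N ^ 3" using 7 by linarith
  finally show ?thesis by (simp add: N_def)
qed

lemma matching_com_correct:
  assumes E: "bipartite_graph {..<n} E" and k: "0 < k"
  shows "alg_output (matching_com k (6 * k)) n E = random_matching n k (6 * k) E"
    "lossless_spmf (run (matching_com k (6 * k)) n E)"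
    "runs_within (matching_com k (6 * k)) n E
       (3 * 10 ^ 7 * real k ^ 2 * real (Suc n) ^ 3 * max 1 (log 2 (real n)))"
proof -
  let ?c = "matching_com k (6 * k)" and ?B = "memory_bound n k" and ?L = "max 1 (log 2 (real n))"
  obtain \<mu> where \<mu>: "yields ?B ?c (total_steps n k (6 * k)) \<mu> (input_memory n E)"
    "map_pmf (output_edges n) \<mu> = random_matching n k (6 * k) E"
    using yields_matching_com[OF bipartite_simple[OF E] k memory_bound_ge[OF k]] by blast
  have run: "map_pmf (\<lambda>r. snd (the r)) (run ?c n E) = \<mu>"
    and some: "\<And>r. r \<in> set_pmf (run ?c n E) \<Longrightarrow>
      \<exists>t s'. r = Some (t, s') \<and> t \<le> total_steps n k (6 * k) * unit_cost ?B \<and> mem_le ?B s'"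
    using \<mu>(1) by (auto simp: yields_def run_def)
  show "alg_output ?c n E = random_matching n k (6 * k) E"
    unfolding alg_output_def \<mu>(2)[symmetric] run[symmetric] by (simp add: pmf.map_comp o_def)
  show "lossless_spmf (run ?c n E)"
    unfolding lossless_iff_set_pmf_None using some by fastforce
  have steps: "real (total_steps n k (6 * k)) \<le> 200 * real k * real (Suc n) ^ 3"
    using of_nat_mono[OF total_steps_le[OF k, of n], where ?'a = real] by simp
  have unit: "real (unit_cost ?B) \<le> 10000 * (15 * real k * ?L)"
    using bits_memory_bound_le[OF k, of n] by (simp add: unit_cost_def)
  show "runs_within ?c n E (3 * 10 ^ 7 * real k ^ 2 * real (Suc n) ^ 3 * ?L)"
    unfolding runs_within_def
  proof clarify
    fix t s assume "(t, s) \<in> set_spmf (run ?c n E)"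
    then have "Some (t, s) \<in> set_pmf (run ?c n E)" by (simp add: in_set_spmf)
    from some[OF this] have "t \<le> total_steps n k (6 * k) * unit_cost ?B" by simp
    then have "real t \<le> real (total_steps n k (6 * k)) * real (unit_cost ?B)"
      by (metis of_nat_mono of_nat_mult)
    \<comment> \<open>The factors 200, 10000 and 15 stem from the number of steps, the cost of a
      step and the bit length of the memory bound.\<close>
    also have "\<dots> \<le> (200 * real k * real (Suc n) ^ 3) * (10000 * (15 * real k * ?L))"
      using steps unit by (intro mult_mono) auto
    also have "\<dots> = 3 * 10 ^ 7 * real k ^ 2 * real (Suc n) ^ 3 * ?L"
      by (simp add: power2_eq_square del: of_nat_Suc)
    finally show "real t \<le> 3 * 10 ^ 7 * real k ^ 2 * real (Suc n) ^ 3 * ?L" .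
  qed
qed

lemma runs_within_mono: "runs_within P n E T \<Longrightarrow> T \<le> T' \<Longrightarrow> runs_within P n E T'"
  unfolding runs_within_def by (auto intro: order_trans)

text \<open>By \<open>le_two_powr\<close> powers of k move into the exponent. Here 300 * 4^3 = 19200
  is below 2 powr 15; the constant, x^3 and \<Delta>^2 then use up 15 x, 3 x and 2 x, which is the
  origin of 20.\<close>

lemma polynomial_le_powr:
  fixes x :: real and \<Delta> k :: nat
  assumes x: "1 < x" and k: "real k \<le> 4 * x" and \<Delta>: "2 \<le> \<Delta>" and k1: "1 \<le> k"
  shows "(2 * real (6 * k) + 3) * (20 * real k ^ 2 * real \<Delta> ^ 2) \<le> real \<Delta> powr (20 * x)"
proof -
  have "(2 * real (6 * k) + 3) * (20 * real k ^ 2 * real \<Delta> ^ 2) \<le> (15 * real k) * (20 * real k ^ 2 * real \<Delta> ^ 2)"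
    using k1 by (intro mult_right_mono) auto
  also have "\<dots> = 300 * real k ^ 3 * real \<Delta> ^ 2" by (simp add: power2_eq_square power3_eq_cube)
  also have "\<dots> \<le> 300 * (4 * x) ^ 3 * real \<Delta> ^ 2"
    using k by (intro mult_right_mono mult_left_mono power_mono) auto
  also have "\<dots> = 19200 * x ^ 3 * real \<Delta> ^ 2" by (simp add: power_mult_distrib)
  also have "\<dots> \<le> (2 powr (15 * x) * (2 powr x) ^ 3) * real \<Delta> ^ 2"
  proof (intro mult_right_mono mult_mono)
    have "(19200 :: real) \<le> 2 powr 15" by (simp add: powr_numeral)
    also have "\<dots> \<le> 2 powr (15 * x)" by (intro powr_mono) (use x in auto)
    finally show "19200 \<le> 2 powr (15 * x)" .
    show "x ^ 3 \<le> (2 powr x) ^ 3" using x by (intro power_mono le_two_powr) auto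
  qed (use x in auto)
  also have "2 powr (15 * x) * (2 powr x) ^ 3 = 2 powr (18 * x)"
    by (simp add: powr_power flip: powr_add)
  also have "2 powr (18 * x) * real \<Delta> ^ 2 \<le> real \<Delta> powr (18 * x) * real \<Delta> powr (2 * x)"
  proof (intro mult_mono)
    show "2 powr (18 * x) \<le> real \<Delta> powr (18 * x)" using x \<Delta> by (intro powr_mono2) auto
    have "real \<Delta> ^ 2 = real \<Delta> powr 2" using \<Delta> by (simp add: powr_numeral)
    also have "\<dots> \<le> real \<Delta> powr (2 * x)" using x \<Delta> by (intro powr_mono) auto
    finally show "real \<Delta> ^ 2 \<le> real \<Delta> powr (2 * x)" .
  qed auto
  also have "\<dots> = real \<Delta> powr (20 * x)" by (simp flip: powr_add)
  finally show ?thesis .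
qed

text \<open>An edge to delete forces \<Delta> \<ge> 1. For \<Delta> = 1 both outputs are the full
  edge sets, which differ in one edge and meet the bound 1 exactly; from \<Delta> = 2 on the
  polynomial bound is small enough.\<close>

lemma sensitivity_random_matching:
  assumes E: "bipartite_graph {..<n} E" and k: "1 \<le> k" "real k \<le> 4 * x" and x: "1 < x"
    and A: "\<And>F. bipartite_graph {..<n} F \<Longrightarrow> A F = random_matching n k (6 * k) F"
  shows "sensitivity A E \<le> real (max_degree {..<n} E) powr (20 * x)"
proof -
  have sg: "simple_graph {..<n} E" using E by (rule bipartite_simple)
  let ?\<Delta> = "max_degree {..<n} E"
  have "wasserstein (A E) (A (E - {e})) \<le> real ?\<Delta> powr (20 * x)" if e: "e \<in> E" for e
  proof -
    have F: "bipartite_graph {..<n} (E - {e})" using bipartite_subset[OF E] by blast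
    obtain a b where ab: "e = {a, b}" using sg e by (auto simp: simple_graph_def card_2_iff)
    have "0 < deg E b" using deg_pos[OF sg] e ab by blast
    moreover have "deg E b \<le> ?\<Delta>" using simple_graph_edge(2)[OF sg] e ab by (intro deg_le_max_degree) blast
    ultimately consider "?\<Delta> = 1" | "2 \<le> ?\<Delta>" by linarith
    then show ?thesis
    proof cases
      case 1
      have "max_degree {..<n} (E - {e}) \<le> 1"
        using max_degree_mono[OF finite_edges[OF sg], of "E - {e}" n] 1 by auto
      then have "A E = map_pmf (\<lambda>_. E) (return_pmf ())" "A (E - {e}) = map_pmf (\<lambda>_. E - {e}) (return_pmf ())"
        using A[OF E] A[OF F] random_matching_degree_one[OF E] random_matching_degree_one[OF F] 1 k by simp_all
      then have "wasserstein (A E) (A (E - {e})) \<le> measure_pmf.expectation (return_pmf ()) (\<lambda>_. real (card (sym_diff E (E - {e}))))"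
        by (simp only:) (rule wasserstein_map_le, simp)
      also have "sym_diff E (E - {e}) = {e}" using e by auto
      finally show ?thesis using 1 by simp
    next
      case 2
      have "wasserstein (A E) (A (E - {e})) \<le> (2 * real (6 * k) + 3) * (20 * real k ^ 2 * real ?\<Delta> ^ 2)"
        unfolding A[OF E] A[OF F] using k by (intro wasserstein_random_matching_le[OF sg e]) simp
      also have "\<dots> \<le> real ?\<Delta> powr (20 * x)" using x k 2 by (intro polynomial_le_powr)
      finally show ?thesis .
    qed
  qed
  then show ?thesis unfolding sensitivity_def using finite_edges[OF sg] by (subst Max_le_iff) auto
qed

theorem theorem1p3:
  shows "\<exists>C>0::real. \<exists>K>0::real. \<exists>k::nat. \<forall>\<epsilon>::real. 0 < \<epsilon> \<and> \<epsilon> < 1 \<longrightarrow>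
    (\<exists>P. approximation_algorithm_on (\<lambda>n E. bipartite_graph {..<n} E) (1 - \<epsilon>) P \<and>
      (\<forall>n E. bipartite_graph {..<n} E \<longrightarrow>
         sensitivity (alg_output P n) E \<le> real (max_degree {..<n} E) powr (C / \<epsilon>)) \<and>
      (\<forall>n E. bipartite_graph {..<n} E \<longrightarrow>
         runs_within P n E (K * polylog k n * time_bound \<epsilon> n E)))"
proof (rule exI[of _ 20], intro conjI, simp, rule exI[of _ "10 ^ 10"], intro conjI, simp,
    rule exI[of _ 1], intro allI impI)
  fix \<epsilon> :: real assume \<epsilon>: "0 < \<epsilon> \<and> \<epsilon> < 1"
  define x where "x = 1 / \<epsilon>"
  have x: "1 < x" using \<epsilon> by (simp add: x_def)
  \<comment> \<open>The factor 3 turns the loss 3/k into at most \<epsilon>; rounding up adds less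
    than 1 < x, so k stays below 4 x.\<close>
  define k where "k = nat \<lceil>3 * x\<rceil>"
  have "real k = of_int \<lceil>3 * x\<rceil>" using x by (simp add: k_def)
  then have k: "3 * x \<le> real k" "real k \<le> 4 * x" using x ceiling_correct[of "3 * x"] by linarith+
  then have k1: "1 \<le> k" "0 < k" using x by (auto simp: Suc_le_eq)
  let ?P = "matching_com k (6 * k)"
  have "approximation_algorithm_on (\<lambda>n E. bipartite_graph {..<n} E) (1 - \<epsilon>) ?P"
    unfolding approximation_algorithm_on_def matching_algorithm_on_def
  proof (intro conjI allI impI ballI)
    fix n :: nat and E assume E: "bipartite_graph {..<n} E"
    note correct = matching_com_correct[OF E k1(2)]
    show "lossless_spmf (run ?P n E)" by (rule correct)
    show "matching E M" if "M \<in> set_pmf (alg_output ?P n E)" for M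
      using that matching_matched_edges unfolding correct(1) random_matching_def by auto
    have "3 / real k \<le> 3 / (3 * x)" using k x by (intro divide_left_mono) auto
    then have "1 - \<epsilon> \<le> 1 - 3 / real k" using \<epsilon> by (simp add: x_def)
    then have "(1 - \<epsilon>) * real (matching_number E) \<le> (1 - 3 / real k) * real (matching_number E)"
      by (rule mult_right_mono) simp
    also have "\<dots> \<le> measure_pmf.expectation (alg_output ?P n E) (\<lambda>M. real (card M))"
      unfolding correct(1) using E k1(2) by (rule expected_random_matching_ge)
    finally show "(1 - \<epsilon>) * real (matching_number E) \<le> measure_pmf.expectation (alg_output ?P n E) (\<lambda>M. real (card M))" .
  qed
  moreover have "sensitivity (alg_output ?P n) E \<le> real (max_degree {..<n} E) powr (20 / \<epsilon>)"
    if "bipartite_graph {..<n} E" for n :: nat and E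
    using sensitivity_random_matching[OF that k1(1) k(2) x, of "alg_output ?P n"] matching_com_correct(1)[OF _ k1(2)]
    by (simp add: x_def)
  moreover have "runs_within ?P n E (10 ^ 10 * polylog 1 n * time_bound \<epsilon> n E)" if E: "bipartite_graph {..<n} E" for n :: nat and E
  proof -
    let ?L = "max 1 (log 2 (real n))" and ?n = "real (max 1 n)"
    let ?D = "max 1 (log 2 (real (max_degree {..<n} E)))" and ?m = "real (max 1 (card E))"
    \<comment> \<open>With k \<le> 4 x and n + 1 \<le> 2 \<open>?n\<close> the constant becomes 3 *
      10^7 * 16 * 8, which is below 10^10.\<close>
    have "3 * 10 ^ 7 * real k ^ 2 * real (Suc n) ^ 3 * ?L \<le> 3 * 10 ^ 7 * (4 * x) ^ 2 * (2 * ?n) ^ 3 * ?L"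
      using k by (intro mult_right_mono mult_mono power_mono) auto
    also have "\<dots> = 3840000000 * (x ^ 2 * ?n ^ 3 * ?L)" by (simp add: power_mult_distrib)
    also have "\<dots> \<le> 10 ^ 10 * (x ^ 3 * ?n ^ 16 * ?L)"
      using x by (intro mult_mono power_increasing) auto
    also have "\<dots> = 10 ^ 10 * (x ^ 3 * ?n ^ 16 * ?L) * 1 * 1" by simp
    also have "\<dots> \<le> 10 ^ 10 * (x ^ 3 * ?n ^ 16 * ?L) * ?m ^ 3 * ?D ^ 3"
      using x by (intro mult_mono one_le_power mult_nonneg_nonneg) auto
    also have "\<dots> = 10 ^ 10 * polylog 1 n * time_bound \<epsilon> n E"
      by (simp add: polylog_def time_bound_def x_def)
    finally show ?thesis using matching_com_correct(3)[OF E k1(2)] by (rule runs_within_mono[rotated])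
  qed
  ultimately show "\<exists>P. approximation_algorithm_on (\<lambda>n E. bipartite_graph {..<n} E) (1 - \<epsilon>) P \<and>
      (\<forall>n E. bipartite_graph {..<n} E \<longrightarrow>
         sensitivity (alg_output P n) E \<le> real (max_degree {..<n} E) powr (20 / \<epsilon>)) \<and>
      (\<forall>n E. bipartite_graph {..<n} E \<longrightarrow>
         runs_within P n E (10 ^ 10 * polylog 1 n * time_bound \<epsilon> n E))"
    by blast
qed

end
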